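(* Let $(M,g,f)$ be an oriented four-dimensional gradient Ricci soliton, i.e. $(M,g)$ is an oriented Riemannian four-manifold and $f\in C^\infty(M)$, $\lambda\in\mathbb{R}$ satisfy $\mathrm{Ric}+\nabla^2f=\lambda g$. Then, for each choice of sign $\pm$ (the same throughout), $$\Delta_f|W^{\pm}|^2=2|\nabla W^{\pm}|^2+4\lambda|W^{\pm}|^2-36\det W^{\pm}-\big\langle(\mathrm{Ric}\circ\mathrm{Ric})^{\pm},W^{\pm}\big\rangle .$$
   Context: Curvature sign convention: $K(e_i,e_j)=R_{ijij}$ for orthonormal $e_i,e_j$, $R_{ik}=g^{jl}R_{ijkl}$. $W$ is the Weyl tensor, viewed as a $(0,4)$-tensor and as the symmetric operator on $\wedge^2TM$ with $\langle W(e_i\wedge e_j),e_k\wedge e_l\rangle=W_{ijkl}$, where $\{e_i\wedge e_j\}_{i<j}$ is orthonormal for an orthonormal frame $\{e_i\}$. The Hodge star gives $\wedge^2TM=\wedge^+M\oplus\wedge^-M$ ($\pm1$ eigenbundles); $\alpha^{\pm}$ denotes the projection of $\alpha$ to $\wedge^{\pm}M$. For a $(0,4)$-tensor $T$ antisymmetric in its first two and in its last two indices, $T^{\pm}(\alpha,\beta)=T(\alpha^{\pm},\beta^{\pm})$. $W^{\pm}$ are the self-dual and anti-self-dual parts of $W$; $\det W^{\pm}$ is the determinant of $W^{\pm}$ as an endomorphism of the rank-3 bundle $\wedge^{\pm}M$. Inner product of $(0,4)$-tensors: $\langle S,T\rangle=\frac14S_{ijkl}T^{ijkl}$, $|T|^2=\langle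 T,T\rangle$, $|\nabla T|^2=\frac14\nabla_pT_{ijkl}\nabla^pT^{ijkl}$. Also $\Delta_f=\Delta-\langle\nabla f,\nabla\,\cdot\,\rangle$, where $\Delta=\nabla^p\nabla_p$. For symmetric $(0,2)$-tensors $\alpha,\beta$, $(\alpha\circ\beta)_{ijkl}=\alpha_{ik}\beta_{jl}+\alpha_{jl}\beta_{ik}-\alpha_{il}\beta_{jk}-\alpha_{jk}\beta_{il}$. *)

theory Defs
  imports "HOL-Analysis.Analysis"
begin

definition pd :: "4 \<Rightarrow> (real^4 \<Rightarrow> real) \<Rightarrow> real^4 \<Rightarrow> real" where
  "pd i u x = frechet_derivative u (at x) (axis i 1)"

fun Ck_on :: "nat \<Rightarrow> (real^4) set \<Rightarrow> (real^4 \<Rightarrow> real) \<Rightarrow> bool" where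
  "Ck_on 0 S u = continuous_on S u"
| "Ck_on (Suc k) S u =
     ((\<forall>x\<in>S. u differentiable (at x)) \<and> (\<forall>i. Ck_on k S (pd i u)))"

definition smooth_on :: "(real^4) set \<Rightarrow> (real^4 \<Rightarrow> real) \<Rightarrow> bool" where
  "smooth_on S u \<longleftrightarrow> (\<forall>k. Ck_on k S u)"

text \<open>A chart is a pair of its domain \<open>U\<close> and its coordinate map, only the values of the latter
  on \<open>U\<close> being relevant. An orientation is given by an atlas whose transition maps have positive
  Jacobian determinant; the charts of the atlas are the positively oriented ones. The atlas
  need not be maximal.\<close>

type_synonym 'm chart = "'m set \<times> ('m \<Rightarrow> real^4)"

definition chart_image :: "'m chart \<Rightarrow> (real^4) set" where
  "chart_image c = snd c ` fst c"

definition chart_inv :: "'m chart \<Rightarrow> real^4 \<Rightarrow> 'm" where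
  "chart_inv c = inv_into (fst c) (snd c)"

definition transition :: "'m chart \<Rightarrow> 'm chart \<Rightarrow> real^4 \<Rightarrow> real^4" where
  "transition c d = snd d \<circ> chart_inv c"

definition overlap :: "'m chart \<Rightarrow> 'm chart \<Rightarrow> (real^4) set" where
  "overlap c d = snd c ` (fst c \<inter> fst d)"

locale oriented_smooth_4manifold =
  fixes M :: "'m topology" and \<A> :: "'m chart set"
  assumes hausdorff: "Hausdorff_space M"
    and second_countable: "second_countable M"
    and charts_cover: "\<Union> (fst ` \<A>) = topspace M"
    and chart_domain_open: "c \<in> \<A> \<Longrightarrow> openin M (fst c)"
    and chart_image_open: "c \<in> \<A> \<Longrightarrow> open (chart_image c)"
    and chart_homeo: "c \<in> \<A> \<Longrightarrow>
      homeomorphic_map (subtopology M (fst c)) (top_of_set (chart_image c)) (snd c)"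
    and transition_smooth: "c \<in> \<A> \<Longrightarrow> d \<in> \<A> \<Longrightarrow>
      smooth_on (overlap c d) (\<lambda>x. transition c d x $ i)"
    and transition_oriented: "c \<in> \<A> \<Longrightarrow> d \<in> \<A> \<Longrightarrow> x \<in> overlap c d \<Longrightarrow>
      det (jacobian (transition c d) (at x)) > 0"

text \<open>A metric is given by its matrices of components \<open>g c x $ i $ j\<close>, the value of
  \<open>g(\<partial>\<^sub>i, \<partial>\<^sub>j)\<close> in the chart \<open>c\<close> at the point with coordinates \<open>x\<close>, subject to the transformation
  law of a covariant 2-tensor.\<close>

type_synonym metric_coeffs = "real^4 \<Rightarrow> real^4^4"

locale oriented_riemannian_4manifold = oriented_smooth_4manifold M \<A>
  for M :: "'m topology" and \<A> :: "'m chart set" +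
  fixes g :: "'m chart \<Rightarrow> metric_coeffs"
  assumes metric_smooth: "c \<in> \<A> \<Longrightarrow> smooth_on (chart_image c) (\<lambda>x. g c x $ i $ j)"
    and metric_symmetric: "c \<in> \<A> \<Longrightarrow> x \<in> chart_image c \<Longrightarrow> g c x $ i $ j = g c x $ j $ i"
    and metric_positive: "c \<in> \<A> \<Longrightarrow> x \<in> chart_image c \<Longrightarrow> v \<noteq> 0 \<Longrightarrow> v \<bullet> (g c x *v v) > 0"
    and metric_tensorial: "c \<in> \<A> \<Longrightarrow> d \<in> \<A> \<Longrightarrow> x \<in> overlap c d \<Longrightarrow>
      g c x = transpose (jacobian (transition c d) (at x)) ** g d (transition c d x)
                ** jacobian (transition c d) (at x)"

text \<open>Covariant tensors are given by their components with respect to the coordinate frame.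
  Below, \<open>G\<close> is the matrix of the metric at one point, whereas \<open>g\<close> of type \<open>metric_coeffs\<close> is
  the metric in one chart as a function of the coordinates. Derivatives are taken at points of
  the open chart image only, so that values outside it do not matter.\<close>

type_synonym tensor2 = "4 \<Rightarrow> 4 \<Rightarrow> real"
type_synonym tensor4 = "4 \<Rightarrow> 4 \<Rightarrow> 4 \<Rightarrow> 4 \<Rightarrow> real"

abbreviation ginv :: "real^4^4 \<Rightarrow> 4 \<Rightarrow> 4 \<Rightarrow> real" where
  "ginv G i j \<equiv> matrix_inv G $ i $ j"

definition kn_prod :: "tensor2 \<Rightarrow> tensor2 \<Rightarrow> tensor4" where
  "kn_prod \<alpha> \<beta> i j k l = \<alpha> i k * \<beta> j l + \<alpha> j l * \<beta> i k - \<alpha> i l * \<beta> j k - \<alpha> j k * \<beta> i l"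

definition tensor_inner :: "real^4^4 \<Rightarrow> tensor4 \<Rightarrow> tensor4 \<Rightarrow> real" where
  "tensor_inner G S T = 1/4 * (\<Sum>i\<in>UNIV. \<Sum>j\<in>UNIV. \<Sum>k\<in>UNIV. \<Sum>l\<in>UNIV.
     \<Sum>a\<in>UNIV. \<Sum>b\<in>UNIV. \<Sum>c\<in>UNIV. \<Sum>d\<in>UNIV.
       ginv G i a * ginv G j b * ginv G k c * ginv G l d * S i j k l * T a b c d)"

abbreviation tensor_norm2 :: "real^4^4 \<Rightarrow> tensor4 \<Rightarrow> real" where
  "tensor_norm2 G T \<equiv> tensor_inner G T T"

text \<open>A bivector \<open>\<alpha> = 1/2 \<alpha>\<^sup>i\<^sup>j \<partial>\<^sub>i \<and> \<partial>\<^sub>j\<close> is given by the antisymmetric matrix \<open>\<alpha> $ i $ j\<close>.\<close>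

definition bivectors :: "(real^4^4) set" where
  "bivectors = {\<alpha>. transpose \<alpha> = - \<alpha>}"

definition wedge :: "4 \<Rightarrow> 4 \<Rightarrow> real^4^4" where
  "wedge i j = (\<chi> a b. axis i 1 $ a * axis j 1 $ b - axis j 1 $ a * axis i 1 $ b)"

definition vol_form :: "real^4^4 \<Rightarrow> tensor4" where
  "vol_form G i j k l =
     sqrt (det G) * det (vector [axis i 1, axis j 1, axis k 1, axis l 1] :: real^4^4)"

definition hodge :: "real^4^4 \<Rightarrow> real^4^4 \<Rightarrow> real^4^4" where
  "hodge G \<alpha> = (\<chi> k l. 1/2 * (\<Sum>i\<in>UNIV. \<Sum>j\<in>UNIV. \<Sum>a\<in>UNIV. \<Sum>b\<in>UNIV.
     ginv G k a * ginv G l b * vol_form G i j a b * \<alpha> $ i $ j))"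

text \<open>From here on \<open>s = 1\<close> and \<open>s = -1\<close> select the self-dual and the anti-self-dual part.\<close>

definition dual_bivectors :: "real \<Rightarrow> real^4^4 \<Rightarrow> (real^4^4) set" where
  "dual_bivectors s G = {\<alpha> \<in> bivectors. hodge G \<alpha> = s *\<^sub>R \<alpha>}"

definition bivector_proj :: "real \<Rightarrow> real^4^4 \<Rightarrow> real^4^4 \<Rightarrow> real^4^4" where
  "bivector_proj s G \<alpha> = (1/2) *\<^sub>R (\<alpha> + s *\<^sub>R hodge G \<alpha>)"

text \<open>The factor 1/4 is such that \<open>T(\<partial>\<^sub>i \<and> \<partial>\<^sub>j, \<partial>\<^sub>k \<and> \<partial>\<^sub>l) = T\<^sub>i\<^sub>j\<^sub>k\<^sub>l\<close> for \<open>T\<close> antisymmetric in its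
  first two and in its last two indices.\<close>

definition on_bivectors :: "tensor4 \<Rightarrow> real^4^4 \<Rightarrow> real^4^4 \<Rightarrow> real" where
  "on_bivectors T \<alpha> \<beta> = 1/4 * (\<Sum>i\<in>UNIV. \<Sum>j\<in>UNIV. \<Sum>k\<in>UNIV. \<Sum>l\<in>UNIV.
     T i j k l * \<alpha> $ i $ j * \<beta> $ k $ l)"

definition dual_part :: "real \<Rightarrow> real^4^4 \<Rightarrow> tensor4 \<Rightarrow> tensor4" where
  "dual_part s G T i j k l =
     on_bivectors T (bivector_proj s G (wedge i j)) (bivector_proj s G (wedge k l))"

text \<open>The operator with \<open>\<langle>T \<alpha>, \<beta>\<rangle> = T(\<alpha>, \<beta>)\<close>, where
  \<open>\<langle>\<alpha>, \<beta>\<rangle> = 1/2 g\<^sub>i\<^sub>k g\<^sub>j\<^sub>l \<alpha>\<^sup>i\<^sup>j \<beta>\<^sup>k\<^sup>l\<close> makes the \<open>e\<^sub>i \<and> e\<^sub>j\<close>, \<open>i < j\<close>, of an orthonormal frame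
  orthonormal.\<close>

definition bivector_op :: "real^4^4 \<Rightarrow> tensor4 \<Rightarrow> real^4^4 \<Rightarrow> real^4^4" where
  "bivector_op G T \<alpha> = (\<chi> k l. 1/2 * (\<Sum>i\<in>UNIV. \<Sum>j\<in>UNIV. \<Sum>a\<in>UNIV. \<Sum>b\<in>UNIV.
     ginv G k a * ginv G l b * T i j a b * \<alpha> $ i $ j))"

text \<open>The determinant of the matrix of \<open>L\<close> in any basis of \<open>V\<close>; meaningful only if \<open>V\<close> is
  three-dimensional and \<open>L\<close> maps \<open>V\<close> linearly into itself.\<close>

definition endo_det3 :: "'v::real_vector set \<Rightarrow> ('v \<Rightarrow> 'v) \<Rightarrow> real" where
  "endo_det3 V L = (THE d. \<forall>(b :: 3 \<Rightarrow> 'v) (m :: real^3^3).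
     inj b \<and> independent (range b) \<and> span (range b) = V
       \<and> (\<forall>j. L (b j) = (\<Sum>i\<in>UNIV. m $ i $ j *\<^sub>R b i)) \<longrightarrow> d = det m)"

definition dual_det :: "real \<Rightarrow> real^4^4 \<Rightarrow> tensor4 \<Rightarrow> real" where
  "dual_det s G T = endo_det3 (dual_bivectors s G) (bivector_op G (dual_part s G T))"

definition christoffel :: "metric_coeffs \<Rightarrow> real^4 \<Rightarrow> 4 \<Rightarrow> 4 \<Rightarrow> 4 \<Rightarrow> real" where
  "christoffel g x k i j = 1/2 * (\<Sum>l\<in>UNIV. ginv (g x) k l *
     (pd i (\<lambda>y. g y $ j $ l) x + pd j (\<lambda>y. g y $ i $ l) x - pd l (\<lambda>y. g y $ i $ j) x))"

text \<open>\<open>R\<^sub>i\<^sub>j\<^sub>k\<^sub>l = g(R(\<partial>\<^sub>i,\<partial>\<^sub>j)\<partial>\<^sub>l, \<partial>\<^sub>k)\<close> with \<open>R(X,Y) = [\<nabla>\<^sub>X,\<nabla>\<^sub>Y] - \<nabla>\<^bsub>[X,Y]\<^esub>\<close>,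
  so that \<open>R\<^sub>i\<^sub>j\<^sub>i\<^sub>j\<close> is the sectional curvature in an orthonormal frame.\<close>

definition riemann :: "metric_coeffs \<Rightarrow> real^4 \<Rightarrow> tensor4" where
  "riemann g x i j k l = (\<Sum>a\<in>UNIV. g x $ k $ a *
     (pd i (\<lambda>y. christoffel g y a j l) x - pd j (\<lambda>y. christoffel g y a i l) x
      + (\<Sum>m\<in>UNIV. christoffel g x a i m * christoffel g x m j l
                   - christoffel g x a j m * christoffel g x m i l)))"

definition ricci :: "metric_coeffs \<Rightarrow> real^4 \<Rightarrow> tensor2" where
  "ricci g x i k = (\<Sum>j\<in>UNIV. \<Sum>l\<in>UNIV. ginv (g x) j l * riemann g x i j k l)"

definition scalar_curv :: "metric_coeffs \<Rightarrow> real^4 \<Rightarrow> real" where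
  "scalar_curv g x = (\<Sum>i\<in>UNIV. \<Sum>k\<in>UNIV. ginv (g x) i k * ricci g x i k)"

text \<open>The decomposition \<open>Rm = W + 1/(n-2) Ric \<circ> g - R/(2(n-1)(n-2)) g \<circ> g\<close> for \<open>n = 4\<close>.\<close>

definition weyl :: "metric_coeffs \<Rightarrow> real^4 \<Rightarrow> tensor4" where
  "weyl g x i j k l = riemann g x i j k l
     - 1/2 * kn_prod (ricci g x) (\<lambda>i j. g x $ i $ j) i j k l
     + scalar_curv g x / 12 * kn_prod (\<lambda>i j. g x $ i $ j) (\<lambda>i j. g x $ i $ j) i j k l"

definition hessian :: "metric_coeffs \<Rightarrow> (real^4 \<Rightarrow> real) \<Rightarrow> real^4 \<Rightarrow> tensor2" where
  "hessian g u x i j = pd i (pd j u) x - (\<Sum>k\<in>UNIV. christoffel g x k i j * pd k u x)"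

definition laplacian :: "metric_coeffs \<Rightarrow> (real^4 \<Rightarrow> real) \<Rightarrow> real^4 \<Rightarrow> real" where
  "laplacian g u x = (\<Sum>i\<in>UNIV. \<Sum>j\<in>UNIV. ginv (g x) i j * hessian g u x i j)"

definition drift_laplacian ::
    "metric_coeffs \<Rightarrow> (real^4 \<Rightarrow> real) \<Rightarrow> (real^4 \<Rightarrow> real) \<Rightarrow> real^4 \<Rightarrow> real" where
  "drift_laplacian g f u x =
     laplacian g u x - (\<Sum>i\<in>UNIV. \<Sum>j\<in>UNIV. ginv (g x) i j * pd i f x * pd j u x)"

definition cov_deriv :: "metric_coeffs \<Rightarrow> (real^4 \<Rightarrow> tensor4) \<Rightarrow> real^4 \<Rightarrow> 4 \<Rightarrow> tensor4" where
  "cov_deriv g T x p i j k l = pd p (\<lambda>y. T y i j k l) x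
     - (\<Sum>a\<in>UNIV. christoffel g x a p i * T x a j k l + christoffel g x a p j * T x i a k l
                + christoffel g x a p k * T x i j a l + christoffel g x a p l * T x i j k a)"

definition cov_deriv_norm2 :: "metric_coeffs \<Rightarrow> (real^4 \<Rightarrow> tensor4) \<Rightarrow> real^4 \<Rightarrow> real" where
  "cov_deriv_norm2 g T x = (\<Sum>p\<in>UNIV. \<Sum>q\<in>UNIV.
     ginv (g x) p q * tensor_inner (g x) (cov_deriv g T x p) (cov_deriv g T x q))"

definition dual_weyl :: "real \<Rightarrow> metric_coeffs \<Rightarrow> real^4 \<Rightarrow> tensor4" where
  "dual_weyl s g x = dual_part s (g x) (weyl g x)"

locale gradient_ricci_soliton_4 = oriented_riemannian_4manifold M \<A> g
  for M :: "'m topology" and \<A> :: "'m chart set" and g :: "'m chart \<Rightarrow> metric_coeffs" +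
  fixes f :: "'m \<Rightarrow> real" and lam :: real
  assumes potential_smooth: "c \<in> \<A> \<Longrightarrow> smooth_on (chart_image c) (f \<circ> chart_inv c)"
    and soliton_eq: "c \<in> \<A> \<Longrightarrow> x \<in> chart_image c \<Longrightarrow>
      ricci (g c) x i j + hessian (g c) (f \<circ> chart_inv c) x i j = lam * g c x $ i $ j"

end

theory Submission
  imports Defs
begin

text \<open>In a smooth, positively oriented orthonormal frame contractions are plain sums, the Hodge star has
  constant coefficients and the connection matrices are antisymmetric, so the projection to \<open>W\<^sup>\<plusminus>\<close>
  commutes with covariant differentiation. The soliton equation turns the contracted second Bianchi
  identity into \<open>\<nabla>\<^sup>p R\<^sub>j\<^sub>p\<^sub>k\<^sub>l = R\<^sub>j\<^sub>a\<^sub>k\<^sub>l \<nabla>\<^sup>a f\<close>, and commuting derivatives in \<open>\<Delta> Rm\<close> then gives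
  \<open>\<Delta>\<^sub>f Rm = 2 \<lambda> Rm + Q(Rm)\<close> with \<open>Q\<close> quadratic. As \<open>W\<^sup>\<plusminus>\<close> is trace-free and differs from \<open>Rm\<^sup>\<plusminus>\<close> by a
  function times the parallel identity of \<open>\<and>\<^sup>\<plusminus>\<close>, we have
  \<open>\<langle>\<Delta>\<^sub>f W\<^sup>\<plusminus>, W\<^sup>\<plusminus>\<rangle> = \<langle>\<Delta>\<^sub>f Rm, W\<^sup>\<plusminus>\<rangle>\<close>. What remains is an algebraic identity for
  \<open>\<langle>Q(Rm), W\<^sup>\<plusminus>\<rangle>\<close> at one point.\<close>

text \<open>The curvature operator has a mixed block between the two dualities, the trace-free Ricci
  tensor, and it enters the part of \<open>Q\<close> of one duality quadratically. Up to a multiple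
  of the identity this contribution is a multiple of (Ric o Ric)^+-, which is the origin of that
  term; multiples of the identity vanish against the trace-free W^+-. What is left is a quadratic
  polynomial in the block of one duality. Paired with the matrix w of W^+-, its terms in scalar
  curvature times |w|^2 cancel, and tr w^3 = 3 det w remains. Frame vector fields do not commute.
  Therefore only the tensor indices refer to the frame, while differentiation is along the
  coordinates, where the derivations commute; the direction is converted to the frame afterwards.
  Identities that have to be differentiated are proved for germs; only the last, purely algebraic
  step is carried out with real numbers at the point.\<close>

text \<open>From here on \<open>\<Sum>i. t\<close> is the sum over all elements of a finite index type, not an infinite series.\<close>

no_notation suminf (binder "\<Sum>" 10)

abbreviation sum_UNIV :: "('i \<Rightarrow> 'r::comm_monoid_add) \<Rightarrow> 'r" (binder "\<Sum>" 10) where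
  "sum_UNIV f \<equiv> sum f UNIV"

section \<open>Smooth functions\<close>

lemma pd_eqI: "(u has_derivative u') (at x) \<Longrightarrow> pd i u x = u' (axis i 1)"
  unfolding pd_def by (metis frechet_derivative_at)

lemma has_derivative_pd:
  "u differentiable (at x) \<Longrightarrow> (u has_derivative frechet_derivative u (at x)) (at x)"
  by (simp add: frechet_derivative_works)

text \<open>\<open>frechet_derivative\<close> is a choice among the derivatives at the point, so it
  is enough that both functions have the same derivatives there, if any.\<close>

lemma pd_cong:
  assumes "open S" "x \<in> S" "\<And>y. y \<in> S \<Longrightarrow> u y = v y"
  shows "pd i u x = pd i v x"
proof -
  have "(u has_derivative f') (at x) \<longleftrightarrow> (v has_derivative f') (at x)" for f'
    using has_derivative_transform_within_open[of u f' x UNIV S v]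
      has_derivative_transform_within_open[of v f' x UNIV S u] assms by auto
  then show ?thesis unfolding pd_def frechet_derivative_def by simp
qed

lemma differentiable_cong_open:
  assumes "open S" "x \<in> S" "\<And>y. y \<in> S \<Longrightarrow> u y = v y"
  shows "u differentiable (at x) \<longleftrightarrow> v differentiable (at x)"
  unfolding differentiable_def
  using has_derivative_transform_within_open[of u _ x UNIV S v]
      has_derivative_transform_within_open[of v _ x UNIV S u] assms by metis

lemma Ck_on_cong:
  assumes "open S" "\<And>y. y \<in> S \<Longrightarrow> u y = v y"
  shows "Ck_on k S u \<longleftrightarrow> Ck_on k S v"
  using assms(2)
proof (induction k arbitrary: u v)
  case 0
  then show ?case by (auto intro: continuous_on_cong)
next
  case (Suc k)
  have "Ck_on k S (pd i u) \<longleftrightarrow> Ck_on k S (pd i v)" for i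
    by (rule Suc.IH) (use pd_cong[OF assms(1)] Suc.prems in blast)
  moreover have "u differentiable (at x) \<longleftrightarrow> v differentiable (at x)" if "x \<in> S" for x
    using differentiable_cong_open[OF assms(1) that] Suc.prems by blast
  ultimately show ?case by auto
qed

text \<open>\<open>Ck_on\<close> mentions continuity at level 0 only; one level higher it comes from
  differentiability, which is the base case here.\<close>

lemma Ck_on_decrease: "Ck_on (Suc k) S u \<Longrightarrow> Ck_on k S u"
proof (induction k arbitrary: u)
  case 0
  then show ?case
    by (auto intro!: continuous_at_imp_continuous_on differentiable_imp_continuous_within)
next
  case (Suc k)
  then show ?case by auto
qed

lemma Ck_on_const: "Ck_on k S (\<lambda>x. c)"
proof (induction k arbitrary: c)
  case (Suc k)
  have "pd i (\<lambda>x. c) = (\<lambda>x. 0)" for i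
    by (rule ext, rule pd_eqI[where u'="\<lambda>_. 0"]) simp
  then show ?case using Suc by simp
qed simp

lemma pd_add:
  "u differentiable (at x) \<Longrightarrow> v differentiable (at x) \<Longrightarrow>
     pd i (\<lambda>y. u y + v y) x = pd i u x + pd i v x"
  unfolding pd_def by (subst frechet_derivative_at[OF has_derivative_add[OF has_derivative_pd has_derivative_pd], symmetric]) auto

lemma pd_mult:
  "u differentiable (at x) \<Longrightarrow> v differentiable (at x) \<Longrightarrow>
     pd i (\<lambda>y. u y * v y) x = u x * pd i v x + pd i u x * v x"
  unfolding pd_def by (subst frechet_derivative_at[OF has_derivative_mult[OF has_derivative_pd has_derivative_pd], symmetric]) auto

lemma pd_inverse:
  "u differentiable (at x) \<Longrightarrow> u x \<noteq> 0 \<Longrightarrow>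
     pd i (\<lambda>y. inverse (u y)) x = - (inverse (u x) * inverse (u x)) * pd i u x"
  unfolding pd_def
  by (subst frechet_derivative_at[OF Deriv.has_derivative_inverse[OF _ has_derivative_pd], symmetric]) auto

lemma has_derivative_sqrt_comp:
  fixes u :: "real^4 \<Rightarrow> real"
  assumes "u differentiable (at x)" "u x > 0"
  shows "((\<lambda>y. sqrt (u y)) has_derivative
           (\<lambda>h. inverse (sqrt (u x)) / 2 * frechet_derivative u (at x) h)) (at x)"
proof -
  have "(sqrt has_derivative (*) (inverse (sqrt (u x)) / 2)) (at (u x))"
    using DERIV_real_sqrt[OF assms(2)] by (simp only: has_field_derivative_def)
  from has_derivative_compose[OF has_derivative_pd[OF assms(1)] this] show ?thesis .
qed

lemma pd_sqrt:
  "u differentiable (at x) \<Longrightarrow> u x > 0 \<Longrightarrow>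
     pd i (\<lambda>y. sqrt (u y)) x = inverse (sqrt (u x)) * (1/2 * pd i u x)"
  by (subst pd_eqI[OF has_derivative_sqrt_comp]) (auto simp: pd_def)

lemma Ck_on_add:
  assumes "open S" shows "Ck_on k S u \<Longrightarrow> Ck_on k S v \<Longrightarrow> Ck_on k S (\<lambda>y. u y + v y)"
proof (induction k arbitrary: u v)
  case 0
  then show ?case by (auto intro: continuous_intros)
next
  case (Suc k)
  have "Ck_on k S (pd i (\<lambda>y. u y + v y))" for i
  proof (subst Ck_on_cong[OF assms])
    show "pd i (\<lambda>y. u y + v y) y = pd i u y + pd i v y" if "y \<in> S" for y
      using Suc.prems that by (auto intro: pd_add)
  qed (use Suc in auto)
  then show ?case using Suc.prems by (auto intro: derivative_intros)
qed

lemma Ck_on_mult: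
  assumes "open S" shows "Ck_on k S u \<Longrightarrow> Ck_on k S v \<Longrightarrow> Ck_on k S (\<lambda>y. u y * v y)"
proof (induction k arbitrary: u v)
  case 0
  then show ?case by (auto intro: continuous_intros)
next
  case (Suc k)
  have "Ck_on k S (pd i (\<lambda>y. u y * v y))" for i
  proof (subst Ck_on_cong[OF assms])
    show "pd i (\<lambda>y. u y * v y) y = u y * pd i v y + pd i u y * v y" if "y \<in> S" for y
      using Suc.prems that by (auto intro: pd_mult)
    show "Ck_on k S (\<lambda>y. u y * pd i v y + pd i u y * v y)"
      using Suc.prems by (intro Ck_on_add[OF assms] Suc.IH) (simp_all add: Ck_on_decrease)
  qed
  then show ?case using Suc.prems by (auto intro: derivative_intros)
qed

text \<open>The derivative is a polynomial in the reciprocal itself and in the derivative of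
  \<open>u\<close>, so the induction hypothesis for the reciprocal closes the step. Square roots
  work likewise.\<close>

lemma Ck_on_inverse:
  assumes "open S" "\<And>y. y \<in> S \<Longrightarrow> u y \<noteq> 0"
  shows "Ck_on k S u \<Longrightarrow> Ck_on k S (\<lambda>y. inverse (u y))"
proof (induction k)
  case 0
  then show ?case using assms by (auto intro: continuous_intros)
next
  case (Suc k)
  have "Ck_on k S (pd i (\<lambda>y. inverse (u y)))" for i
  proof (subst Ck_on_cong[OF assms(1)])
    show "pd i (\<lambda>y. inverse (u y)) y = (-1 * (inverse (u y) * inverse (u y))) * pd i u y" if "y \<in> S" for y
      using Suc.prems that assms by (auto simp: pd_inverse)
    show "Ck_on k S (\<lambda>y. (-1 * (inverse (u y) * inverse (u y))) * pd i u y)"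
      using Suc.prems by (intro Ck_on_mult[OF assms(1)] Suc.IH Ck_on_const Ck_on_decrease[of k S u]) auto
  qed
  then show ?case using Suc.prems assms by (auto intro!: derivative_intros)
qed

lemma Ck_on_sqrt:
  assumes "open S" "\<And>y. y \<in> S \<Longrightarrow> u y > 0"
  shows "Ck_on k S u \<Longrightarrow> Ck_on k S (\<lambda>y. sqrt (u y))"
proof (induction k)
  case 0
  then show ?case using assms by (auto intro: continuous_intros)
next
  case (Suc k)
  have "sqrt (u y) \<noteq> 0" if "y \<in> S" for y using assms(2)[OF that] by simp
  then have "Ck_on k S (pd i (\<lambda>y. sqrt (u y)))" for i
  proof (subst Ck_on_cong[OF assms(1)])
    show "pd i (\<lambda>y. sqrt (u y)) y = inverse (sqrt (u y)) * (1/2 * pd i u y)" if "y \<in> S" for y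
      using Suc.prems that assms by (auto simp: pd_sqrt)
    show "Ck_on k S (\<lambda>y. inverse (sqrt (u y)) * (1/2 * pd i u y))"
      using Suc.prems \<open>\<And>y. y \<in> S \<Longrightarrow> sqrt (u y) \<noteq> 0\<close>
      by (intro Ck_on_mult[OF assms(1)] Ck_on_inverse[OF assms(1)] Suc.IH Ck_on_const
          Ck_on_decrease[of k S u]) auto
  qed
  then show ?case using Suc.prems assms has_derivative_sqrt_comp
    unfolding Ck_on.simps differentiable_def by metis
qed

lemma smooth_on_cong:
  "open S \<Longrightarrow> (\<And>y. y \<in> S \<Longrightarrow> u y = v y) \<Longrightarrow> smooth_on S u \<longleftrightarrow> smooth_on S v"
  unfolding smooth_on_def using Ck_on_cong by blast

lemma smooth_on_const: "smooth_on S (\<lambda>y. c)"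
  by (simp add: smooth_on_def Ck_on_const)

lemma smooth_on_add: "open S \<Longrightarrow> smooth_on S u \<Longrightarrow> smooth_on S v \<Longrightarrow> smooth_on S (\<lambda>y. u y + v y)"
  by (simp add: smooth_on_def Ck_on_add)

lemma smooth_on_mult: "open S \<Longrightarrow> smooth_on S u \<Longrightarrow> smooth_on S v \<Longrightarrow> smooth_on S (\<lambda>y. u y * v y)"
  by (simp add: smooth_on_def Ck_on_mult)

lemma smooth_on_uminus: "open S \<Longrightarrow> smooth_on S u \<Longrightarrow> smooth_on S (\<lambda>y. - u y)"
  using smooth_on_mult[OF _ smooth_on_const[of S "-1"]] by simp

lemma smooth_on_diff: "open S \<Longrightarrow> smooth_on S u \<Longrightarrow> smooth_on S v \<Longrightarrow> smooth_on S (\<lambda>y. u y - v y)"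
  using smooth_on_add[of S u "\<lambda>y. - v y"] smooth_on_uminus by simp

lemma smooth_on_inverse:
  "open S \<Longrightarrow> smooth_on S u \<Longrightarrow> (\<And>y. y \<in> S \<Longrightarrow> u y \<noteq> 0) \<Longrightarrow> smooth_on S (\<lambda>y. inverse (u y))"
  by (simp add: smooth_on_def Ck_on_inverse)

lemma smooth_on_sqrt:
  "open S \<Longrightarrow> smooth_on S u \<Longrightarrow> (\<And>y. y \<in> S \<Longrightarrow> u y > 0) \<Longrightarrow> smooth_on S (\<lambda>y. sqrt (u y))"
  by (simp add: smooth_on_def Ck_on_sqrt)

lemma smooth_on_sum:
  "open S \<Longrightarrow> (\<And>i. i \<in> I \<Longrightarrow> smooth_on S (u i)) \<Longrightarrow> smooth_on S (\<lambda>y. \<Sum>i\<in>I. u i y)"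
  by (induction I rule: infinite_finite_induct) (auto intro: smooth_on_const smooth_on_add)

lemma smooth_on_pd: "smooth_on S u \<Longrightarrow> smooth_on S (pd i u)"
  unfolding smooth_on_def by (metis Ck_on.simps(2))

lemma smooth_on_differentiable: "smooth_on S u \<Longrightarrow> x \<in> S \<Longrightarrow> u differentiable (at x)"
  unfolding smooth_on_def by (metis Ck_on.simps(2))

lemma smooth_on_continuous: "smooth_on S u \<Longrightarrow> continuous_on S u"
  unfolding smooth_on_def by (metis Ck_on.simps(1))

lemma Ck_on_subset: "Ck_on k S u \<Longrightarrow> T \<subseteq> S \<Longrightarrow> Ck_on k T u"
  by (induction k arbitrary: u) (auto intro: continuous_on_subset)

lemma smooth_on_subset: "smooth_on S u \<Longrightarrow> T \<subseteq> S \<Longrightarrow> smooth_on T u"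
  unfolding smooth_on_def using Ck_on_subset by blast

lemmas smooth_intros = smooth_on_const smooth_on_add smooth_on_mult smooth_on_uminus smooth_on_diff
  smooth_on_sum smooth_on_pd

section \<open>Symmetry of mixed partial derivatives\<close>

lemma pd_along_axis:
  assumes "u differentiable (at (a + t *\<^sub>R axis i 1))"
  shows "((\<lambda>t. u (a + t *\<^sub>R axis i 1)) has_real_derivative pd i u (a + t *\<^sub>R axis i 1)) (at t)"
proof -
  let ?u' = "frechet_derivative u (at (a + t *\<^sub>R axis i 1))"
  have d: "(u has_derivative ?u') (at (a + t *\<^sub>R axis i 1))"
    using assms by (rule has_derivative_pd)
  have "((\<lambda>t. a + t *\<^sub>R axis i 1) has_derivative (\<lambda>h. h *\<^sub>R axis i 1)) (at t)"
    by (auto intro!: derivative_eq_intros)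
  from has_derivative_compose[OF this d]
  have "((\<lambda>t. u (a + t *\<^sub>R axis i 1)) has_derivative (\<lambda>h. ?u' (h *\<^sub>R axis i 1))) (at t)" .
  moreover have "?u' (h *\<^sub>R axis i 1) = pd i u (a + t *\<^sub>R axis i 1) * h" for h
    using linear_cmul[OF has_derivative_linear[OF d], of h "axis i 1"] by (simp add: pd_def)
  ultimately show ?thesis unfolding has_field_derivative_def by simp
qed

text \<open>The mean value theorem is used twice: in direction \<open>i\<close> on the difference of
  two parallel edges of the square, then in direction \<open>j\<close> on the derivative so
  obtained.\<close>

lemma mixed_difference:
  fixes x :: "real^4"
  assumes S: "smooth_on S u" and h: "h > 0"
    and mem: "\<And>s t. 0 \<le> s \<Longrightarrow> s \<le> h \<Longrightarrow> 0 \<le> t \<Longrightarrow> t \<le> h \<Longrightarrow> x + s *\<^sub>R axis i 1 + t *\<^sub>R axis j 1 \<in> S"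
  shows "\<exists>s t. 0 < s \<and> s < h \<and> 0 < t \<and> t < h \<and>
    u (x + h *\<^sub>R axis i 1 + h *\<^sub>R axis j 1) - u (x + h *\<^sub>R axis i 1) - u (x + h *\<^sub>R axis j 1) + u x
      = h * (h * pd j (pd i u) (x + s *\<^sub>R axis i 1 + t *\<^sub>R axis j 1))"
proof -
  let ?\<phi> = "\<lambda>s. u ((x + h *\<^sub>R axis j 1) + s *\<^sub>R axis i 1) - u (x + s *\<^sub>R axis i 1)"
  let ?\<phi>' = "\<lambda>s. pd i u ((x + h *\<^sub>R axis j 1) + s *\<^sub>R axis i 1) - pd i u (x + s *\<^sub>R axis i 1)"
  have "(?\<phi> has_real_derivative ?\<phi>' s) (at s)" if "0 \<le> s" "s \<le> h" for s
  proof (intro DERIV_diff pd_along_axis smooth_on_differentiable[OF S])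
    show "(x + h *\<^sub>R axis j 1) + s *\<^sub>R axis i 1 \<in> S"
      using mem[of s h] that h by (simp add: algebra_simps)
    show "x + s *\<^sub>R axis i 1 \<in> S" using mem[of s 0] that h by simp
  qed
  from MVT2[OF h, of ?\<phi> ?\<phi>'] this obtain s where s: "0 < s" "s < h" "?\<phi> h - ?\<phi> 0 = h * ?\<phi>' s"
    by auto
  let ?\<psi> = "\<lambda>t. pd i u ((x + s *\<^sub>R axis i 1) + t *\<^sub>R axis j 1)"
  let ?\<psi>' = "\<lambda>t. pd j (pd i u) ((x + s *\<^sub>R axis i 1) + t *\<^sub>R axis j 1)"
  have "(?\<psi> has_real_derivative ?\<psi>' t) (at t)" if "0 \<le> t" "t \<le> h" for t
    using mem[of s t] that s by (intro pd_along_axis smooth_on_differentiable[OF smooth_on_pd[OF S]]) auto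
  from MVT2[OF h, of ?\<psi> ?\<psi>'] this obtain t where t: "0 < t" "t < h" "?\<psi> h - ?\<psi> 0 = h * ?\<psi>' t"
    by auto
  have "?\<phi>' s = ?\<psi> h - ?\<psi> 0" by (simp add: algebra_simps)
  then have "?\<phi> h - ?\<phi> 0 = h * (h * ?\<psi>' t)" using s(3) t(3) by simp
  then have "u (x + h *\<^sub>R axis i 1 + h *\<^sub>R axis j 1) - u (x + h *\<^sub>R axis i 1) - u (x + h *\<^sub>R axis j 1) + u x
      = h * (h * ?\<psi>' t)" by (simp add: algebra_simps)
  then show ?thesis using s t by blast
qed

text \<open>The second difference is symmetric in the two directions, so
  \<open>mixed_difference\<close> gives points arbitrarily close to \<open>x\<close> at which the
  two mixed derivatives take a common value. By continuity they cannot differ at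
  \<open>x\<close>.\<close>

lemma pd_commute:
  fixes x :: "real^4"
  assumes S: "smooth_on S u" and "open S" "x \<in> S"
  shows "pd i (pd j u) x = pd j (pd i u) x"
proof (rule ccontr)
  assume ne: "pd i (pd j u) x \<noteq> pd j (pd i u) x"
  define e where "e = \<bar>pd i (pd j u) x - pd j (pd i u) x\<bar> / 2"
  have e: "e > 0" using ne by (simp add: e_def)
  have c: "isCont (pd j (pd i u)) x" for i j
    using smooth_on_continuous[OF smooth_on_pd[OF smooth_on_pd[OF S]]] assms
    by (simp add: continuous_on_eq_continuous_at)
  obtain d1 where d1: "d1 > 0" "\<And>y. dist y x < d1 \<Longrightarrow> dist (pd j (pd i u) y) (pd j (pd i u) x) < e"
    using c[of j i] e unfolding continuous_at_eps_delta by metis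
  obtain d2 where d2: "d2 > 0" "\<And>y. dist y x < d2 \<Longrightarrow> dist (pd i (pd j u) y) (pd i (pd j u) x) < e"
    using c[of i j] e unfolding continuous_at_eps_delta by metis
  obtain d3 where d3: "d3 > 0" "\<And>y. dist y x < d3 \<Longrightarrow> y \<in> S"
    using assms by (metis open_dist)
  \<comment> \<open>Points of the square have distance at most \<open>2 * h\<close> from
    \<open>x\<close>, so a third of the least radius is small enough.\<close>
  define h where "h = Min {d1, d2, d3} / 3"
  have h: "h > 0" "2 * h < d1" "2 * h < d2" "2 * h < d3" using d1 d2 d3 by (auto simp: h_def)
  have near: "dist (x + s *\<^sub>R axis i 1 + t *\<^sub>R axis j 1) x \<le> 2 * h"
    if "0 \<le> s" "s \<le> h" "0 \<le> t" "t \<le> h" for s t i j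
  proof -
    have "norm (s *\<^sub>R (axis i 1 :: real^4) + t *\<^sub>R axis j 1) \<le> s + t"
      using norm_triangle_ineq[of "s *\<^sub>R (axis i 1 :: real^4)" "t *\<^sub>R axis j 1"] that by simp
    then show ?thesis using that by (simp add: dist_norm algebra_simps)
  qed
  have mem: "x + s *\<^sub>R axis i 1 + t *\<^sub>R axis j 1 \<in> S" if "0 \<le> s" "s \<le> h" "0 \<le> t" "t \<le> h" for s t i j
    using near[OF that] h d3 by (meson le_less_trans)
  obtain s t where st: "0 < s" "s < h" "0 < t" "t < h"
    "u (x + h *\<^sub>R axis i 1 + h *\<^sub>R axis j 1) - u (x + h *\<^sub>R axis i 1) - u (x + h *\<^sub>R axis j 1) + u x
      = h * (h * pd j (pd i u) (x + s *\<^sub>R axis i 1 + t *\<^sub>R axis j 1))"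
    using mixed_difference[OF S h(1), of x i j] mem by blast
  obtain s' t' where st': "0 < s'" "s' < h" "0 < t'" "t' < h"
    "u (x + h *\<^sub>R axis j 1 + h *\<^sub>R axis i 1) - u (x + h *\<^sub>R axis j 1) - u (x + h *\<^sub>R axis i 1) + u x
      = h * (h * pd i (pd j u) (x + s' *\<^sub>R axis j 1 + t' *\<^sub>R axis i 1))"
    using mixed_difference[OF S h(1), of x j i] mem by blast
  have "h * (h * pd j (pd i u) (x + s *\<^sub>R axis i 1 + t *\<^sub>R axis j 1))
     = h * (h * pd i (pd j u) (x + s' *\<^sub>R axis j 1 + t' *\<^sub>R axis i 1))"
    unfolding st(5)[symmetric] st'(5)[symmetric] by (simp add: algebra_simps)
  then have "pd j (pd i u) (x + s *\<^sub>R axis i 1 + t *\<^sub>R axis j 1)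
     = pd i (pd j u) (x + s' *\<^sub>R axis j 1 + t' *\<^sub>R axis i 1)" using h by simp
  moreover have "dist (pd j (pd i u) (x + s *\<^sub>R axis i 1 + t *\<^sub>R axis j 1)) (pd j (pd i u) x) < e"
    using d1(2) near[of s t i j] st h by (meson le_less_trans less_imp_le)
  moreover have "dist (pd i (pd j u) (x + s' *\<^sub>R axis j 1 + t' *\<^sub>R axis i 1)) (pd i (pd j u) x) < e"
    using d2(2) near[of s' t' j i] st' h by (meson le_less_trans less_imp_le)
  ultimately show False unfolding e_def dist_real_def by (auto simp: abs_if split: if_splits)
qed

section \<open>Germs\<close>

text \<open>Smoothness near 0 belongs to the relation. It is therefore reflexive exactly on the
  functions smooth near 0, and the partial quotient contains no other germs.\<close>

definition germ_rel :: "(real^4 \<Rightarrow> real) \<Rightarrow> (real^4 \<Rightarrow> real) \<Rightarrow> bool" where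
  "germ_rel u v \<longleftrightarrow>
     (\<exists>S. open S \<and> 0 \<in> S \<and> smooth_on S u \<and> smooth_on S v \<and> (\<forall>y\<in>S. u y = v y))"

lemma germ_relI:
  "open S \<Longrightarrow> 0 \<in> S \<Longrightarrow> smooth_on S u \<Longrightarrow> (\<And>y. y \<in> S \<Longrightarrow> u y = v y) \<Longrightarrow> germ_rel u v"
  unfolding germ_rel_def using smooth_on_cong[of S u v] by blast

lemma germ_rel_sym: "germ_rel u v \<Longrightarrow> germ_rel v u"
  unfolding germ_rel_def by metis

lemma germ_rel_Int:
  assumes "germ_rel u u'" "germ_rel v v'"
  obtains S where "open S" "0 \<in> S" "smooth_on S u" "smooth_on S u'" "smooth_on S v" "smooth_on S v'"
    "\<And>y. y \<in> S \<Longrightarrow> u y = u' y" "\<And>y. y \<in> S \<Longrightarrow> v y = v' y"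
proof -
  obtain S T where ST: "open S" "0 \<in> S" "smooth_on S u" "smooth_on S u'" "\<And>y. y \<in> S \<Longrightarrow> u y = u' y"
    "open T" "0 \<in> T" "smooth_on T v" "smooth_on T v'" "\<And>y. y \<in> T \<Longrightarrow> v y = v' y"
    using assms unfolding germ_rel_def by blast
  show ?thesis
    by (rule that[of "S \<inter> T"])
      (use ST smooth_on_subset[of S _ "S \<inter> T"] smooth_on_subset[of T _ "S \<inter> T"] in auto)
qed

lemma germ_rel_trans: "germ_rel u v \<Longrightarrow> germ_rel v w \<Longrightarrow> germ_rel u w"
  by (erule germ_rel_Int, assumption) (rule germ_relI, auto)

lemma germ_rel_const: "germ_rel (\<lambda>y. c) (\<lambda>y. c)"
  by (rule germ_relI[of UNIV]) (auto intro: smooth_on_const)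

lemma germ_rel_add:
  "germ_rel u u' \<Longrightarrow> germ_rel v v' \<Longrightarrow> germ_rel (\<lambda>y. u y + v y) (\<lambda>y. u' y + v' y)"
  by (erule germ_rel_Int, assumption) (rule germ_relI, auto intro: smooth_intros)

lemma germ_rel_mult:
  "germ_rel u u' \<Longrightarrow> germ_rel v v' \<Longrightarrow> germ_rel (\<lambda>y. u y * v y) (\<lambda>y. u' y * v' y)"
  by (erule germ_rel_Int, assumption) (rule germ_relI, auto intro: smooth_intros)

lemma germ_rel_pd: "germ_rel u v \<Longrightarrow> germ_rel (pd i u) (pd i v)"
  unfolding germ_rel_def by (metis pd_cong smooth_on_pd)

lemma germ_rel_minus: "germ_rel u u' \<Longrightarrow> germ_rel (\<lambda>y. - u y) (\<lambda>y. - u' y)"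
  using germ_rel_mult[OF germ_rel_const[of "-1"]] by simp

lemma germ_rel_diff:
  "germ_rel u u' \<Longrightarrow> germ_rel v v' \<Longrightarrow> germ_rel (\<lambda>y. u y - v y) (\<lambda>y. u' y - v' y)"
  using germ_rel_add[OF _ germ_rel_minus] by simp

text \<open>Germs at the origin of smooth functions. They form a commutative ring with four commuting
  derivations, so tensor calculus becomes ring algebra without side conditions.\<close>

quotient_type germ = "real^4 \<Rightarrow> real" / partial: germ_rel
proof (rule part_equivpI)
  show "\<exists>u. germ_rel u u" using germ_rel_const by blast
qed (auto intro: sympI transpI germ_rel_sym germ_rel_trans)

instantiation germ :: "{comm_ring_1, real_algebra_1}"
begin

lift_definition zero_germ :: germ is "\<lambda>y. 0" by (rule germ_rel_const)
lift_definition one_germ :: germ is "\<lambda>y. 1" by (rule germ_rel_const)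
lift_definition plus_germ :: "germ \<Rightarrow> germ \<Rightarrow> germ" is "\<lambda>u v y. u y + v y" by (rule germ_rel_add)
lift_definition minus_germ :: "germ \<Rightarrow> germ \<Rightarrow> germ" is "\<lambda>u v y. u y - v y" by (rule germ_rel_diff)
lift_definition uminus_germ :: "germ \<Rightarrow> germ" is "\<lambda>u y. - u y" by (rule germ_rel_minus)
lift_definition times_germ :: "germ \<Rightarrow> germ \<Rightarrow> germ" is "\<lambda>u v y. u y * v y" by (rule germ_rel_mult)
lift_definition scaleR_germ :: "real \<Rightarrow> germ \<Rightarrow> germ" is "\<lambda>r u y. r * u y"
  by (rule germ_rel_mult[OF germ_rel_const])

lemmas germ_rel_rules = germ_rel_const germ_rel_add germ_rel_mult germ_rel_minus germ_rel_diff

instance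
proof
  fix a b c :: germ and r s :: real
  show "a + b + c = a + (b + c)"
    by transfer (simp add: add.assoc germ_rel_rules)
  show "a + b = b + a"
    by transfer (subst add.commute, simp add: germ_rel_rules)
  show "0 + a = a" by transfer simp
  show "- a + a = 0" by transfer (simp add: germ_rel_rules)
  show "a - b = a + - b" by transfer (simp add: germ_rel_rules)
  show "a * b * c = a * (b * c)" by transfer (simp add: mult.assoc germ_rel_rules)
  show "a * b = b * a" by transfer (subst mult.commute, simp add: germ_rel_rules)
  show "1 * a = a" by transfer simp
  show "(a + b) * c = a * c + b * c" by transfer (simp add: distrib_right germ_rel_rules)
  show "a * 1 = a" by transfer simp
  show "a * (b + c) = a * b + a * c" by transfer (simp add: distrib_left germ_rel_rules)
  show "(0::germ) \<noteq> 1"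
    by transfer (auto simp: germ_rel_def)
  show "r *\<^sub>R (a + b) = r *\<^sub>R a + r *\<^sub>R b" by transfer (simp add: distrib_left germ_rel_rules)
  show "(r + s) *\<^sub>R a = r *\<^sub>R a + s *\<^sub>R a" by transfer (simp add: distrib_right germ_rel_rules)
  show "r *\<^sub>R s *\<^sub>R a = (r * s) *\<^sub>R a" by transfer (simp add: mult.assoc germ_rel_rules)
  show "1 *\<^sub>R a = a" by transfer simp
  show "r *\<^sub>R a * b = r *\<^sub>R (a * b)" by transfer (simp add: mult.assoc germ_rel_rules)
  show "a * r *\<^sub>R b = r *\<^sub>R (a * b)" by transfer (simp add: mult.left_commute germ_rel_rules)
qed

end

lift_definition D :: "4 \<Rightarrow> germ \<Rightarrow> germ" is pd by (rule germ_rel_pd)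

lift_definition ev :: "germ \<Rightarrow> real" is "\<lambda>u. u 0" by (auto simp: germ_rel_def)

lemma ev_add [simp]: "ev (a + b) = ev a + ev b" by transfer simp
lemma ev_diff [simp]: "ev (a - b) = ev a - ev b" by transfer simp
lemma ev_minus [simp]: "ev (- a) = - ev a" by transfer simp
lemma ev_mult [simp]: "ev (a * b) = ev a * ev b" by transfer simp
lemma ev_scaleR [simp]: "ev (r *\<^sub>R a) = r * ev a" by transfer simp
lemma ev_0 [simp]: "ev 0 = 0" by transfer simp
lemma ev_1 [simp]: "ev 1 = 1" by transfer simp
lemma ev_sum [simp]: "ev (sum u I) = (\<Sum>i\<in>I. ev (u i))"
  by (induction I rule: infinite_finite_induct) auto

lemma D_add [simp]: "D p (a + b) = D p a + D p b"
proof transfer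
  fix p u v assume "germ_rel u u" "germ_rel v v"
  then obtain S where S: "open S" "0 \<in> S" "smooth_on S u" "smooth_on S v" by (rule germ_rel_Int) auto
  show "germ_rel (pd p (\<lambda>y. u y + v y)) (\<lambda>y. pd p u y + pd p v y)"
    by (rule germ_relI[of S]) (auto intro!: S smooth_intros pd_add intro: smooth_on_differentiable[of S] S)
qed

lemma D_mult [simp]: "D p (a * b) = a * D p b + D p a * b"
proof transfer
  fix p u v assume "germ_rel u u" "germ_rel v v"
  then obtain S where S: "open S" "0 \<in> S" "smooth_on S u" "smooth_on S v" by (rule germ_rel_Int) auto
  show "germ_rel (pd p (\<lambda>y. u y * v y)) (\<lambda>y. u y * pd p v y + pd p u y * v y)"
    by (rule germ_relI[of S]) (auto intro!: S smooth_intros pd_mult intro: smooth_on_differentiable[of S] S)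
qed

lemma D_0 [simp]: "D p 0 = 0" using D_add[of p 0 0] by simp

lemma D_1 [simp]: "D p 1 = 0" using D_mult[of p 1 1] by simp

lemma D_minus [simp]: "D p (- a) = - D p a"
  using D_add[of p a "- a"] by (simp add: add_eq_0_iff)

lemma D_diff [simp]: "D p (a - b) = D p a - D p b"
  using D_add[of p a "- b"] by simp

lemma D_sum [simp]: "D p (sum u I) = (\<Sum>i\<in>I. D p (u i))"
  by (induction I rule: infinite_finite_induct) auto

lemma D_scaleR [simp]: "D p (r *\<^sub>R a) = r *\<^sub>R D p a"
proof -
  have "D p (r *\<^sub>R 1) = 0"
  proof transfer
    fix p r
    have "pd p (\<lambda>y. r * 1) = (\<lambda>y. 0)"
      by (rule ext, rule pd_eqI[where u'="\<lambda>_. 0"]) simp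
    then show "germ_rel (pd p (\<lambda>y. r * 1)) (\<lambda>y. 0)" by (simp add: germ_rel_const)
  qed
  then show ?thesis using D_mult[of p "r *\<^sub>R 1" a] by simp
qed

lemma D_commute: "D p (D q a) = D q (D p a)"
proof transfer
  fix p q u assume "germ_rel u u"
  then obtain S where S: "open S" "0 \<in> S" "smooth_on S u" unfolding germ_rel_def by auto
  show "germ_rel (pd p (pd q u)) (pd q (pd p u))"
    by (rule germ_relI[OF S(1,2)]) (simp_all add: S smooth_on_pd pd_commute[OF S(3,1)])
qed

section \<open>Germs at an arbitrary point of an open set\<close>

lemma has_derivative_translate:
  fixes u :: "'a::real_normed_vector \<Rightarrow> 'b::real_normed_vector"
  shows "((\<lambda>y. u (x + y)) has_derivative f') (at y) \<longleftrightarrow> (u has_derivative f') (at (x + y))"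
proof
  assume "(u has_derivative f') (at (x + y))"
  moreover have "((\<lambda>y. x + y) has_derivative (\<lambda>h. h)) (at y)" by (auto intro!: derivative_eq_intros)
  ultimately show "((\<lambda>y. u (x + y)) has_derivative f') (at y)"
    using has_derivative_compose[of "\<lambda>y. x + y" "\<lambda>h. h" y UNIV u f'] by simp
next
  assume a: "((\<lambda>y. u (x + y)) has_derivative f') (at y)"
  have "((\<lambda>y. - x + y) has_derivative (\<lambda>h. h)) (at (x + y))" by (auto intro!: derivative_eq_intros)
  from has_derivative_compose[OF this, of "\<lambda>y. u (x + y)" f'] a
  show "(u has_derivative f') (at (x + y))" by simp
qed

lemma pd_translate: "pd i (\<lambda>y. u (x + y)) = (\<lambda>y. pd i u (x + y))"
  by (rule ext) (simp add: pd_def frechet_derivative_def has_derivative_translate)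

lemma Ck_on_translate: "Ck_on k S u \<Longrightarrow> Ck_on k ((\<lambda>y. y - x) ` S) (\<lambda>y. u (x + y))"
proof (induction k arbitrary: u)
  case 0
  then show ?case
    by (auto intro!: continuous_on_compose2[of S u] continuous_intros)
next
  case (Suc k)
  then show ?case
    by (auto simp: pd_translate differentiable_def has_derivative_translate)
qed

lemma smooth_on_translate: "smooth_on S u \<Longrightarrow> smooth_on ((\<lambda>y. y - x) ` S) (\<lambda>y. u (x + y))"
  by (simp add: smooth_on_def Ck_on_translate)

text \<open>The type \<open>germ\<close> knows the origin only; translating the function lets one
  ring serve all points.\<close>

definition germ_at :: "real^4 \<Rightarrow> (real^4 \<Rightarrow> real) \<Rightarrow> germ" where
  "germ_at x u = abs_germ (\<lambda>y. u (x + y))"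

locale base_point =
  fixes S :: "(real^4) set" and x :: "real^4"
  assumes open_S: "open S" and x_in_S: "x \<in> S"
begin

lemma germ_rel_translate:
  assumes "smooth_on S u" "\<And>y. y \<in> S \<Longrightarrow> u y = v y"
  shows "germ_rel (\<lambda>y. u (x + y)) (\<lambda>y. v (x + y))"
proof (rule germ_relI)
  show "open ((\<lambda>y. y - x) ` S)"
    using open_translation[OF open_S, of "- x"] by (simp add: add.commute)
  show "smooth_on ((\<lambda>y. y - x) ` S) (\<lambda>y. u (x + y))"
    using assms(1) by (rule smooth_on_translate)
qed (use assms(2) x_in_S in auto)

text \<open>The bridge from pointwise identities on \<open>S\<close> to equations in the ring of
  germs, which can then be differentiated.\<close>

lemma germ_at_cong:
  "smooth_on S u \<Longrightarrow> (\<And>y. y \<in> S \<Longrightarrow> u y = v y) \<Longrightarrow> germ_at x u = germ_at x v"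
  unfolding germ_at_def by (rule Quotient_rel_abs[OF Quotient_germ germ_rel_translate])

lemma germ_rel_translate_self: "smooth_on S u \<Longrightarrow> germ_rel (\<lambda>y. u (x + y)) (\<lambda>y. u (x + y))"
  by (erule germ_rel_translate) (rule refl)

lemma ev_germ_at [simp]: "smooth_on S u \<Longrightarrow> ev (germ_at x u) = u x"
  unfolding germ_at_def by (subst ev.abs_eq[OF germ_rel_translate_self]) auto

lemma germ_at_add:
  "smooth_on S u \<Longrightarrow> smooth_on S v \<Longrightarrow> germ_at x (\<lambda>y. u y + v y) = germ_at x u + germ_at x v"
  unfolding germ_at_def
  by (rule plus_germ.abs_eq[OF germ_rel_translate_self germ_rel_translate_self, symmetric])

lemma germ_at_diff:
  "smooth_on S u \<Longrightarrow> smooth_on S v \<Longrightarrow> germ_at x (\<lambda>y. u y - v y) = germ_at x u - germ_at x v"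
  unfolding germ_at_def
  by (rule minus_germ.abs_eq[OF germ_rel_translate_self germ_rel_translate_self, symmetric])

lemma germ_at_minus: "smooth_on S u \<Longrightarrow> germ_at x (\<lambda>y. - u y) = - germ_at x u"
  unfolding germ_at_def by (rule uminus_germ.abs_eq[OF germ_rel_translate_self, symmetric])

lemma germ_at_mult:
  "smooth_on S u \<Longrightarrow> smooth_on S v \<Longrightarrow> germ_at x (\<lambda>y. u y * v y) = germ_at x u * germ_at x v"
  unfolding germ_at_def
  by (rule times_germ.abs_eq[OF germ_rel_translate_self germ_rel_translate_self, symmetric])

lemma germ_at_const: "germ_at x (\<lambda>y. r) = of_real r"
proof -
  have "abs_germ (\<lambda>y. r * 1) = r *\<^sub>R abs_germ (\<lambda>y. 1)"
    using scaleR_germ.abs_eq[of "\<lambda>y. 1" r] by (simp add: germ_rel_const)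
  then show ?thesis by (simp add: germ_at_def of_real_def one_germ_def)
qed

lemma germ_at_sum:
  "(\<And>i. i \<in> I \<Longrightarrow> smooth_on S (u i)) \<Longrightarrow> germ_at x (\<lambda>y. \<Sum>i\<in>I. u i y) = (\<Sum>i\<in>I. germ_at x (u i))"
proof (induction I rule: infinite_finite_induct)
  case (insert i I)
  then have "germ_at x (\<lambda>y. u i y + (\<Sum>i\<in>I. u i y)) = germ_at x (u i) + (\<Sum>i\<in>I. germ_at x (u i))"
    by (subst germ_at_add) (auto intro!: smooth_intros open_S)
  then show ?case using insert by simp
qed (simp_all add: germ_at_const)

lemma germ_at_pd: "smooth_on S u \<Longrightarrow> germ_at x (pd p u) = D p (germ_at x u)"
  unfolding germ_at_def pd_translate[symmetric]
  by (rule D.abs_eq[OF germ_rel_translate_self, symmetric])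

end

section \<open>Tensor calculus in an orthonormal frame\<close>

text \<open>A covariant tensor of rank \<open>n\<close> is a function of index lists, only its values on lists of length \<open>n\<close>
  being relevant. A matrix acts on it by \<open>slots\<close> as a derivation of the tensor algebra, and by \<open>conv\<close> as
  a change of frame.\<close>

fun slots :: "('i::finite \<Rightarrow> 'i \<Rightarrow> 'r::comm_ring_1) \<Rightarrow> ('i list \<Rightarrow> 'r) \<Rightarrow> 'i list \<Rightarrow> 'r" where
  "slots M T [] = 0"
| "slots M T (a # as) = (\<Sum>b. M b a * T (b # as)) + slots M (\<lambda>bs. T (a # bs)) as"

fun conv :: "('i::finite \<Rightarrow> 'j \<Rightarrow> 'r::comm_ring_1) \<Rightarrow> ('i list \<Rightarrow> 'r) \<Rightarrow> 'j list \<Rightarrow> 'r" where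
  "conv E T [] = T []"
| "conv E T (b # bs) = (\<Sum>a. E a b * conv E (\<lambda>as. T (a # as)) bs)"

fun pairing :: "nat \<Rightarrow> ('i::finite list \<Rightarrow> 'r::comm_ring_1) \<Rightarrow> ('i list \<Rightarrow> 'r) \<Rightarrow> 'r" where
  "pairing 0 S T = S [] * T []"
| "pairing (Suc n) S T = (\<Sum>a. pairing n (\<lambda>as. S (a # as)) (\<lambda>as. T (a # as)))"

section \<open>Algebra and product rules of slot actions, frame changes and contractions\<close>

lemma slots_cong:
  "(\<And>as. length as = length is \<Longrightarrow> S as = T as) \<Longrightarrow> slots M S is = slots M T is"
proof (induction "is" arbitrary: S T)
  case (Cons a "is")
  have "slots M (\<lambda>bs. S (a # bs)) is = slots M (\<lambda>bs. T (a # bs)) is"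
    by (rule Cons.IH) (simp add: Cons.prems)
  then show ?case by (simp add: Cons.prems)
qed simp

lemma slots_add: "slots M (\<lambda>as. S as + T as) is = slots M S is + slots M T is"
  by (induction "is" arbitrary: S T) (auto simp: algebra_simps sum.distrib)

lemma slots_cmult: "slots M (\<lambda>as. c * T as) is = c * slots M T is"
  by (induction "is" arbitrary: T) (auto simp: algebra_simps sum_distrib_left)

lemma slots_minus: "slots M (\<lambda>as. - T as) is = - slots M T is"
  using slots_cmult[of M "-1"] by simp

lemma slots_diff: "slots M (\<lambda>as. S as - T as) is = slots M S is - slots M T is"
  using slots_add[of M S "\<lambda>as. - T as"] by (simp add: slots_minus)

lemma slots_zero [simp]: "slots M (\<lambda>as. 0) is = 0"
  using slots_cmult[of M 0] by simp

lemma slots_sum: "slots M (\<lambda>as. \<Sum>x\<in>X. T x as) is = (\<Sum>x\<in>X. slots M (T x) is)"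
  by (induction X rule: infinite_finite_induct) (auto simp: slots_add)

text \<open>Permutations of slots are composed from adjacent transpositions, because these are
  compatible with the recursion of \<open>slots\<close> along the list.\<close>

fun swap_at :: "nat \<Rightarrow> 'a list \<Rightarrow> 'a list" where
  "swap_at 0 (x # y # zs) = y # x # zs"
| "swap_at (Suc k) (x # zs) = x # swap_at k zs"
| "swap_at _ zs = zs"

lemma swap_at_numeral [simp]:
  "swap_at (numeral n) (x # zs) = x # swap_at (pred_numeral n) zs"
  by (simp add: numeral_eq_Suc)

lemma slots_swap: "slots M (\<lambda>as. T (swap_at k as)) is = slots M T (swap_at k is)"
  by (induction k "is" arbitrary: T rule: swap_at.induct) (auto simp: add.left_commute)

lemma slots_mat_add: "slots (\<lambda>b a. M b a + N b a) T is = slots M T is + slots N T is"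
  by (induction "is" arbitrary: T) (auto simp: algebra_simps sum.distrib)

lemma slots_mat_cmult: "slots (\<lambda>b a. c * M b a) T is = c * slots M T is"
  by (induction "is" arbitrary: T) (auto simp: algebra_simps sum_distrib_left)

lemma slots_mat_diff: "slots (\<lambda>b a. M b a - N b a) T is = slots M T is - slots N T is"
  using slots_mat_add[of M "\<lambda>b a. - 1 * N b a"] slots_mat_cmult[of "-1" N] by simp

lemma slots_mat_zero [simp]: "slots (\<lambda>b a. 0) T is = 0"
  using slots_mat_cmult[of 0] by simp

lemma slots_mat_sum: "slots (\<lambda>b a. \<Sum>x\<in>X. M x b a) T is = (\<Sum>x\<in>X. slots (M x) T is)"
  by (induction X rule: infinite_finite_induct) (auto simp: slots_mat_add)

text \<open>Terms in which the two matrices act on different slots cancel; what survives is both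
  acting on the same slot. The matrix products appear in reversed order, since each matrix is summed
  over its row index.\<close>

lemma slots_commutator:
  "slots M (slots N T) is - slots N (slots M T) is =
     slots (\<lambda>c a. (\<Sum>b. N c b * M b a) - (\<Sum>b. M c b * N b a)) T is"
proof (induction "is" arbitrary: T)
  case (Cons a "is")
  have step: "slots M (slots N T) (a # is) =
      (\<Sum>c. (\<Sum>b. N c b * M b a) * T (c # is))
    + (\<Sum>b. M b a * slots N (\<lambda>as. T (b # as)) is)
    + (\<Sum>b. N b a * slots M (\<lambda>as. T (b # as)) is)
    + slots M (slots N (\<lambda>as. T (a # as))) is" for M N
  proof -
    have "(\<Sum>b. M b a * (\<Sum>c. N c b * T (c # is)))
        = (\<Sum>c. (\<Sum>b. N c b * M b a) * T (c # is))"
      unfolding sum_distrib_left sum_distrib_right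
      by (subst sum.swap) (simp add: ac_simps)
    then show ?thesis
      by (simp add: slots_add slots_sum slots_cmult distrib_left sum.distrib)
  qed
  show ?case
    using Cons.IH[of "\<lambda>as. T (a # as)"] step[of M N] step[of N M]
    by (simp del: slots.simps(2) add: slots.simps(2)[of "\<lambda>c a. _ c a - _ c a"] left_diff_distrib sum_subtractf)
qed simp

lemma D_slots:
  "D p (slots M T is) = slots (\<lambda>b a. D p (M b a)) T is + slots M (\<lambda>as. D p (T as)) is"
  by (induction "is" arbitrary: T) (auto simp: sum.distrib algebra_simps)

lemma conv_cong:
  "(\<And>as. length as = length bs \<Longrightarrow> S as = T as) \<Longrightarrow> conv E S bs = conv E T bs"
proof (induction bs arbitrary: S T)
  case (Cons b bs)
  have "conv E (\<lambda>bs. S (a # bs)) bs = conv E (\<lambda>bs. T (a # bs)) bs" for a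
    by (rule Cons.IH) (simp add: Cons.prems)
  then show ?case by simp
qed simp

lemma conv_add: "conv E (\<lambda>as. S as + T as) bs = conv E S bs + conv E T bs"
  by (induction bs arbitrary: S T) (auto simp: algebra_simps sum.distrib)

lemma conv_cmult: "conv E (\<lambda>as. c * T as) bs = c * conv E T bs"
  by (induction bs arbitrary: T) (auto simp: algebra_simps sum_distrib_left)

lemma conv_diff: "conv E (\<lambda>as. S as - T as) bs = conv E S bs - conv E T bs"
  using conv_add[of E S "\<lambda>as. -1 * T as"] conv_cmult[of E "-1" T] by simp

lemma conv_sum: "conv E (\<lambda>as. \<Sum>x\<in>X. T x as) bs = (\<Sum>x\<in>X. conv E (T x) bs)"
  by (induction X rule: infinite_finite_induct)
    (use conv_cmult[of E 0] in \<open>auto simp: conv_add\<close>)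

text \<open>The assumption says that \<open>E\<close>, with one coordinate index and one frame
  index, is parallel with respect to \<open>G\<close> and \<open>A\<close> together. Contraction
  with a parallel tensor commutes with covariant differentiation.\<close>

lemma conv_covariant:
  assumes E: "\<And>i b. D p (E i b) = (\<Sum>a. E i a * A a b) - (\<Sum>k. G i k * E k b)"
  shows "D p (conv E T bs) - slots A (conv E T) bs = conv E (\<lambda>as. D p (T as) - slots G T as) bs"
proof (induction bs arbitrary: T)
  case (Cons b bs)
  let ?C = "\<lambda>i. conv E (\<lambda>as. T (i # as)) bs"
  have IH: "D p (?C i) = slots A (conv E (\<lambda>as. T (i # as))) bs
      + conv E (\<lambda>as. D p (T (i # as)) - slots G (\<lambda>as. T (i # as)) as) bs" for i
    using Cons.IH[of "\<lambda>as. T (i # as)"] by (simp add: algebra_simps)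
  have 1: "(\<Sum>i. (\<Sum>a. E i a * A a b) * ?C i) = (\<Sum>a. A a b * (\<Sum>i. E i a * ?C i))"
    unfolding sum_distrib_left sum_distrib_right by (subst sum.swap) (simp add: ac_simps)
  have 2: "(\<Sum>i. (\<Sum>k. G i k * E k b) * ?C i) = (\<Sum>k. E k b * (\<Sum>i. G i k * ?C i))"
    unfolding sum_distrib_left sum_distrib_right by (subst sum.swap) (simp add: ac_simps)
  have 3: "slots A (conv E T) (b # bs) = (\<Sum>a. A a b * (\<Sum>i. E i a * ?C i))
      + (\<Sum>i. E i b * slots A (conv E (\<lambda>as. T (i # as))) bs)"
    by (simp add: slots_sum slots_cmult)
  have 4: "conv E (\<lambda>as. D p (T as) - slots G T as) (b # bs) =
      (\<Sum>i. E i b * conv E (\<lambda>as. D p (T (i # as)) - slots G (\<lambda>as. T (i # as)) as) bs)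
      - (\<Sum>k. E k b * (\<Sum>i. G i k * ?C i))"
    by (simp add: conv_diff conv_add conv_sum conv_cmult right_diff_distrib distrib_left
        sum_subtractf sum.distrib)
  have 5: "D p (conv E T (b # bs)) = (\<Sum>i. E i b * slots A (conv E (\<lambda>as. T (i # as))) bs)
      + (\<Sum>i. E i b * conv E (\<lambda>as. D p (T (i # as)) - slots G (\<lambda>as. T (i # as)) as) bs)
      + (\<Sum>i. (\<Sum>a. E i a * A a b) * ?C i) - (\<Sum>i. (\<Sum>k. G i k * E k b) * ?C i)"
    by (simp add: E IH distrib_left left_diff_distrib sum.distrib sum_subtractf)
  show ?case unfolding 3 4 5 1 2 by (simp add: algebra_simps)
qed simp

lemma pairing_cong:
  "(\<And>as. length as = n \<Longrightarrow> S as = S' as) \<Longrightarrow> (\<And>as. length as = n \<Longrightarrow> T as = T' as) \<Longrightarrow>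
     pairing n S T = pairing n S' T'"
proof (induction n arbitrary: S S' T T')
  case (Suc n)
  have "pairing n (\<lambda>as. S (a # as)) (\<lambda>as. T (a # as)) = pairing n (\<lambda>as. S' (a # as)) (\<lambda>as. T' (a # as))" for a
    by (rule Suc.IH) (simp_all add: Suc.prems)
  then show ?case by simp
qed simp

lemma pairing_commute: "pairing n S T = pairing n T S"
  by (induction n arbitrary: S T) (auto simp: mult.commute)

lemma pairing_add: "pairing n (\<lambda>as. S as + S' as) T = pairing n S T + pairing n S' T"
  by (induction n arbitrary: S S' T) (auto simp: algebra_simps sum.distrib)

lemma pairing_cmult: "pairing n (\<lambda>as. c * S as) T = c * pairing n S T"
  by (induction n arbitrary: S T) (auto simp: algebra_simps sum_distrib_left)

lemma pairing_diff: "pairing n (\<lambda>as. S as - S' as) T = pairing n S T - pairing n S' T"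
  using pairing_add[of n S "\<lambda>as. -1 * S' as"] pairing_cmult[of n "-1" S'] by simp

lemma pairing_sum: "pairing n (\<lambda>as. \<Sum>x\<in>X. S x as) T = (\<Sum>x\<in>X. pairing n (S x) T)"
  by (induction X rule: infinite_finite_induct)
    (use pairing_cmult[of n 0] in \<open>auto simp: pairing_add\<close>)

lemma D_pairing: "D p (pairing n S T) = pairing n (\<lambda>as. D p (S as)) T + pairing n S (\<lambda>as. D p (T as))"
  by (induction n arbitrary: S T) (auto simp: sum.distrib algebra_simps)

text \<open>The reason why contracting two slots commutes with the action of an antisymmetric
  matrix: the actions on the two contracted slots are opposite.\<close>

lemma sum_antisym_eq_0:
  fixes M X :: "'i::finite \<Rightarrow> 'i \<Rightarrow> 'r::comm_ring_1"
  assumes "\<And>a b. M a b = - M b a"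
  shows "(\<Sum>a b. M b a * X b a) + (\<Sum>a b. M b a * X a b) = 0"
proof -
  have "(\<Sum>a b. M b a * X a b) = (\<Sum>a b. M a b * X b a)"
    by (rule sum.swap)
  also have "\<dots> = - (\<Sum>a b. M b a * X b a)"
    unfolding sum_negf[symmetric] by (subst assms) simp
  finally show ?thesis by simp
qed

text \<open>An antisymmetric matrix is an infinitesimal rotation, and rotations preserve the full
  contraction. This is metric compatibility in an orthonormal frame.\<close>

lemma pairing_slots:
  assumes M: "\<And>a b. M a b = - M b a"
  shows "pairing n (slots M S) T + pairing n S (slots M T) = 0"
proof (induction n arbitrary: S T)
  case (Suc n)
  have 1: "pairing (Suc n) (slots M S) T =
      (\<Sum>a b. M b a * pairing n (\<lambda>as. S (b # as)) (\<lambda>as. T (a # as)))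
      + (\<Sum>a. pairing n (slots M (\<lambda>as. S (a # as))) (\<lambda>as. T (a # as)))" for S T
    by (simp add: pairing_add pairing_sum pairing_cmult sum.distrib)
  have 2: "pairing (Suc n) S (slots M T) =
      (\<Sum>a b. M b a * pairing n (\<lambda>as. S (a # as)) (\<lambda>as. T (b # as)))
      + (\<Sum>a. pairing n (\<lambda>as. S (a # as)) (slots M (\<lambda>as. T (a # as))))"
    unfolding pairing_commute[of "Suc n" S] 1 by (simp add: pairing_commute[of n _ "\<lambda>as. S (_ # as)"])
  have 3: "(\<Sum>a. pairing n (slots M (\<lambda>as. S (a # as))) (\<lambda>as. T (a # as)))
      + (\<Sum>a. pairing n (\<lambda>as. S (a # as)) (slots M (\<lambda>as. T (a # as)))) = 0"
    unfolding sum.distrib[symmetric] Suc.IH by simp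
  show ?case unfolding 1 2
    using 3 sum_antisym_eq_0[where M = M and X = "\<lambda>b a. pairing n (\<lambda>as. S (b # as)) (\<lambda>as. T (a # as))", OF M]
    by (simp add: algebra_simps)
qed simp

fun tensor1 :: "('i \<Rightarrow> 'r::zero) \<Rightarrow> 'i list \<Rightarrow> 'r" where
  "tensor1 T [i] = T i"
| "tensor1 T _ = 0"

fun tensor4 :: "('i \<Rightarrow> 'i \<Rightarrow> 'i \<Rightarrow> 'i \<Rightarrow> 'r::zero) \<Rightarrow> 'i list \<Rightarrow> 'r" where
  "tensor4 T [i, j, k, l] = T i j k l"
| "tensor4 T _ = 0"

text \<open>In an orthonormal frame \<open>e\<^sub>c = \<Sum> E i c \<partial>\<^sub>i\<close> the connection matrices \<open>A p\<close>, defined by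
  \<open>\<nabla>\<^bsub>\<partial>\<^sub>p\<^esub> e\<^sub>b = \<Sum> A p a b e\<^sub>a\<close>, are antisymmetric. The numbers \<open>Gam p i k\<close> are the Christoffel
  symbols \<open>\<Gamma>\<^sup>i\<^sub>p\<^sub>k\<close>.\<close>

locale frame_calculus =
  fixes E :: "4 \<Rightarrow> 4 \<Rightarrow> germ" and \<theta> :: "4 \<Rightarrow> 4 \<Rightarrow> germ"
    and A :: "4 \<Rightarrow> 4 \<Rightarrow> 4 \<Rightarrow> germ" and Gam :: "4 \<Rightarrow> 4 \<Rightarrow> 4 \<Rightarrow> germ"
    and X :: "4 \<Rightarrow> germ"
  assumes A_antisym: "A p a b = - A p b a"
    and D_frame: "D p (E i b) = (\<Sum>a. E i a * A p a b) - (\<Sum>k. Gam p i k * E k b)"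
    and Gam_sym: "Gam p i k = Gam k i p"
    and frame_inverse: "(\<Sum>i. \<theta> b i * E i a) = (if a = b then 1 else 0)"
    and D_coordinate: "D p (X i) = (if p = i then 1 else 0)"
begin

section \<open>Covariant derivative, curvature and the Ricci identity\<close>

definition nab :: "4 \<Rightarrow> (4 list \<Rightarrow> germ) \<Rightarrow> 4 list \<Rightarrow> germ" where
  "nab c T is = (\<Sum>p. E p c * (D p (T is) - slots (A p) T is))"

fun nabla :: "(4 list \<Rightarrow> germ) \<Rightarrow> 4 list \<Rightarrow> germ" where
  "nabla T [] = 0"
| "nabla T (c # is) = nab c T is"

text \<open>The curvature form of the connection matrices, with the two directions in coordinates
  and the two matrix indices in the frame; \<open>Rm\<close> converts the directions to the
  frame.\<close>

definition F :: "4 \<Rightarrow> 4 \<Rightarrow> 4 \<Rightarrow> 4 \<Rightarrow> germ" where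
  "F q p a b = D q (A p a b) - D p (A q a b)
     + (\<Sum>m. A q a m * A p m b) - (\<Sum>m. A p a m * A q m b)"

definition Rm :: "4 \<Rightarrow> 4 \<Rightarrow> 4 \<Rightarrow> 4 \<Rightarrow> germ" where
  "Rm d c a b = (\<Sum>q p. E q d * E p c * F q p a b)"

lemma nab_cong:
  "(\<And>as. length as = length is \<Longrightarrow> S as = T as) \<Longrightarrow> nab c S is = nab c T is"
  unfolding nab_def using slots_cong[of "is" S T] by simp

lemma nab_add: "nab c (\<lambda>as. S as + T as) is = nab c S is + nab c T is"
  by (simp add: nab_def slots_add sum.distrib sum_subtractf algebra_simps)

lemma nab_minus: "nab c (\<lambda>as. - T as) is = - nab c T is"
  by (simp add: nab_def slots_minus sum_negf algebra_simps sum_subtractf)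

lemma nab_diff: "nab c (\<lambda>as. S as - T as) is = nab c S is - nab c T is"
  by (simp add: nab_def slots_diff sum_subtractf sum.distrib algebra_simps)

lemma nab_zero [simp]: "nab c (\<lambda>as. 0) is = 0"
  by (simp add: nab_def)

lemma slots_F:
  "(D q (D p (T is) - slots (A p) T is) - slots (A q) (\<lambda>as. D p (T as) - slots (A p) T as) is)
   - (D p (D q (T is) - slots (A q) T is) - slots (A p) (\<lambda>as. D q (T as) - slots (A q) T as) is)
   = - slots (F q p) T is"
proof -
  have "slots (F q p) T is = slots (\<lambda>a b. D q (A p a b)) T is - slots (\<lambda>a b. D p (A q a b)) T is
      + slots (\<lambda>a b. (\<Sum>m. A q a m * A p m b) - (\<Sum>m. A p a m * A q m b)) T is"
    unfolding slots_mat_diff[symmetric] slots_mat_add[symmetric]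
    by (rule arg_cong[of _ _ "\<lambda>M. slots M T is"]) (auto simp: F_def fun_eq_iff)
  then show ?thesis
    using slots_commutator[of "A p" "A q" T "is"]
    by (simp add: D_slots slots_diff D_commute[of q p] algebra_simps)
qed

text \<open>The coordinate version is \<open>slots_F\<close>. Passing to frame directions adds only
  terms with Christoffel symbols, which are symmetric in the two directions because the connection
  is torsion-free.\<close>

lemma ricci_identity:
  "nabla (nabla T) (d # c # is) - nabla (nabla T) (c # d # is) = - slots (Rm d c) T is"
proof -
  define Y where "Y p as = D p (T as) - slots (A p) T as" for p as
  define Z where "Z q p = D q (Y p is) - slots (A q) (Y p) is" for q p
  have F: "Z q p - Z p q = - slots (F q p) T is" for q p
    unfolding Z_def Y_def by (rule slots_F)
  \<comment> \<open>The Christoffel terms; \<open>Gam_sym\<close> makes them symmetric, so they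
    cancel in the antisymmetrization.\<close>
  define G where "G d c = (\<Sum>q p k. E q d * E k c * Gam q p k * Y p is)" for d c
  have G: "G d c = G c d" for d c
  proof -
    have "G d c = (\<Sum>k p q. E q d * E k c * Gam q p k * Y p is)"
      unfolding G_def by (subst sum.swap, subst sum.swap, subst (2) sum.swap) (rule refl)
    also have "\<dots> = G c d" unfolding G_def
      by (intro sum.cong refl) (subst Gam_sym, simp add: ac_simps)
    finally show ?thesis .
  qed
  have N: "nabla T (m # as) = (\<Sum>p. E p m * Y p as)" for m as
    by (simp add: nab_def Y_def)
  have main: "nabla (nabla T) (d # c # is) =
     (\<Sum>q p. E q d * E p c * Z q p) - G d c" for d c
  proof -
    \<comment> \<open>Differentiating the coefficient \<open>E p c\<close> by \<open>D_frame\<close>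
      produces the rotation term that \<open>slots\<close> subtracts for the derivative slot
      \<open>c\<close>, and a Christoffel term that stays.\<close>
    have "D q (nabla T (c # is)) - slots (A q) (nabla T) (c # is)
       = (\<Sum>p. E p c * Z q p) - (\<Sum>p k. E k c * Gam q p k * Y p is)" for q
    proof -
      have 1: "(\<Sum>m. A q m c * (\<Sum>p. E p m * Y p is))
          = (\<Sum>p. (\<Sum>a. E p a * A q a c) * Y p is)"
        unfolding sum_distrib_left sum_distrib_right by (subst sum.swap) (simp add: ac_simps)
      have "slots (A q) (nabla T) (c # is) = (\<Sum>m. A q m c * (\<Sum>p. E p m * Y p is))
          + (\<Sum>p. E p c * slots (A q) (Y p) is)"
        by (simp only: slots.simps N slots_sum slots_cmult)
      then show ?thesis unfolding N D_sum D_mult D_frame 1 Z_def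
        by (simp add: algebra_simps sum.distrib sum_subtractf sum_distrib_left sum_distrib_right)
    qed
    then have "nabla (nabla T) (d # c # is) = (\<Sum>q. E q d * 
        ((\<Sum>p. E p c * Z q p) - (\<Sum>p k. E k c * Gam q p k * Y p is)))"
      by (simp add: nab_def[of d "nabla T"])
    then show ?thesis
      by (simp add: G_def right_diff_distrib sum_subtractf sum_distrib_left ac_simps)
  qed
  have "nabla (nabla T) (d # c # is) - nabla (nabla T) (c # d # is)
    = (\<Sum>q p. E q d * E p c * Z q p) - (\<Sum>q p. E q c * E p d * Z q p)"
    unfolding main G[of d c] by simp
  also have "(\<Sum>q p. E q c * E p d * Z q p) = (\<Sum>q p. E q d * E p c * Z p q)"
    by (subst sum.swap) (simp add: ac_simps)
  also have "(\<Sum>q p. E q d * E p c * Z q p) - \<dots>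
      = (\<Sum>q p. E q d * E p c * (Z q p - Z p q))"
    by (simp add: sum_subtractf right_diff_distrib)
  also have "\<dots> = - slots (Rm d c) T is"
    unfolding F Rm_def slots_mat_sum slots_mat_cmult by (simp add: sum_negf)
  finally show ?thesis .
qed

section \<open>Symmetries of the curvature and the first Bianchi identity\<close>

lemma F_antisym: "F q p a b = - F p q a b" "F q p a b = - F q p b a"
proof -
  show "F q p a b = - F p q a b" by (simp add: F_def)
  have "(\<Sum>m. A q a m * A p m b) = (\<Sum>m. A p b m * A q m a)" for q p a b
    by (rule sum.cong) (auto simp: A_antisym[of _ a] A_antisym[of _ _ b])
  then show "F q p a b = - F q p b a"
    unfolding F_def using A_antisym[of p a b] A_antisym[of q a b] by simp
qed

lemma Rm_antisym: "Rm d c a b = - Rm c d a b" "Rm d c a b = - Rm d c b a"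
proof -
  show "Rm d c a b = - Rm c d a b" unfolding Rm_def
    by (subst sum.swap, subst F_antisym(1)) (simp add: sum_negf ac_simps)
  show "Rm d c a b = - Rm d c b a" unfolding Rm_def
    by (subst F_antisym(2)) (simp add: sum_negf)
qed

lemma frame_cancel:
  assumes "\<And>i. (\<Sum>a. E i a * x a) = 0"
  shows "x b = 0"
proof -
  have "(\<Sum>i. \<theta> b i * (\<Sum>a. E i a * x a)) = (\<Sum>a. (\<Sum>i. \<theta> b i * E i a) * x a)"
    unfolding sum_distrib_left sum_distrib_right by (subst sum.swap) (simp add: ac_simps)
  also have "\<dots> = x b" by (simp add: frame_inverse if_distrib[of "\<lambda>y. y * _"] cong: if_cong)
  finally show ?thesis using assms by simp
qed

lemma nab_symmetric:
  assumes "\<And>x y. T [x, y] = T [y, x]"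
  shows "nab c T [a, b] = nab c T [b, a]"
  using assms by (simp add: nab_def add.commute)

lemma hessian_symmetric: "nabla (nabla (\<lambda>_. u)) [a, b] = nabla (nabla (\<lambda>_. u)) [b, a]"
  using ricci_identity[of "\<lambda>_. u" a b "[]"] by simp

text \<open>The Ricci identity is applied to the differentials of the coordinate functions, which span all
  covectors, and the Hessians are symmetric.\<close>

lemma bianchi1: "Rm d c a b + Rm c b a d + Rm b d a c = 0"
proof (rule frame_cancel[where x = "\<lambda>a. Rm d c a b + Rm c b a d + Rm b d a c"])
  fix i
  let ?N = "nabla (nabla (nabla (\<lambda>_. X i)))"
  have u: "nabla (\<lambda>_. X i) [a] = E i a" for a
    by (simp add: nab_def D_coordinate if_distrib[of "\<lambda>y. _ * y"] cong: if_cong)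
  have r: "(\<Sum>a. E i a * Rm d c a b) = ?N [c, d, b] - ?N [d, c, b]" for d c b
    using ricci_identity[of "nabla (\<lambda>_. X i)" d c "[b]"]
    by (simp add: u mult.commute eq_neg_iff_add_eq_0 algebra_simps del: nabla.simps)
  have s: "?N [d, c, b] = ?N [d, b, c]" for d c b
    using nab_symmetric[of "nabla (nabla (\<lambda>_. X i))" d c b] hessian_symmetric by simp
  have "(\<Sum>a. E i a * (Rm d c a b + Rm c b a d + Rm b d a c))
    = (?N [c, d, b] - ?N [d, c, b]) + (?N [b, c, d] - ?N [c, b, d]) + (?N [d, b, c] - ?N [b, d, c])"
    unfolding r[symmetric] by (simp add: distrib_left sum.distrib)
  then show "(\<Sum>a. E i a * (Rm d c a b + Rm c b a d + Rm b d a c)) = 0"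
    unfolding s[of c d b] s[of b c d] s[of d b c] by simp
qed

text \<open>The octahedron argument: in a signed sum of four instances of the first Bianchi identity
  all components but two cancel, by the antisymmetries.\<close>

lemma Rm_pair_symmetric: "Rm i j k l = Rm k l i j"
proof -
  have *: "2 * a = 2 * f" if "a + b + c = 0" "d + e - a = 0" "f + b - d = 0" "e - c - f = 0"
    for a b c d e f :: germ
  proof -
    have "2 * a - 2 * f = (a + b + c) - (d + e - a) - (f + b - d) + (e - c - f)"
      by (simp add: algebra_simps)
    then show ?thesis using that by simp
  qed
  have "2 * Rm i j k l = 2 * Rm k l i j"
  proof (rule *[of _ "Rm j l k i" "Rm l i k j" "Rm j k l i" "Rm k i l j"])
    show "Rm i j k l + Rm j l k i + Rm l i k j = 0" using bianchi1[of i j k l] .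
    show "Rm j k l i + Rm k i l j - Rm i j k l = 0"
      using bianchi1[of j k l i] Rm_antisym(2)[of i j l k] by simp
    show "Rm k l i j + Rm j l k i - Rm j k l i = 0"
      using bianchi1[of k l i j] Rm_antisym(1)[of l j i k] Rm_antisym(2)[of j l i k]
        Rm_antisym(2)[of j k i l] by simp
    show "Rm k i l j - Rm l i k j - Rm k l i j = 0"
      using bianchi1[of l i j k] Rm_antisym(2)[of l i j k] Rm_antisym(1)[of i k j l]
        Rm_antisym(2)[of k i j l] Rm_antisym(2)[of k l j i] by (simp add: algebra_simps)
  qed
  \<comment> \<open>Germs do not form a field, but as a real algebra they allow halving by
    \<open>scaleR\<close>.\<close>
  then have "(1/2) *\<^sub>R (2 * Rm i j k l) = (1/2) *\<^sub>R (2 * Rm k l i j)" by simp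
  then show ?thesis by (simp flip: scaleR_2 add: mult_2)
qed

section \<open>Derivatives of the curvature and the second Bianchi identity\<close>

definition R :: "4 list \<Rightarrow> germ" where "R = tensor4 Rm"

lemma R_simps [simp]: "R [i, j, k, l] = Rm i j k l"
  by (simp add: R_def)

lemma nab_swap: "nab c (\<lambda>as. T (swap_at k as)) is = nab c T (swap_at k is)"
  by (simp add: nab_def slots_swap)

text \<open>The connection terms of the two contracted slots cancel by antisymmetry. Contractions of
  other slots are brought to the front by \<open>swap_at\<close>.\<close>

lemma nab_contract: "nab c (\<lambda>as. \<Sum>p. T (p # p # as)) is = (\<Sum>p. nab c T (p # p # is))"
proof -
  have *: "(\<Sum>p. slots (A q) T (p # p # is)) = (\<Sum>p. slots (A q) (\<lambda>as. T (p # p # as)) is)" for q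
    using sum_antisym_eq_0[where M = "A q" and X = "\<lambda>b a. T (b # a # is)", OF A_antisym]
    by (simp add: sum.distrib add.assoc[symmetric])
  show ?thesis
    unfolding nab_def slots_sum D_sum
    by (subst sum.swap) (simp add: sum_distrib_left[symmetric] sum_subtractf * del: slots.simps)
qed

lemma nab_contract_mult:
  "nab c (\<lambda>as. \<Sum>p. S (p # as) * T [p]) is =
     (\<Sum>p. nab c S (p # is) * T [p] + S (p # is) * nab c T [p])"
proof -
  have *: "(\<Sum>p. slots (A q) (\<lambda>as. S (p # as) * T [p]) is) =
     (\<Sum>p. slots (A q) S (p # is) * T [p] + S (p # is) * slots (A q) T [p])" for q
    using sum_antisym_eq_0[where M = "A q" and X = "\<lambda>b a. S (b # is) * T [a]", OF A_antisym]
      slots_cmult[of "A q" "T [_]" "\<lambda>as. S (_ # as)"]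
    by (simp add: sum.distrib algebra_simps sum_distrib_left)
  have "nab c (\<lambda>as. \<Sum>p. S (p # as) * T [p]) is = (\<Sum>q. E q c * (\<Sum>p.
      (D q (S (p # is)) - slots (A q) S (p # is)) * T [p] + S (p # is) * (D q (T [p]) - slots (A q) T [p])))"
    unfolding nab_def slots_sum D_sum *
    by (simp add: sum_subtractf[symmetric] algebra_simps)
  also have "\<dots> = (\<Sum>p q. E q c * (
      (D q (S (p # is)) - slots (A q) S (p # is)) * T [p] + S (p # is) * (D q (T [p]) - slots (A q) T [p])))"
    unfolding sum_distrib_left by (rule sum.swap)
  also have "\<dots> = (\<Sum>p. nab c S (p # is) * T [p] + S (p # is) * nab c T [p])"
    unfolding nab_def sum_distrib_left sum_distrib_right sum.distrib[symmetric]
    by (simp add: distrib_left ac_simps)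
  finally show ?thesis .
qed

lemma nab_R_antisym: "nab e R [i, j, k, l] = - nab e R [j, i, k, l]"
proof -
  have "nab e R [i, j, k, l] = nab e (\<lambda>as. - R (swap_at 0 as)) [i, j, k, l]"
    by (rule nab_cong) (auto simp: length_Suc_conv intro: Rm_antisym(1))
  then show ?thesis by (simp add: nab_minus nab_swap)
qed

text \<open>For a covector field with constant components, the third covariant derivatives are antisymmetrized
  in two ways by the Ricci identity.\<close>

lemma bianchi2: "nab e R [d, c, a, b] + nab d R [c, e, a, b] + nab c R [e, d, a, b] = 0"
proof -
  define V where "V = tensor1 (\<lambda>i. if i = a then 1 else 0 :: germ)"
  let ?N = "nabla V" and ?NN = "nabla (nabla V)" and ?N3 = "nabla (nabla (nabla V))"
  \<comment> \<open>The contracted index, third in \<open>R\<close>, is moved to the front as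
    \<open>nab_contract_mult\<close> requires.\<close>
  let ?R = "\<lambda>as. R (swap_at (Suc 0) (swap_at 0 as))"
  have NN: "?NN [d, c, b] - ?NN [c, d, b] = - (\<Sum>m. ?R [m, d, c, b] * V [m])" for d c b
    using ricci_identity[of V d c "[b]"] by (simp del: nabla.simps)
  \<comment> \<open>First way: the Ricci identity for \<open>V\<close>, differentiated. The constant
    components of \<open>V\<close> single out the index \<open>a\<close> of the curvature.\<close>
  have left: "?N3 [e, d, c, b] - ?N3 [e, c, d, b]
      = - nab e R [d, c, a, b] - (\<Sum>m. Rm d c m b * ?N [e, m])" for e d c
  proof -
    have "?N3 [e, d, c, b] - ?N3 [e, c, d, b] = nab e (\<lambda>as. ?NN as - ?NN (swap_at 0 as)) [d, c, b]"
      by (simp add: nab_diff nab_swap)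
    also have "\<dots> = nab e (\<lambda>as. - (\<Sum>m. ?R (m # as) * V [m])) [d, c, b]"
      by (rule nab_cong) (auto simp: length_Suc_conv NN simp del: nabla.simps)
    also have "\<dots> = - (\<Sum>m. nab e ?R [m, d, c, b] * V [m] + Rm d c m b * ?N [e, m])"
      unfolding nab_minus nab_contract_mult[of e ?R V] by simp
    also have "\<dots> = - nab e R [d, c, a, b] - (\<Sum>m. Rm d c m b * ?N [e, m])"
      using nab_swap[of e "\<lambda>as. R (swap_at (Suc 0) as)" 0] nab_swap[of e R "Suc 0"]
      by (simp add: V_def sum.distrib if_distrib[of "\<lambda>y. _ * y"] cong: if_cong)
    finally show ?thesis .
  qed
  have left': "nab e R [d, c, a, b] = ?N3 [e, c, d, b] - ?N3 [e, d, c, b]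
      - (\<Sum>m. Rm d c m b * ?N [e, m])" for e d c
  proof -
    have "nab e R [d, c, a, b] = - (- nab e R [d, c, a, b] - (\<Sum>m. Rm d c m b * ?N [e, m]))
      - (\<Sum>m. Rm d c m b * ?N [e, m])" by simp
    then show ?thesis unfolding left[symmetric] by simp
  qed
  \<comment> \<open>Second way: the Ricci identity for the 2-tensor \<open>nabla V\<close>, where
    the curvature also acts on the derivative slot \<open>c\<close>.\<close>
  have right: "(\<Sum>m. Rm e d m c * ?N [m, b]) = ?N3 [d, e, c, b] - ?N3 [e, d, c, b]
      - (\<Sum>m. Rm e d m b * ?N [c, m])" for e d c
    using ricci_identity[of ?N e d "[c, b]"] by (simp add: algebra_simps)
  \<comment> \<open>In the cyclic sum all third derivatives of \<open>V\<close>, and the products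
    with \<open>b\<close> in the curvature, cancel. The first Bianchi identity disposes of the
    rest.\<close>
  have "nab e R [d, c, a, b] + nab d R [c, e, a, b] + nab c R [e, d, a, b]
      = (\<Sum>m. (Rm e d m c + Rm d c m e + Rm c e m d) * ?N [m, b])"
    unfolding left' distrib_right sum.distrib right by (simp add: algebra_simps)
  then show ?thesis using bianchi1[of e d _ c] by simp
qed

lemma nab_R_pair_symmetric: "nab e R [i, j, k, l] = nab e R [k, l, i, j]"
proof -
  have "nab e R [i, j, k, l] =
      nab e (\<lambda>as. R (swap_at 1 (swap_at 2 (swap_at 0 (swap_at 1 as))))) [i, j, k, l]"
    by (rule nab_cong) (auto simp: length_Suc_conv intro: Rm_pair_symmetric)
  then show ?thesis
    using nab_swap[of e "\<lambda>as. R (swap_at 1 (swap_at 2 (swap_at 0 as)))" 1]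
      nab_swap[of e "\<lambda>as. R (swap_at 1 (swap_at 2 as))" 0]
      nab_swap[of e "\<lambda>as. R (swap_at 1 as)" 2] nab_swap[of e R 1] by simp
qed

lemma nab2_R_antisym: "nab q (nabla R) [p, i, j, k, l] = - nab q (nabla R) [p, j, i, k, l]"
proof -
  have "nab q (nabla R) [p, i, j, k, l] = nab q (\<lambda>as. - nabla R (swap_at 1 as)) [p, i, j, k, l]"
    by (rule nab_cong) (auto simp: length_Suc_conv intro: nab_R_antisym)
  then show ?thesis by (simp add: nab_minus nab_swap)
qed

lemma nab_bianchi2:
  "nab q (nabla R) [e, d, c, a, b] + nab q (nabla R) [d, c, e, a, b] + nab q (nabla R) [c, e, d, a, b] = 0"
proof -
  let ?T = "nabla R"
  have "nab q (\<lambda>as. ?T as + ?T (swap_at 1 (swap_at 0 as)) + ?T (swap_at 0 (swap_at 1 as))) [e, d, c, a, b]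
      = nab q (\<lambda>as. 0) [e, d, c, a, b]"
    by (rule nab_cong) (auto simp: length_Suc_conv bianchi2)
  then show ?thesis
    using nab_swap[of q "\<lambda>as. ?T (swap_at 1 as)" 0] nab_swap[of q ?T 1]
      nab_swap[of q "\<lambda>as. ?T (swap_at 0 as)" 1] nab_swap[of q ?T 0]
    by (simp add: nab_add)
qed

definition Ric :: "4 \<Rightarrow> 4 \<Rightarrow> germ" where
  "Ric i k = (\<Sum>j. Rm i j k j)"

lemma Ric_symmetric: "Ric a b = Ric b a"
  unfolding Ric_def by (subst Rm_pair_symmetric) (rule refl)

definition tensor2 :: "(4 \<Rightarrow> 4 \<Rightarrow> germ) \<Rightarrow> 4 list \<Rightarrow> germ" where
  "tensor2 T is = (case is of [i, j] \<Rightarrow> T i j | _ \<Rightarrow> 0)"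

lemma nab_Ric: "nab e (tensor2 Ric) [i, k] = (\<Sum>j. nab e R [i, j, k, j])"
proof -
  let ?T = "\<lambda>as. R (swap_at 2 (swap_at 0 (swap_at 1 as)))"
  have "nab e (tensor2 Ric) [i, k] = nab e (\<lambda>as. \<Sum>j. ?T (j # j # as)) [i, k]"
    by (rule nab_cong) (auto simp: length_Suc_conv tensor2_def Ric_def)
  also have "\<dots> = (\<Sum>j. nab e ?T [j, j, i, k])" by (rule nab_contract)
  also have "\<dots> = (\<Sum>j. nab e R [i, j, k, j])"
    using nab_swap[of e "\<lambda>as. R (swap_at 2 (swap_at 0 as))" 1] nab_swap[of e "\<lambda>as. R (swap_at 2 as)" 0]
      nab_swap[of e R 2] by simp
  finally show ?thesis .
qed

definition div_R :: "4 list \<Rightarrow> germ" where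
  "div_R as = (case as of [j, k, l] \<Rightarrow> \<Sum>p. nab p R [j, p, k, l] | _ \<Rightarrow> 0)"

lemma nab_div_R: "nab i div_R [j, k, l] = (\<Sum>p. nab i (nabla R) [p, j, p, k, l])"
proof -
  let ?T = "\<lambda>as. nabla R (swap_at 1 as)"
  have "nab i div_R [j, k, l] = nab i (\<lambda>as. \<Sum>p. ?T (p # p # as)) [j, k, l]"
    by (rule nab_cong) (auto simp: length_Suc_conv div_R_def)
  also have "\<dots> = (\<Sum>p. nab i ?T [p, p, j, k, l])" by (rule nab_contract)
  finally show ?thesis using nab_swap[of i "nabla R" 1] by simp
qed

text \<open>The contracted second Bianchi identity. Pair symmetry first moves the contraction into
  the position in which \<open>Ric\<close> is defined.\<close>

lemma div_R_eq: "div_R [j, k, l] = nab l (tensor2 Ric) [k, j] - nab k (tensor2 Ric) [l, j]"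
proof -
  have "nab p R [j, p, k, l] = nab l R [k, p, j, p] - nab k R [l, p, j, p]" for p
    using bianchi2[of p k l j p] nab_R_pair_symmetric[of p j p k l] nab_R_antisym[of l p k j p]
    by (simp add: algebra_simps)
  then show ?thesis unfolding nab_Ric by (simp add: div_R_def sum_subtractf)
qed

end

section \<open>The curvature of a gradient Ricci soliton\<close>

locale frame_soliton = frame_calculus +
  fixes f :: germ and lam :: germ
  assumes soliton: "Ric a b + nabla (nabla (\<lambda>_. f)) [a, b] = (if a = b then lam else 0)"
    and D_lam: "D p lam = 0"
begin

abbreviation f1 :: "4 list \<Rightarrow> germ" where "f1 \<equiv> nabla (\<lambda>_. f)"
abbreviation H :: "4 list \<Rightarrow> germ" where "H \<equiv> nabla f1"

text \<open>The metric is parallel and \<open>lam\<close> is constant, so differentiating the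
  soliton equation leaves Ricci and Hessian only.\<close>

lemma nab_Ric_eq: "nab e (tensor2 Ric) [a, b] = - nab e H [a, b]"
proof -
  have "nab e (tensor2 Ric) [a, b] = nab e (\<lambda>as. tensor2 (\<lambda>a b. if a = b then lam else 0) as - H as) [a, b]"
    using soliton by (intro nab_cong) (auto simp: length_Suc_conv tensor2_def algebra_simps simp del: nabla.simps)
  moreover have "nab e (tensor2 (\<lambda>a b. if a = b then lam else 0)) [a, b] = 0"
    using A_antisym[of _ a b]
    by (simp add: nab_def tensor2_def D_lam if_distrib[of "\<lambda>y. _ * y"] if_distrib[of "D _"]
        mult.commute[of lam] distrib_right[symmetric] cong: if_cong)
  ultimately show ?thesis by (simp add: nab_diff)
qed

text \<open>By the soliton equation the antisymmetrized derivative of Ricci is one of third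
  derivatives of \<open>f\<close>, which the Ricci identity for \<open>f1\<close> turns into
  curvature times gradient.\<close>

lemma div_R_soliton: "div_R [j, k, l] = (\<Sum>a. Rm j a k l * f1 [a])"
proof -
  have H: "nab l H [k, j] = nab l H [j, k]" for j k l
    using hessian_symmetric[of f] by (intro nab_symmetric) 
  have "div_R [j, k, l] = nabla H [k, l, j] - nabla H [l, k, j]"
    unfolding div_R_eq nab_Ric_eq by simp
  also have "\<dots> = - (\<Sum>a. Rm k l a j * f1 [a])"
    using ricci_identity[of f1 k l "[j]"] by simp
  also have "\<dots> = (\<Sum>a. Rm j a k l * f1 [a])"
    unfolding sum_negf[symmetric]
    by (rule sum.cong) (simp_all add: Rm_pair_symmetric[of k l] Rm_antisym(1)[of _ j])
  finally show ?thesis .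
qed

lemma nab_div_R_soliton:
  "nab i div_R [j, k, l] = (\<Sum>a. nab i R [j, a, k, l] * f1 [a] + Rm j a k l * H [i, a])"
proof -
  let ?T = "\<lambda>as. R (swap_at 0 as)"
  have "nab i div_R [j, k, l] = nab i (\<lambda>as. \<Sum>a. ?T (a # as) * f1 [a]) [j, k, l]"
    by (rule nab_cong) (auto simp: length_Suc_conv div_R_soliton)
  then show ?thesis unfolding nab_contract_mult[of i ?T f1] by (simp add: nab_swap)
qed

text \<open>What commuting the derivatives \<open>p\<close> and \<open>i\<close> on the curvature
  with indices \<open>j p k l\<close> produces in the slots \<open>j\<close>, \<open>k\<close>,
  \<open>l\<close>. The contracted slot \<open>p\<close> gives a Ricci term, which is kept
  apart.\<close>

definition Q :: "4 \<Rightarrow> 4 \<Rightarrow> 4 \<Rightarrow> 4 \<Rightarrow> germ" where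
  "Q i j k l = (\<Sum>p a. Rm p i a j * Rm a p k l + Rm p i a k * Rm j p a l
     + Rm p i a l * Rm j p k a)"

text \<open>The second Bianchi identity writes the Laplacian as an antisymmetrized derivative of the
  divergence after commuting derivatives, and the divergence is known on a soliton. Each of the two
  terms contributes \<open>lam\<close> once.\<close>

lemma laplacian_R:
  "(\<Sum>p. nab p (nabla R) [p, i, j, k, l]) - (\<Sum>a. f1 [a] * nab a R [i, j, k, l])
     = 2 * lam * Rm i j k l + Q i j k l - Q j i k l"
proof -
  define C where "C i j = (\<Sum>p. nab p (nabla R) [i, j, p, k, l])" for i j
  have C: "C i j = nab i div_R [j, k, l] - Q i j k l + (\<Sum>a. Ric i a * Rm j a k l)" for i j
  proof -
    have "nab p (nabla R) [i, j, p, k, l] = nab i (nabla R) [p, j, p, k, l]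
      - (\<Sum>a. Rm p i a j * Rm a p k l + Rm p i a k * Rm j p a l + Rm p i a l * Rm j p k a)
      - (\<Sum>a. Rm p i a p * Rm j a k l)" for p
      using ricci_identity[of R p i "[j, p, k, l]"] by (simp add: algebra_simps sum.distrib)
    then have "C i j = nab i div_R [j, k, l] - Q i j k l
        - (\<Sum>p a. Rm p i a p * Rm j a k l)"
      unfolding C_def Q_def nab_div_R by (simp add: sum_subtractf)
    also have "(\<Sum>p a. Rm p i a p * Rm j a k l) = - (\<Sum>a. Ric i a * Rm j a k l)"
      unfolding Ric_def sum_distrib_right sum_negf[symmetric]
      by (subst sum.swap, intro sum.cong refl) (simp add: Rm_antisym(1)[of _ i])
    finally show ?thesis by simp
  qed
  have H: "H [i, a] = (if i = a then lam else 0) - Ric i a" for i a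
    using soliton[of i a] by (simp add: eq_diff_eq add.commute del: nabla.simps)
  \<comment> \<open>The Ricci term of the commutator cancels the one hidden in the Hessian, leaving
    \<open>lam\<close>.\<close>
  have C': "C i j = (\<Sum>a. nab i R [j, a, k, l] * f1 [a]) + lam * Rm j i k l - Q i j k l" for i j
    unfolding C nab_div_R_soliton H
    by (simp add: sum.distrib left_diff_distrib right_diff_distrib sum_subtractf if_distrib[of "\<lambda>y. y * _"] ac_simps
        del: nabla.simps cong: if_cong)
  have "nab p (nabla R) [p, i, j, k, l] = nab p (nabla R) [j, i, p, k, l] - nab p (nabla R) [i, j, p, k, l]" for p
    using nab_bianchi2[of p p i j k l] nab2_R_antisym[of p j p i k l] by (simp add: algebra_simps)
  then have "(\<Sum>p. nab p (nabla R) [p, i, j, k, l]) = C j i - C i j"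
    by (simp add: C_def sum_subtractf)
  also have "\<dots> = (\<Sum>a. (nab j R [i, a, k, l] - nab i R [j, a, k, l]) * f1 [a])
      + 2 * lam * Rm i j k l + Q i j k l - Q j i k l"
    unfolding C' Rm_antisym(1)[of j i]
    by (simp add: left_diff_distrib sum_subtractf algebra_simps del: nabla.simps)
  \<comment> \<open>The second Bianchi identity again: the derivatives along \<open>i\<close> and
    \<open>j\<close> combine to the one along the gradient of \<open>f\<close>, which is the drift
    term.\<close>
  also have "(\<Sum>a. (nab j R [i, a, k, l] - nab i R [j, a, k, l]) * f1 [a])
      = (\<Sum>a. f1 [a] * nab a R [i, j, k, l])"
  proof (intro sum.cong refl)
    fix a
    have "nab j R [i, a, k, l] - nab i R [j, a, k, l] = nab a R [i, j, k, l]"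
      using bianchi2[of a i j k l] nab_R_antisym[of j a i k l]
      by (simp add: algebra_simps)
    then show "(nab j R [i, a, k, l] - nab i R [j, a, k, l]) * f1 [a] = f1 [a] * nab a R [i, j, k, l]"
      by (simp add: mult.commute)
  qed
  finally show ?thesis by (simp add: algebra_simps del: nabla.simps)
qed

end

section \<open>The quadratic terms at a point\<close>

definition unit2 :: "4 \<Rightarrow> 4 \<Rightarrow> 4 \<Rightarrow> 4 \<Rightarrow> real" where
  "unit2 k l i j = (if i = k \<and> j = l then 1 else 0) - (if i = l \<and> j = k then 1 else 0)"

text \<open>The components of \<open>e\<^sub>1 \<and> e\<^sub>2 + s e\<^sub>3 \<and> e\<^sub>4\<close>, \<open>e\<^sub>1 \<and> e\<^sub>3 - s e\<^sub>2 \<and> e\<^sub>4\<close>, \<open>e\<^sub>1 \<and> e\<^sub>4 + s e\<^sub>2 \<and> e\<^sub>3\<close>, a basis of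
  the bivectors of duality \<open>s\<close>, in an oriented orthonormal frame.\<close>

definition om :: "real \<Rightarrow> 3 \<Rightarrow> 4 \<Rightarrow> 4 \<Rightarrow> real" where
  "om s \<alpha> i j =
     (if \<alpha> = 1 then unit2 1 2 i j + s * unit2 3 4 i j
      else if \<alpha> = 2 then unit2 1 3 i j - s * unit2 2 4 i j
      else unit2 1 4 i j + s * unit2 2 3 i j)"

definition om_contract ::
    "real \<Rightarrow> 3 \<Rightarrow> (4 \<Rightarrow> 4 \<Rightarrow> 'r) \<Rightarrow> 'r::{comm_ring_1, real_algebra_1}" where
  "om_contract s \<alpha> h = (\<Sum>i j. of_real (om s \<alpha> i j) * h i j)"

lemma om_contract_eq:
  "om_contract s 1 h = h 1 2 - h 2 1 + of_real s * (h 3 4 - h 4 3)"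
  "om_contract s 2 h = h 1 3 - h 3 1 - of_real s * (h 2 4 - h 4 2)"
  "om_contract s 3 h = h 1 4 - h 4 1 + of_real s * (h 2 3 - h 3 2)"
  by (simp_all add: om_contract_def om_def unit2_def sum_4 algebra_simps)

text \<open>Four times the value of \<open>T\<close> on the bivectors \<open>om s \<alpha>\<close>
  and \<open>om s \<beta>\<close>, hence eight times the matrix entry in the orthonormal basis, as
  these bivectors have norm \<surd>2.\<close>

definition om_comp :: "real \<Rightarrow> (4 \<Rightarrow> 4 \<Rightarrow> 4 \<Rightarrow> 4 \<Rightarrow> 'r) \<Rightarrow> 3 \<Rightarrow> 3 \<Rightarrow> 'r::{comm_ring_1, real_algebra_1}" where
  "om_comp s T \<alpha> \<beta> = om_contract s \<alpha> (\<lambda>i j. om_contract s \<beta> (T i j))"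

section \<open>Algebraic curvature tensors in dimension four\<close>

locale curvature_tensor =
  fixes r :: tensor4
  assumes r_antisym: "r i j k l = - r j i k l"
    and r_pair: "r i j k l = r k l i j"
    and r_bianchi: "r i j k l + r j k i l + r k i j l = 0"
begin

lemma r_antisym2: "r i j k l = - r i j l k"
  using r_pair[of i j k l] r_antisym[of k l i j] r_pair[of l k i j] by simp

text \<open>A normal form: index pairs become increasing and ordered among themselves, and the
  Bianchi identity eliminates one of the remaining 21 components. Polynomial identities in the
  curvature then hold by ring normalization.\<close>

lemma canon:
  "r i i k l = 0" "r i j k k = 0"
  "r 2 1 k l = - r 1 2 k l" "r 3 1 k l = - r 1 3 k l" "r 4 1 k l = - r 1 4 k l"
  "r 3 2 k l = - r 2 3 k l" "r 4 2 k l = - r 2 4 k l" "r 4 3 k l = - r 3 4 k l"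
  "r i j 2 1 = - r i j 1 2" "r i j 3 1 = - r i j 1 3" "r i j 4 1 = - r i j 1 4"
  "r i j 3 2 = - r i j 2 3" "r i j 4 2 = - r i j 2 4" "r i j 4 3 = - r i j 3 4"
  "r 1 3 1 2 = r 1 2 1 3" "r 1 4 1 2 = r 1 2 1 4" "r 2 3 1 2 = r 1 2 2 3" "r 2 4 1 2 = r 1 2 2 4"
  "r 3 4 1 2 = r 1 2 3 4" "r 1 4 1 3 = r 1 3 1 4" "r 2 3 1 3 = r 1 3 2 3" "r 2 4 1 3 = r 1 3 2 4"
  "r 3 4 1 3 = r 1 3 3 4" "r 2 3 1 4 = r 1 4 2 3" "r 2 4 1 4 = r 1 4 2 4" "r 3 4 1 4 = r 1 4 3 4"
  "r 2 4 2 3 = r 2 3 2 4" "r 3 4 2 3 = r 2 3 3 4" "r 3 4 2 4 = r 2 4 3 4"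
  "r 1 4 2 3 = r 1 3 2 4 - r 1 2 3 4"
  using r_antisym[of i i k l] r_antisym2[of i j k k]
    r_bianchi[of 1 2 3 4] r_antisym[of 3 1 2 4] r_pair[of 2 3 1 4]
  by (simp_all add: r_antisym[of 2 1] r_antisym[of 3 1] r_antisym[of 4 1] r_antisym[of 3 2]
      r_antisym[of 4 2] r_antisym[of 4 3] r_antisym2[of _ _ 2 1] r_antisym2[of _ _ 3 1]
      r_antisym2[of _ _ 4 1] r_antisym2[of _ _ 3 2] r_antisym2[of _ _ 4 2] r_antisym2[of _ _ 4 3]
      r_pair[of 1 3 1 2] r_pair[of 1 4 1 2] r_pair[of 2 3 1 2] r_pair[of 2 4 1 2] r_pair[of 3 4 1 2]
      r_pair[of 1 4 1 3] r_pair[of 2 3 1 3] r_pair[of 2 4 1 3] r_pair[of 3 4 1 3] r_pair[of 2 3 1 4]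
      r_pair[of 2 4 1 4] r_pair[of 3 4 1 4] r_pair[of 2 4 2 3] r_pair[of 3 4 2 3] r_pair[of 3 4 2 4])

definition ric :: tensor2 where "ric i k = (\<Sum>j. r i j k j)"

definition q :: tensor4 where
  "q i j k l = (\<Sum>p a. r p i a j * r a p k l + r p i a k * r j p a l + r p i a l * r j p k a)"

lemma ric_eqs:
  "ric 1 1 = r 1 2 1 2 + r 1 3 1 3 + r 1 4 1 4" "ric 2 2 = r 1 2 1 2 + r 2 3 2 3 + r 2 4 2 4"
  "ric 3 3 = r 1 3 1 3 + r 2 3 2 3 + r 3 4 3 4" "ric 4 4 = r 1 4 1 4 + r 2 4 2 4 + r 3 4 3 4"
  "ric 1 2 = r 1 3 2 3 + r 1 4 2 4" "ric 2 1 = r 1 3 2 3 + r 1 4 2 4"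
  "ric 1 3 = r 1 4 3 4 - r 1 2 2 3" "ric 3 1 = r 1 4 3 4 - r 1 2 2 3"
  "ric 1 4 = - r 1 2 2 4 - r 1 3 3 4" "ric 4 1 = - r 1 2 2 4 - r 1 3 3 4"
  "ric 2 3 = r 1 2 1 3 + r 2 4 3 4" "ric 3 2 = r 1 2 1 3 + r 2 4 3 4"
  "ric 2 4 = r 1 2 1 4 - r 2 3 3 4" "ric 4 2 = r 1 2 1 4 - r 2 3 3 4"
  "ric 3 4 = r 1 3 1 4 + r 2 3 2 4" "ric 4 3 = r 1 3 1 4 + r 2 3 2 4"
  by (simp_all add: ric_def sum_4 canon)

text \<open>For the block t of duality \<open>s\<close> this is 2 tr(t) t - 3 t^2, with coefficients
  for which the scalar curvature drops out in \<open>reaction_identity\<close>.\<close>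

definition sq :: "real \<Rightarrow> 3 \<Rightarrow> 3 \<Rightarrow> real" where
  "sq s \<alpha> \<beta> = 2 * (\<Sum>\<gamma>. om_comp s r \<gamma> \<gamma>) * om_comp s r \<alpha> \<beta>
     - 3 * (\<Sum>\<gamma>. om_comp s r \<alpha> \<gamma> * om_comp s r \<gamma> \<beta>)"

lemmas om_comp_expand = om_comp_def om_contract_eq kn_prod_def ric_eqs q_def sum_3 sum_4 sq_def

text \<open>Up to multiples of the identity the reaction term is a polynomial in the block of the
  curvature operator on bivectors of the chosen duality alone.\<close>

lemma q_offdiag:
  assumes "s = 1 \<or> s = -1"
  shows "8 * om_comp s q 1 2 + 2 * om_comp s (kn_prod ric ric) 1 2 = sq s 1 2"
    "8 * om_comp s q 2 1 + 2 * om_comp s (kn_prod ric ric) 2 1 = sq s 2 1"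
    "8 * om_comp s q 1 3 + 2 * om_comp s (kn_prod ric ric) 1 3 = sq s 1 3"
    "8 * om_comp s q 3 1 + 2 * om_comp s (kn_prod ric ric) 3 1 = sq s 3 1"
    "8 * om_comp s q 2 3 + 2 * om_comp s (kn_prod ric ric) 2 3 = sq s 2 3"
    "8 * om_comp s q 3 2 + 2 * om_comp s (kn_prod ric ric) 3 2 = sq s 3 2"
  by (use assms in \<open>elim disjE; simp only:\<close>; simp add: om_comp_expand canon algebra_simps)+

lemma q_diag:
  assumes "s = 1 \<or> s = -1"
  shows "8 * om_comp s q 2 2 + 2 * om_comp s (kn_prod ric ric) 2 2 - sq s 2 2
      = 8 * om_comp s q 1 1 + 2 * om_comp s (kn_prod ric ric) 1 1 - sq s 1 1"
    "8 * om_comp s q 3 3 + 2 * om_comp s (kn_prod ric ric) 3 3 - sq s 3 3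
      = 8 * om_comp s q 1 1 + 2 * om_comp s (kn_prod ric ric) 1 1 - sq s 1 1"
  by (use assms in \<open>elim disjE; simp only:\<close>; simp add: om_comp_expand canon algebra_simps)+

text \<open>The matrix of \<open>W\<^sup>\<plusminus>\<close> in the orthonormal basis \<open>om s \<alpha> / \<surd>2\<close>; each \<open>om_contract\<close> counts every pair
  of indices twice.\<close>

definition w :: "real \<Rightarrow> 3 \<Rightarrow> 3 \<Rightarrow> real" where
  "w s \<alpha> \<beta> = om_comp s r \<alpha> \<beta> / 8 - (if \<alpha> = \<beta> then (\<Sum>i. ric i i) / 12 else 0)"

lemma om_comp_symmetric: "om_comp s r \<alpha> \<beta> = om_comp s r \<beta> \<alpha>"
proof -
  have "om_comp s r \<alpha> \<beta> = (\<Sum>i j k l. om s \<alpha> i j * om s \<beta> k l * r i j k l)" for \<alpha> \<beta>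
    by (simp add: om_comp_def om_contract_def sum_distrib_left mult.assoc)
  moreover have "(\<Sum>i j k l. om s \<alpha> i j * om s \<beta> k l * r i j k l)
     = (\<Sum>k l i j. om s \<alpha> i j * om s \<beta> k l * r i j k l)"
    by (subst (2) sum.swap, subst sum.swap, subst (3) sum.swap, subst (2) sum.swap) (rule refl)
  ultimately show ?thesis by (simp add: r_pair mult.commute[of "om s \<alpha> _ _"])
qed

text \<open>The part of the trace that depends on \<open>s\<close> is a multiple of the Bianchi sum,
  so both dualities have the same trace.\<close>

lemma trace_om_comp:
  assumes "s = 1 \<or> s = -1"
  shows "(\<Sum>\<alpha>. om_comp s r \<alpha> \<alpha>) = 2 * (\<Sum>i. ric i i)"
  using assms by (elim disjE) (simp_all add: om_comp_expand canon)

text \<open>The block is t = 8 w + c id with w trace-free and tr t = 3 c. Pairing w with 2 tr(t) t -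
  3 t^2 gives (48 - 48) c |w|^2 - 192 tr w^3. For a symmetric trace-free 3 by 3 matrix tr w^3 = 3
  det w, so this is -576 det w, that is 8 times the right side.\<close>

lemma reaction_identity:
  assumes s: "s = 1 \<or> s = -1"
  shows "(\<Sum>\<alpha> \<beta>. w s \<alpha> \<beta> * (om_comp s q \<alpha> \<beta> + om_comp s (kn_prod ric ric) \<alpha> \<beta> / 4))
    = -72 * det (\<chi> \<alpha> \<beta>. w s \<alpha> \<beta>)"
proof -
  define t where "t = om_comp s r"
  define x where "x \<alpha> \<beta> = 8 * om_comp s q \<alpha> \<beta> + 2 * om_comp s (kn_prod ric ric) \<alpha> \<beta>" for \<alpha> \<beta>
  \<comment> \<open>The defect of \<open>x\<close> from \<open>sq\<close> is this multiple of the
    identity, which pairs to zero with the trace-free \<open>w s\<close>.\<close>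
  define c where "c = x 1 1 - sq s 1 1"
  have ric: "(\<Sum>i. ric i i) = (t 1 1 + t 2 2 + t 3 3) / 2"
    using trace_om_comp[OF s] by (simp add: t_def sum_3)
  have x: "x \<alpha> \<beta> = sq s \<alpha> \<beta> + (if \<alpha> = \<beta> then c else 0)" for \<alpha> \<beta>
    using q_offdiag[OF s] q_diag[OF s] exhaust_3[of \<alpha>] exhaust_3[of \<beta>] unfolding c_def x_def by auto
  have sym: "t 2 1 = t 1 2" "t 3 1 = t 1 3" "t 3 2 = t 2 3"
    by (simp_all add: t_def om_comp_symmetric[of s 2 1] om_comp_symmetric[of s 3] )
  have "(\<Sum>\<alpha> \<beta>. w s \<alpha> \<beta> * x \<alpha> \<beta>) = 8 * (-72 * det (\<chi> \<alpha> \<beta>. w s \<alpha> \<beta>))"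
    unfolding x w_def ric sq_def det_3 t_def[symmetric] by (simp add: sum_3 sym field_simps)
  moreover have "(\<Sum>\<alpha> \<beta>. w s \<alpha> \<beta> * x \<alpha> \<beta>) =
      8 * (\<Sum>\<alpha> \<beta>. w s \<alpha> \<beta> * (om_comp s q \<alpha> \<beta> + om_comp s (kn_prod ric ric) \<alpha> \<beta> / 4))"
    unfolding x_def sum_distrib_left by (intro sum.cong refl) (simp add: algebra_simps)
  ultimately show ?thesis by simp
qed

end

section \<open>The projection to a duality type\<close>

lemma D_of_real [simp]: "D p (of_real r) = 0"
  by (simp add: of_real_def)

lemma ev_of_real [simp]: "ev (of_real r) = r"
  by (simp add: of_real_def)

text \<open>The splitting so(4) = so(3) + so(3): an infinitesimal rotation of the frame acts on the
  bivectors of one duality by an antisymmetric 3 by 3 matrix.\<close>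

lemma om_rotation:
  fixes M :: "4 \<Rightarrow> 4 \<Rightarrow> 'r::{comm_ring_1, real_algebra_1}"
  assumes M: "\<And>a b. M a b = - M b a" and s: "s = 1 \<or> s = -1"
  obtains m where "\<And>\<alpha> \<beta>. m \<alpha> \<beta> = - m \<beta> \<alpha>"
    "\<And>\<alpha> i j. (\<Sum>b. M b i * of_real (om s \<alpha> b j)) + (\<Sum>b. M b j * of_real (om s \<alpha> i b))
       = (\<Sum>\<beta>. m \<alpha> \<beta> * of_real (om s \<beta> i j))"
proof -
  \<comment> \<open>Up to sign these are the components of \<open>M\<close> along
    \<open>om s 3\<close>, \<open>om s 2\<close> and \<open>om s 1\<close>: only the part of
    \<open>M\<close> of duality \<open>s\<close> acts.\<close>
  define m12 m13 m23 where "m12 = M 2 3 + of_real s * M 1 4" and "m13 = M 2 4 - of_real s * M 1 3"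
    and "m23 = M 3 4 + of_real s * M 1 2"
  define u where "u k l \<alpha> \<beta> = (if \<alpha> = k \<and> \<beta> = l then 1 else 0) - (if \<alpha> = l \<and> \<beta> = k then 1 else 0 :: real)"
    for k l \<alpha> \<beta> :: 3
  define m where "m \<alpha> \<beta> = of_real (u 1 2 \<alpha> \<beta>) * m12 + of_real (u 1 3 \<alpha> \<beta>) * m13
     + of_real (u 2 3 \<alpha> \<beta>) * m23" for \<alpha> \<beta>
  have z: "M a a = 0" for a
  proof -
    have "M a a + M a a = 0" using M[of a a] by (simp only: eq_neg_iff_add_eq_0)
    then have "2 *\<^sub>R M a a = 0" by (simp only: scaleR_2)
    then show ?thesis by simp
  qed
  have u: "u k l \<beta> \<alpha> = - u k l \<alpha> \<beta>" for k l \<alpha> \<beta>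
    unfolding u_def by (simp add: conj_commute split del: if_split)
  note M' = z M[of 2 1] M[of 3 1] M[of 4 1] M[of 3 2] M[of 4 2] M[of 4 3]
  show ?thesis
  proof
    show "m \<alpha> \<beta> = - m \<beta> \<alpha>" for \<alpha> \<beta>
      by (simp add: m_def u[of _ _ \<beta> \<alpha>])
    have "\<forall>\<alpha> i j. (\<Sum>b. M b i * of_real (om s \<alpha> b j)) + (\<Sum>b. M b j * of_real (om s \<alpha> i b))
       = (\<Sum>\<beta>. m \<alpha> \<beta> * of_real (om s \<beta> i j))"
      unfolding forall_3 forall_4 sum_3 sum_4 m_def m12_def m13_def m23_def
      using s by (elim disjE) (simp_all add: om_def unit2_def u_def M' algebra_simps)
    then show "(\<Sum>b. M b i * of_real (om s \<alpha> b j)) + (\<Sum>b. M b j * of_real (om s \<alpha> i b))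
       = (\<Sum>\<beta>. m \<alpha> \<beta> * of_real (om s \<beta> i j))" for \<alpha> i j by blast
  qed
qed

lemma om_contract_add: "om_contract s \<alpha> (\<lambda>i j. g i j + h i j) = om_contract s \<alpha> g + om_contract s \<alpha> h"
  by (simp add: om_contract_def distrib_left sum.distrib)

lemma om_contract_mult: "om_contract s \<alpha> (\<lambda>i j. c * h i j) = c * om_contract s \<alpha> h"
  by (simp add: om_contract_def sum_distrib_left ac_simps)

lemma om_contract_rotation:
  fixes M :: "4 \<Rightarrow> 4 \<Rightarrow> 'r::{comm_ring_1, real_algebra_1}"
  assumes M: "\<And>a b. M a b = - M b a"
    and m: "\<And>\<alpha> i j. (\<Sum>b. M b i * of_real (om s \<alpha> b j)) + (\<Sum>b. M b j * of_real (om s \<alpha> i b))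
       = (\<Sum>\<beta>. m \<alpha> \<beta> * of_real (om s \<beta> i j))"
  shows "om_contract s \<alpha> (\<lambda>i j. (\<Sum>b. M b i * h b j) + (\<Sum>b. M b j * h i b))
    = - (\<Sum>\<beta>. m \<alpha> \<beta> * om_contract s \<beta> h)"
proof -
  let ?o = "\<lambda>i j. of_real (om s \<alpha> i j) :: 'r"
  have "om_contract s \<alpha> (\<lambda>i j. (\<Sum>b. M b i * h b j) + (\<Sum>b. M b j * h i b))
    = (\<Sum>i j b. ?o i j * M b i * h b j)
      + (\<Sum>i j b. ?o i j * M b j * h i b)"
    by (simp add: om_contract_def distrib_left sum.distrib sum_distrib_left mult.assoc)
  also have "(\<Sum>i j b. ?o i j * M b i * h b j)
     = (\<Sum>b j i. ?o i j * M b i * h b j)"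
    by (subst sum.swap, subst (2) sum.swap, subst sum.swap) (rule refl)
  also have "(\<Sum>i j b. ?o i j * M b j * h i b)
     = (\<Sum>i b j. ?o i j * M b j * h i b)"
    by (subst (2) sum.swap) (rule refl)
  also have "(\<Sum>b j i. ?o i j * M b i * h b j)
      + (\<Sum>i b j. ?o i j * M b j * h i b)
    = (\<Sum>i j. ((\<Sum>b. M i b * ?o b j) + (\<Sum>b. M j b * ?o i b)) * h i j)"
    by (simp add: distrib_left distrib_right sum.distrib sum_distrib_left sum_distrib_right ac_simps)
  also have "\<dots> = (\<Sum>i j. - (\<Sum>\<beta>. m \<alpha> \<beta> * of_real (om s \<beta> i j)) * h i j)"
  proof -
    have "(\<Sum>b. M i b * x b) = - (\<Sum>b. M b i * x b)" for i x
      unfolding sum_negf[symmetric] by (intro sum.cong refl) (subst M, simp)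
    then show ?thesis unfolding m[symmetric] by simp
  qed
  also have "\<dots> = - (\<Sum>i j \<beta>. m \<alpha> \<beta> * (of_real (om s \<beta> i j) * h i j))"
    by (simp add: sum_distrib_right sum_negf mult.assoc)
  also have "(\<Sum>i j \<beta>. m \<alpha> \<beta> * (of_real (om s \<beta> i j) * h i j))
     = (\<Sum>\<beta> i j. m \<alpha> \<beta> * (of_real (om s \<beta> i j) * h i j))"
    by (subst (2) sum.swap, subst sum.swap) (rule refl)
  finally show ?thesis by (simp add: om_contract_def sum_distrib_left)
qed

text \<open>The orthogonal projection of the first index pair. The factor 1/4 is the reciprocal of
  the sum of squares of all components of \<open>om s \<alpha>\<close>, see
  \<open>om_orthogonal\<close>.\<close>

fun proj_first :: "real \<Rightarrow> (4 list \<Rightarrow> 'r) \<Rightarrow> 4 list \<Rightarrow> 'r::{comm_ring_1, real_algebra_1}" where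
  "proj_first s T (i # j # as) =
     of_real (1/4) * (\<Sum>\<alpha>. of_real (om s \<alpha> i j) * om_contract s \<alpha> (\<lambda>a b. T (a # b # as)))"
| "proj_first s T _ = 0"

lemma slots_om_contract:
  "slots M (\<lambda>as. om_contract s \<alpha> (\<lambda>a b. T (a # b # as))) is
     = om_contract s \<alpha> (\<lambda>a b. slots M (\<lambda>as. T (a # b # as)) is)"
  by (simp add: om_contract_def slots_sum slots_cmult)

text \<open>By \<open>om_rotation\<close> the outer and the inner factor \<open>om\<close> are
  rotated by the same matrix \<open>m\<close>, and its antisymmetry makes the two contributions
  cancel: the projection is parallel.\<close>

lemma slots_proj_first:
  fixes M :: "4 \<Rightarrow> 4 \<Rightarrow> 'r::{comm_ring_1, real_algebra_1}"
  assumes M: "\<And>a b. M a b = - M b a" and s: "s = 1 \<or> s = -1"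
  shows "slots M (proj_first s T) (i # j # is) = proj_first s (slots M T) (i # j # is)"
proof -
  obtain m where m: "\<And>\<alpha> \<beta>. m \<alpha> \<beta> = - m \<beta> \<alpha>"
    "\<And>\<alpha> i j. (\<Sum>b. M b i * of_real (om s \<alpha> b j)) + (\<Sum>b. M b j * of_real (om s \<alpha> i b))
       = (\<Sum>\<beta>. m \<alpha> \<beta> * of_real (om s \<beta> i j))"
    by (rule om_rotation[OF M s]) (rule that; assumption)
  let ?o = "\<lambda>\<alpha> i j. of_real (om s \<alpha> i j) :: 'r"
  define c where "c \<alpha> as = om_contract s \<alpha> (\<lambda>a b. T (a # b # as))" for \<alpha> as
  define d where "d \<alpha> = om_contract s \<alpha> (\<lambda>a b. slots M (\<lambda>as. T (a # b # as)) is)" for \<alpha>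
  have swap: "(\<Sum>b. M b i * (\<Sum>\<alpha>. ?o \<alpha> b j * c \<alpha> is)) = (\<Sum>\<alpha>. (\<Sum>b. M b i * ?o \<alpha> b j) * c \<alpha> is)"
    "(\<Sum>b. M b j * (\<Sum>\<alpha>. ?o \<alpha> i b * c \<alpha> is)) = (\<Sum>\<alpha>. (\<Sum>b. M b j * ?o \<alpha> i b) * c \<alpha> is)"
    unfolding sum_distrib_left sum_distrib_right by (subst sum.swap, simp add: mult.assoc)+
  have "slots M (proj_first s T) (i # j # is) = of_real (1/4) * (
      (\<Sum>\<alpha>. ((\<Sum>b. M b i * ?o \<alpha> b j) + (\<Sum>b. M b j * ?o \<alpha> i b)) * c \<alpha> is)
      + (\<Sum>\<alpha>. ?o \<alpha> i j * d \<alpha>))"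
    unfolding distrib_right sum.distrib swap[symmetric]
    by (simp add: slots_sum slots_cmult slots_om_contract c_def d_def distrib_left sum_distrib_left
        mult.left_commute[of _ "of_real (1/4)"] del: of_real_divide)
  also have "(\<Sum>\<alpha>. ((\<Sum>b. M b i * ?o \<alpha> b j) + (\<Sum>b. M b j * ?o \<alpha> i b)) * c \<alpha> is)
     = (\<Sum>\<alpha> \<beta>. m \<alpha> \<beta> * ?o \<beta> i j * c \<alpha> is)"
    unfolding m(2) by (simp add: sum_distrib_right)
  also have "\<dots> = (\<Sum>\<alpha> \<beta>. m \<beta> \<alpha> * ?o \<alpha> i j * c \<beta> is)"
    by (rule sum.swap)
  also have "\<dots> = (\<Sum>\<alpha>. ?o \<alpha> i j * - (\<Sum>\<beta>. m \<alpha> \<beta> * c \<beta> is))"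
    unfolding sum_negf[symmetric] sum_distrib_left
    by (intro sum.cong refl) (subst m(1), simp add: ac_simps)
  also have "of_real (1/4) * (\<dots> + (\<Sum>\<alpha>. ?o \<alpha> i j * d \<alpha>)) = of_real (1/4) * (\<Sum>\<alpha>. ?o \<alpha> i j *
      (- (\<Sum>\<beta>. m \<alpha> \<beta> * c \<beta> is) + d \<alpha>))"
    by (simp add: right_diff_distrib sum_subtractf sum_negf del: of_real_divide)
  also have "\<dots> = proj_first s (slots M T) (i # j # is)"
  proof -
    have "om_contract s \<alpha> (\<lambda>a b. slots M T (a # b # is)) = - (\<Sum>\<beta>. m \<alpha> \<beta> * c \<beta> is) + d \<alpha>" for \<alpha>
      using om_contract_rotation[OF M m(2), of \<alpha> "\<lambda>a b. T (a # b # is)"]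
        om_contract_add[of s \<alpha> "\<lambda>i j. (\<Sum>b. M b i * T (b # j # is)) + (\<Sum>b. M b j * T (i # b # is))"
          "\<lambda>i j. slots M (\<lambda>as. T (i # j # as)) is"]
      by (simp add: c_def d_def add.assoc)
    then show ?thesis by simp
  qed
  finally show ?thesis .
qed

lemma sum_rotate3:
  "(\<Sum>i\<in>I. \<Sum>j\<in>J. \<Sum>k\<in>K. f i j k) = (\<Sum>k\<in>K. \<Sum>i\<in>I. \<Sum>j\<in>J. f i j k)"
proof -
  have "(\<Sum>i\<in>I. \<Sum>j\<in>J. \<Sum>k\<in>K. f i j k) = (\<Sum>i\<in>I. \<Sum>k\<in>K. \<Sum>j\<in>J. f i j k)"
    by (intro sum.cong refl sum.swap)
  then show ?thesis using sum.swap[of "\<lambda>i k. \<Sum>j\<in>J. f i j k" K I] by simp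
qed

lemma pairing_om_contract:
  "pairing n S (\<lambda>as. om_contract s \<alpha> (\<lambda>a b. T (a # b # as)))
     = om_contract s \<alpha> (\<lambda>a b. pairing n S (\<lambda>as. T (a # b # as)))"
  unfolding pairing_commute[of n S] by (simp add: om_contract_def pairing_sum pairing_cmult)

lemma pairing_proj_first:
  "pairing (Suc (Suc n)) (proj_first s S) T = of_real (1/4) * (\<Sum>\<alpha>.
      pairing n (\<lambda>as. om_contract s \<alpha> (\<lambda>a b. S (a # b # as))) (\<lambda>as. om_contract s \<alpha> (\<lambda>a b. T (a # b # as))))"
proof -
  have "pairing (Suc (Suc n)) (proj_first s S) T = of_real (1/4) * (\<Sum>i j \<alpha>.
      of_real (om s \<alpha> i j) * pairing n (\<lambda>as. om_contract s \<alpha> (\<lambda>a b. S (a # b # as))) (\<lambda>as. T (i # j # as)))"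
    by (simp add: pairing_cmult pairing_sum sum_distrib_left del: of_real_divide)
  also have "\<dots> = of_real (1/4) * (\<Sum>\<alpha>. om_contract s \<alpha> (\<lambda>i j.
      pairing n (\<lambda>as. om_contract s \<alpha> (\<lambda>a b. S (a # b # as))) (\<lambda>as. T (i # j # as))))"
    unfolding om_contract_def[of s _ "\<lambda>i j. pairing n _ (\<lambda>as. T (i # j # as))"]
    by (rule arg_cong[OF sum_rotate3])
  finally show ?thesis
    unfolding pairing_om_contract .
qed

lemma om_contract_sum: "om_contract s \<alpha> (\<lambda>i j. \<Sum>x\<in>X. h x i j) = (\<Sum>x\<in>X. om_contract s \<alpha> (h x))"
  unfolding om_contract_def sum_distrib_left by (rule sum_rotate3)

lemma om_contract_swap:
  "om_contract s \<alpha> (\<lambda>i j. om_contract s \<beta> (h i j)) = om_contract s \<beta> (\<lambda>k l. om_contract s \<alpha> (\<lambda>i j. h i j k l))"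
  unfolding om_contract_def[of s \<beta>] om_contract_sum om_contract_mult by (rule refl)

definition swap_pairs :: "'a list \<Rightarrow> 'a list" where
  "swap_pairs as = swap_at 1 (swap_at 2 (swap_at 0 (swap_at 1 as)))"

lemma swap_pairs_simp [simp]: "swap_pairs [i, j, k, l] = [k, l, i, j]"
  by (simp add: swap_pairs_def)

lemma slots_swap_pairs: "slots M (\<lambda>as. T (swap_pairs as)) is = slots M T (swap_pairs is)"
  using slots_swap[of M "\<lambda>as. T (swap_at 1 (swap_at 2 (swap_at 0 as)))" 1 "is"]
    slots_swap[of M "\<lambda>as. T (swap_at 1 (swap_at 2 as))" 0] slots_swap[of M "\<lambda>as. T (swap_at 1 as)" 2]
    slots_swap[of M T 1]
  by (simp add: swap_pairs_def)

text \<open>Since \<open>proj_first\<close> acts on the leading pair only, the other pair is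
  projected between two exchanges of the pairs. This reduces all properties to those of
  \<open>proj_first\<close>.\<close>

definition proj_pairs :: "real \<Rightarrow> (4 list \<Rightarrow> 'r) \<Rightarrow> 4 list \<Rightarrow> 'r::{comm_ring_1, real_algebra_1}" where
  "proj_pairs s T as =
     proj_first s (\<lambda>bs. proj_first s (\<lambda>cs. T (swap_pairs cs)) (swap_pairs bs)) as"

lemma slots_proj_pairs:
  fixes M :: "4 \<Rightarrow> 4 \<Rightarrow> 'r::{comm_ring_1, real_algebra_1}"
  assumes M: "\<And>a b. M a b = - M b a" and s: "s = 1 \<or> s = -1"
  shows "slots M (proj_pairs s T) [i, j, k, l] = proj_pairs s (slots M T) [i, j, k, l]"
proof -
  have "slots M (proj_pairs s T) [i, j, k, l]
      = proj_first s (slots M (\<lambda>bs. proj_first s (\<lambda>cs. T (swap_pairs cs)) (swap_pairs bs))) [i, j, k, l]"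
    unfolding slots_proj_first[OF M s, symmetric] by (simp add: proj_pairs_def[abs_def])
  also have "\<dots> = proj_pairs s (slots M T) [i, j, k, l]"
    unfolding proj_pairs_def slots_swap_pairs proj_first.simps swap_pairs_simp
      slots_proj_first[OF M s] by (simp add: slots_swap_pairs del: slots.simps)
  finally show ?thesis .
qed

lemma proj_pairs_eq:
  "proj_pairs s T [i, j, k, l] = of_real (1/16) * (\<Sum>\<alpha> \<beta>.
     of_real (om s \<alpha> i j) * of_real (om s \<beta> k l) * om_comp s (\<lambda>i j k l. T [i, j, k, l]) \<alpha> \<beta>)"
proof -
  have "proj_pairs s T [i, j, k, l] = of_real (1/4) * (\<Sum>\<alpha>. of_real (om s \<alpha> i j) *
     (of_real (1/4) * (\<Sum>\<beta>. of_real (om s \<beta> k l) * om_comp s (\<lambda>i j k l. T [i, j, k, l]) \<alpha> \<beta>)))"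
    unfolding proj_pairs_def proj_first.simps swap_pairs_simp om_contract_mult om_contract_sum om_comp_def
    by (rule refl)
  also have "\<dots> = (of_real (1/4) * of_real (1/4)) * (\<Sum>\<alpha> \<beta>.
     of_real (om s \<alpha> i j) * of_real (om s \<beta> k l) * om_comp s (\<lambda>i j k l. T [i, j, k, l]) \<alpha> \<beta>)"
    by (simp only: sum_distrib_left mult.assoc mult.left_commute)
  finally show ?thesis by (simp flip: of_real_mult)
qed

text \<open>An orthogonal projection of one factor already restricts the contraction to the block of
  duality \<open>s\<close>; each of the two pairs contributes a factor 1/4.\<close>

lemma pairing_proj_pairs_eq:
  "pairing 4 (proj_pairs s S) T = of_real (1/16) * (\<Sum>\<alpha> \<beta>.
     om_comp s (\<lambda>i j k l. S [i, j, k, l]) \<alpha> \<beta> * om_comp s (\<lambda>i j k l. T [i, j, k, l]) \<alpha> \<beta>)"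
proof -
  let ?S = "om_comp s (\<lambda>i j k l. S [i, j, k, l])" and ?T = "om_comp s (\<lambda>i j k l. T [i, j, k, l])"
  let ?t = "\<lambda>\<alpha> k l. om_contract s \<alpha> (\<lambda>a b. T [a, b, k, l])"
  have T: "om_contract s \<beta> (?t \<alpha>) = ?T \<alpha> \<beta>" for \<alpha> \<beta>
    unfolding om_comp_def by (rule om_contract_swap)
  have 2: "pairing 2 f g = (\<Sum>k l. f [k, l] * g [k, l])" for f g :: "4 list \<Rightarrow> 'a"
    by (simp add: numeral_eq_Suc)
  have "pairing 4 (proj_pairs s S) T = of_real (1/4) * (\<Sum>\<alpha> k l.
     (of_real (1/4) * (\<Sum>\<beta>. of_real (om s \<beta> k l) * ?S \<alpha> \<beta>)) * ?t \<alpha> k l)"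
    using pairing_proj_first[of 2 s "\<lambda>bs. proj_first s (\<lambda>cs. S (swap_pairs cs)) (swap_pairs bs)" T]
    unfolding 2 proj_first.simps swap_pairs_simp om_contract_mult om_contract_sum
    by (simp add: proj_pairs_def[abs_def] om_comp_def del: of_real_divide)
  also have "\<dots> = of_real (1/4) * (\<Sum>\<alpha>. of_real (1/4) * (\<Sum>k l \<beta>.
     ?S \<alpha> \<beta> * (of_real (om s \<beta> k l) * ?t \<alpha> k l)))"
    by (simp only: sum_distrib_left sum_distrib_right mult.assoc mult.left_commute)
  also have "\<dots> = (of_real (1/4) * of_real (1/4)) * (\<Sum>\<alpha> \<beta>. ?S \<alpha> \<beta> * om_contract s \<beta> (?t \<alpha>))"
    by (subst sum_rotate3) (simp add: om_contract_def sum_distrib_left mult.assoc)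
  finally show ?thesis unfolding T by (simp flip: of_real_mult)
qed

lemma om_comp_dual:
  "om_comp s (\<lambda>i j k l. \<Sum>\<alpha> \<beta>. of_real (om s \<alpha> i j) * of_real (om s \<beta> k l) * t \<alpha> \<beta>) \<gamma> \<delta>
     = (\<Sum>\<alpha> \<beta>. om_contract s \<gamma> (\<lambda>i j. of_real (om s \<alpha> i j))
         * om_contract s \<delta> (\<lambda>i j. of_real (om s \<beta> i j)) * t \<alpha> \<beta>)"
proof -
  have 1: "om_contract s \<alpha> (\<lambda>i j. h i j * c) = om_contract s \<alpha> h * c" for \<alpha> h and c :: 'a
    using om_contract_mult[of s \<alpha> c h] by (simp add: mult.commute)
  show ?thesis
    unfolding om_comp_def om_contract_sum
    by (simp add: 1 om_contract_mult mult.assoc)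
qed

lemma om_orthogonal:
  assumes "s = 1 \<or> s = -1"
  shows "om_contract s \<alpha> (\<lambda>i j. of_real (om s \<beta> i j)) = (if \<alpha> = \<beta> then 4 else 0)"
proof -
  have "\<forall>\<alpha> \<beta>. om_contract s \<alpha> (\<lambda>i j. of_real (om s \<beta> i j)) = (if \<alpha> = \<beta> then 4 else 0 :: 'a)"
    unfolding forall_3 om_contract_eq using assms by (elim disjE) (simp_all add: om_def unit2_def)
  then show ?thesis by blast
qed

text \<open>Twice the identity of the bivectors of duality \<open>s\<close>, written as a
  (0,4)-tensor.\<close>

definition dual_id :: "real \<Rightarrow> 4 list \<Rightarrow> 'r::{comm_ring_1, real_algebra_1}" where
  "dual_id s = tensor4 (\<lambda>i j k l. \<Sum>\<alpha>. of_real (om s \<alpha> i j) * of_real (om s \<alpha> k l))"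

text \<open>The identity is invariant under rotations: the two terms with \<open>m\<close> differ by
  its transposition and cancel.\<close>

lemma slots_dual_id:
  fixes M :: "4 \<Rightarrow> 4 \<Rightarrow> 'r::{comm_ring_1, real_algebra_1}"
  assumes M: "\<And>a b. M a b = - M b a" and s: "s = 1 \<or> s = -1"
  shows "slots M (dual_id s) [i, j, k, l] = 0"
proof -
  obtain m where m: "\<And>\<alpha> \<beta>. m \<alpha> \<beta> = - m \<beta> \<alpha>"
    "\<And>\<alpha> i j. (\<Sum>b. M b i * of_real (om s \<alpha> b j)) + (\<Sum>b. M b j * of_real (om s \<alpha> i b))
       = (\<Sum>\<beta>. m \<alpha> \<beta> * of_real (om s \<beta> i j))"
    by (rule om_rotation[OF M s]) (rule that; assumption)
  let ?o = "\<lambda>\<alpha> i j. of_real (om s \<alpha> i j) :: 'r"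
  have "slots M (dual_id s) [i, j, k, l] =
      (\<Sum>\<alpha>. ((\<Sum>b. M b i * ?o \<alpha> b j) + (\<Sum>b. M b j * ?o \<alpha> i b)) * ?o \<alpha> k l)
    + (\<Sum>\<alpha>. ?o \<alpha> i j * ((\<Sum>b. M b k * ?o \<alpha> b l) + (\<Sum>b. M b l * ?o \<alpha> k b)))"
    by (simp add: dual_id_def sum_3 sum_4 algebra_simps)
  also have "\<dots> = (\<Sum>\<alpha> \<beta>. m \<alpha> \<beta> * ?o \<beta> i j * ?o \<alpha> k l) + (\<Sum>\<alpha> \<beta>. m \<alpha> \<beta> * ?o \<alpha> i j * ?o \<beta> k l)"
    unfolding m(2) by (simp add: sum_distrib_left sum_distrib_right ac_simps)
  also have "(\<Sum>\<alpha> \<beta>. m \<alpha> \<beta> * ?o \<beta> i j * ?o \<alpha> k l)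
     = (\<Sum>\<beta> \<alpha>. - m \<beta> \<alpha> * ?o \<beta> i j * ?o \<alpha> k l)"
    by (subst sum.swap, subst m(1)) (rule refl)
  finally show ?thesis by (simp add: sum_negf)
qed

lemma om_comp_dual_id:
  assumes s: "s = 1 \<or> s = -1"
  shows "om_comp s (\<lambda>i j k l. dual_id s [i, j, k, l]) \<alpha> \<beta> = (if \<alpha> = \<beta> then 16 else 0 :: 'r::{comm_ring_1, real_algebra_1})"
proof -
  have "om_comp s (\<lambda>i j k l. dual_id s [i, j, k, l]) \<alpha> \<beta>
     = om_comp s (\<lambda>i j k l. \<Sum>\<alpha> \<beta>. of_real (om s \<alpha> i j) * of_real (om s \<beta> k l) * (if \<alpha> = \<beta> then 1 else 0 :: 'r)) \<alpha> \<beta>"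
    by (simp add: dual_id_def if_distrib[of "\<lambda>y. _ * y"] cong: if_cong)
  then show ?thesis
    unfolding om_comp_dual om_orthogonal[OF s]
    by (simp add: if_distrib[of "\<lambda>y. _ * y"] if_distrib[of "\<lambda>y. y * _"] cong: if_cong)
qed

lemma om_comp_proj_pairs:
  assumes s: "s = 1 \<or> s = -1"
  shows "om_comp s (\<lambda>i j k l. proj_pairs s T [i, j, k, l]) \<alpha> \<beta> = om_comp s (\<lambda>i j k l. T [i, j, k, l]) \<alpha> \<beta>"
proof -
  have m: "om_comp s (\<lambda>i j k l. c * g i j k l) \<alpha> \<beta> = c * om_comp s g \<alpha> \<beta>" for c :: 'a and g
    unfolding om_comp_def om_contract_mult by (rule refl)
  have "of_real (1/16) * 16 = (1 :: 'a)"
    by (metis (no_types) nonzero_divide_eq_eq of_real_1 of_real_mult of_real_numeral zero_neq_numeral)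
  then have "of_real (1/16) * (16 * x) = x" for x :: 'a
    by (simp flip: mult.assoc)
  then show ?thesis unfolding proj_pairs_eq m om_comp_dual om_orthogonal[OF s]
    by (simp add: if_distrib[of "\<lambda>y. _ * y"] if_distrib[of "\<lambda>y. y * _"] cong: if_cong)
qed

lemma om_comp_add: "om_comp s (\<lambda>i j k l. g i j k l + h i j k l) \<alpha> \<beta> = om_comp s g \<alpha> \<beta> + om_comp s h \<alpha> \<beta>"
  unfolding om_comp_def om_contract_add by (rule refl)

lemma om_comp_mult: "om_comp s (\<lambda>i j k l. c * g i j k l) \<alpha> \<beta> = c * om_comp s g \<alpha> \<beta>"
  unfolding om_comp_def om_contract_mult by (rule refl)

lemma om_comp_sum: "om_comp s (\<lambda>i j k l. \<Sum>x\<in>X. g x i j k l) \<alpha> \<beta> = (\<Sum>x\<in>X. om_comp s (g x) \<alpha> \<beta>)"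
  unfolding om_comp_def om_contract_sum by (rule refl)

lemma om_comp_diff: "om_comp s (\<lambda>i j k l. g i j k l - h i j k l) \<alpha> \<beta> = om_comp s g \<alpha> \<beta> - om_comp s h \<alpha> \<beta>"
  using om_comp_add[of s g "\<lambda>i j k l. -1 * h i j k l"] om_comp_mult[of s "-1" h] by simp

lemma D_om_comp: "D p (om_comp s g \<alpha> \<beta>) = om_comp s (\<lambda>i j k l. D p (g i j k l)) \<alpha> \<beta>"
  by (simp add: om_comp_def om_contract_def)

lemma om_antisym: "om s \<alpha> j i = - om s \<alpha> i j"
proof -
  have "unit2 k l j i = - unit2 k l i j" for k l
    by (simp add: unit2_def conj_commute split del: if_split)
  then show ?thesis unfolding om_def by simp
qed

lemma om_comp_swap: "om_comp s (\<lambda>i j k l. g j i k l) \<alpha> \<beta> = - om_comp s g \<alpha> \<beta>"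
proof -
  have *: "om_contract s \<alpha> (\<lambda>i j. h j i) = - om_contract s \<alpha> h" for h :: "4 \<Rightarrow> 4 \<Rightarrow> 'a"
    unfolding om_contract_def sum_negf[symmetric]
    by (subst sum.swap, intro sum.cong refl, subst om_antisym, simp)
  show ?thesis unfolding om_comp_def by (rule *)
qed

lemma proj_pairs_mult: "proj_pairs s (\<lambda>as. c * T as) [i, j, k, l] = c * proj_pairs s T [i, j, k, l]"
  by (simp add: proj_pairs_eq om_comp_mult sum_distrib_left mult.left_commute del: of_real_divide)

lemma proj_pairs_sum:
  "proj_pairs s (\<lambda>as. \<Sum>x\<in>X. T x as) [i, j, k, l] = (\<Sum>x\<in>X. proj_pairs s (T x) [i, j, k, l])"
  unfolding proj_pairs_eq om_comp_sum sum_distrib_left by (rule sum_rotate3)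

lemma proj_pairs_diff:
  "proj_pairs s (\<lambda>as. S as - T as) [i, j, k, l] = proj_pairs s S [i, j, k, l] - proj_pairs s T [i, j, k, l]"
  by (simp add: proj_pairs_eq om_comp_diff right_diff_distrib sum_subtractf del: of_real_divide)

lemma proj_pairs_add:
  "proj_pairs s (\<lambda>as. S as + T as) [i, j, k, l] = proj_pairs s S [i, j, k, l] + proj_pairs s T [i, j, k, l]"
  by (simp add: proj_pairs_eq om_comp_add distrib_left sum.distrib del: of_real_divide)

lemma D_proj_pairs: "D p (proj_pairs s T [i, j, k, l]) = proj_pairs s (\<lambda>as. D p (T as)) [i, j, k, l]"
  by (simp add: proj_pairs_eq D_om_comp del: of_real_divide)

lemma pairing_mult_right: "pairing n S (\<lambda>as. c * T as) = c * pairing n S T"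
  unfolding pairing_commute[of n S] by (rule pairing_cmult)

lemma pairing_sum_right: "pairing n S (\<lambda>as. \<Sum>x\<in>X. T x as) = (\<Sum>x\<in>X. pairing n S (T x))"
  unfolding pairing_commute[of n S] by (rule pairing_sum)

lemma pairing_diff_right: "pairing n S (\<lambda>as. T as - T' as) = pairing n S T - pairing n S T'"
  unfolding pairing_commute[of n S] by (rule pairing_diff)

lemma pairing_dual_id:
  "pairing 4 (dual_id s) T = (\<Sum>\<alpha>. om_comp s (\<lambda>i j k l. T [i, j, k, l]) \<alpha> \<alpha>)"
proof -
  have "pairing 4 (dual_id s) T = (\<Sum>i j k l \<alpha>.
      of_real (om s \<alpha> i j) * (of_real (om s \<alpha> k l) * T [i, j, k, l]))"
    by (simp add: numeral_eq_Suc dual_id_def sum_distrib_right mult.assoc)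
  also have "\<dots> = (\<Sum>i j \<alpha> k l.
      of_real (om s \<alpha> i j) * (of_real (om s \<alpha> k l) * T [i, j, k, l]))"
    by (intro sum.cong refl sum_rotate3)
  also have "\<dots> = (\<Sum>\<alpha> i j k l.
      of_real (om s \<alpha> i j) * (of_real (om s \<alpha> k l) * T [i, j, k, l]))"
    by (rule sum_rotate3)
  finally show ?thesis by (simp add: om_comp_def om_contract_def sum_distrib_left)
qed

section \<open>Covariant derivatives of contractions and projections\<close>

context frame_calculus
begin

lemma nab_pairing:
  "nab c (\<lambda>_. pairing n S T) [] = pairing n (nab c S) T + pairing n S (nab c T)"
proof -
  have "D p (pairing n S T) = pairing n (\<lambda>as. D p (S as) - slots (A p) S as) T
      + pairing n S (\<lambda>as. D p (T as) - slots (A p) T as)" for p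
    unfolding pairing_diff pairing_diff_right D_pairing
    using pairing_slots[where M = "A p" and n = n and S = S and T = T, OF A_antisym] by (simp add: algebra_simps)
  then show ?thesis
    unfolding nab_def[abs_def]
    by (simp add: pairing_sum pairing_cmult pairing_sum_right pairing_mult_right distrib_left sum.distrib)
qed

text \<open>One index of \<open>S\<close> stays free, so the result is a covector. It is read off by
  \<open>hd\<close>, because a tensor is a function on lists; \<open>hd\<close> and
  \<open>tl\<close> serve the same purpose in the two lemmas on tails below.\<close>

lemma nab_pairing_vector:
  "nab d (\<lambda>as. pairing n (\<lambda>is. S (hd as # is)) T) [c]
    = pairing n (\<lambda>is. nab d S (c # is)) T + pairing n (\<lambda>is. S (c # is)) (nab d T)"
proof -
  have "D p (pairing n (\<lambda>is. S (c # is)) T) - slots (A p) (\<lambda>as. pairing n (\<lambda>is. S (hd as # is)) T) [c]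
     = pairing n (\<lambda>as. D p (S (c # as)) - slots (A p) S (c # as)) T
      + pairing n (\<lambda>as. S (c # as)) (\<lambda>as. D p (T as) - slots (A p) T as)" for p
    using pairing_slots[where M = "A p" and n = n and S = "\<lambda>as. S (c # as)" and T = T, OF A_antisym]
    by (simp add: pairing_diff pairing_diff_right D_pairing pairing_add pairing_sum pairing_cmult algebra_simps)
  then show ?thesis
    unfolding nab_def[abs_def]
    by (simp add: pairing_sum pairing_cmult pairing_sum_right pairing_mult_right distrib_left sum.distrib)
qed

lemma nab_proj_pairs:
  assumes s: "s = 1 \<or> s = -1"
  shows "nab c (proj_pairs s T) [i, j, k, l] = proj_pairs s (nab c T) [i, j, k, l]"
  unfolding nab_def[abs_def] proj_pairs_sum proj_pairs_mult proj_pairs_diff D_proj_pairs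
    slots_proj_pairs[where M = "A p" for p, OF A_antisym s] by (rule refl)

lemma nab_proj_pairs_tail:
  assumes s: "s = 1 \<or> s = -1"
  shows "nab d (\<lambda>as. proj_pairs s (\<lambda>is. T (hd as # is)) (tl as)) [c, i, j, k, l]
     = proj_pairs s (\<lambda>is. nab d T (c # is)) [i, j, k, l]"
  unfolding nab_def slots.simps list.sel proj_pairs_sum proj_pairs_mult proj_pairs_diff proj_pairs_add
    D_proj_pairs
    slots_proj_pairs[where M = "A p" for p, OF A_antisym s, unfolded slots.simps] 
  by (simp add: slots_proj_pairs[where M = "A p" for p, OF A_antisym s] del: slots.simps)

lemma nab_dual_id:
  assumes s: "s = 1 \<or> s = -1"
  shows "nab c (\<lambda>as. u * dual_id s as) [i, j, k, l] = nabla (\<lambda>_. u) [c] * dual_id s [i, j, k, l]"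
proof -
  have "D p (dual_id s [i, j, k, l]) = 0" for p
    by (simp add: dual_id_def)
  then show ?thesis
    by (simp add: nab_def slots_cmult slots_dual_id[where M = "A p" for p, OF A_antisym s]
        sum_distrib_right mult.assoc del: slots.simps(2))
qed

lemma nab_dual_id_tail:
  assumes s: "s = 1 \<or> s = -1"
  shows "nab d (\<lambda>as. v [hd as] * dual_id s (tl as)) [c, i, j, k, l] = nab d v [c] * dual_id s [i, j, k, l]"
proof -
  have D: "D p (dual_id s [i, j, k, l]) = 0" for p
    by (simp add: dual_id_def)
  have "slots (A p) (\<lambda>as. v [hd as] * dual_id s (tl as)) [c, i, j, k, l] = slots (A p) v [c] * dual_id s [i, j, k, l]" for p
    unfolding slots.simps(2)[of _ _ c] list.sel slots_cmult slots_dual_id[where M = "A p", OF A_antisym s]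
    by (simp add: sum_distrib_right mult.assoc)
  then show ?thesis
    unfolding nab_def by (simp add: D sum_distrib_right left_diff_distrib mult.assoc del: slots.simps(2))
qed

end

section \<open>The drift Laplacian of the squared norm in the frame\<close>

context frame_soliton
begin

definition Rsc :: germ where "Rsc = (\<Sum>a. Ric a a)"

text \<open>The trace-free part of the curvature block: the block has trace \<open>Rsc\<close>/4, a
  third of it is \<open>Rsc\<close>/12, and \<open>dual_id\<close> is twice the identity.\<close>

definition W :: "real \<Rightarrow> 4 list \<Rightarrow> germ" where
  "W s as = proj_pairs s R as - of_real (1/24) * Rsc * dual_id s as"

lemma nab_W:
  assumes s: "s = 1 \<or> s = -1"
  shows "nab c (W s) [i, j, k, l] = proj_pairs s (nab c R) [i, j, k, l]
    - nabla (\<lambda>_. of_real (1/24) * Rsc) [c] * dual_id s [i, j, k, l]"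
  unfolding W_def[abs_def] nab_diff nab_proj_pairs[OF s] nab_dual_id[OF s] by (rule refl)

lemma nab2_W:
  assumes s: "s = 1 \<or> s = -1"
  shows "nab d (nabla (W s)) [c, i, j, k, l] = proj_pairs s (\<lambda>is. nab d (nabla R) (c # is)) [i, j, k, l]
    - nab d (nabla (\<lambda>_. of_real (1/24) * Rsc)) [c] * dual_id s [i, j, k, l]"
proof -
  have "nab d (nabla (W s)) [c, i, j, k, l] = nab d (\<lambda>as. proj_pairs s (\<lambda>is. nabla R (hd as # is)) (tl as)
      - nabla (\<lambda>_. of_real (1/24) * Rsc) [hd as] * dual_id s (tl as)) [c, i, j, k, l]"
    by (rule nab_cong) (auto simp: length_Suc_conv nab_W[OF s])
  then show ?thesis
    unfolding nab_diff nab_proj_pairs_tail[OF s] nab_dual_id_tail[OF s] .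
qed

text \<open>The product rule for a squared norm; it holds because contraction is parallel.\<close>

lemma drift_laplacian_pairing:
  assumes u_def: "u = pairing n T T"
  shows "(\<Sum>c. nabla (nabla (\<lambda>_. u)) [c, c]) - (\<Sum>a. f1 [a] * nabla (\<lambda>_. u) [a])
    = 2 * (\<Sum>c. pairing n (nab c T) (nab c T))
     + 2 * pairing n (\<lambda>is. (\<Sum>c. nab c (nabla T) (c # is)) - (\<Sum>a. f1 [a] * nab a T is)) T"
proof -
  have 1: "nabla (\<lambda>_. u) [c] = 2 * pairing n (nab c T) T" for c
    unfolding u_def nabla.simps nab_pairing pairing_commute[of n T "nab c T"] by (simp only: mult_2)
  have "nabla (nabla (\<lambda>_. u)) [c, c] = nab c (\<lambda>as. 2 * pairing n (\<lambda>is. nabla T (hd as # is)) T) [c]" for c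
    unfolding nabla.simps(2)[of "nabla _"] 
    by (rule nab_cong) (use 1 in \<open>auto simp: length_Suc_conv\<close>)
  also have "\<dots> c = 2 * pairing n (\<lambda>is. nab c (nabla T) (c # is)) T + 2 * pairing n (nab c T) (nab c T)" for c
    unfolding mult_2 nab_add nab_pairing_vector by simp
  finally show ?thesis unfolding 1
    unfolding pairing_diff pairing_sum pairing_cmult
    by (simp add: sum.distrib sum_distrib_left right_diff_distrib mult.left_commute[of "f1 _"]
      del: nabla.simps(2))
qed

abbreviation W4 :: "real \<Rightarrow> 4 \<Rightarrow> 4 \<Rightarrow> 4 \<Rightarrow> 4 \<Rightarrow> germ" where
  "W4 s i j k l \<equiv> W s [i, j, k, l]"

text \<open>The counterpart of \<open>trace_om_comp\<close> in the ring of germs, in which the trace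
  of \<open>W\<close> is needed.\<close>

lemma trace_om_comp_Rm:
  assumes s: "s = 1 \<or> s = -1"
  shows "(\<Sum>\<alpha>. om_comp s Rm \<alpha> \<alpha>) = 2 * Rsc"
proof -
  have z: "Rm i i k l = 0" "Rm i j k k = 0" for i j k l
  proof -
    have "2 *\<^sub>R Rm i i k l = 0" "2 *\<^sub>R Rm i j k k = 0"
      using Rm_antisym(1)[of i i k l] Rm_antisym(2)[of i j k k]
      unfolding scaleR_2 by (simp_all only: eq_neg_iff_add_eq_0)
    then show "Rm i i k l = 0" "Rm i j k k = 0" by simp_all
  qed
  have b: "Rm 1 4 2 3 = Rm 1 3 2 4 - Rm 1 2 3 4"
  proof -
    have 1: "Rm 4 3 2 1 = Rm 1 2 3 4"
      by (simp add: Rm_antisym(1)[of 4 3] Rm_pair_symmetric[of 3 4] Rm_antisym(1)[of 2 1])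
    have 2: "Rm 1 4 2 3 + Rm 1 2 3 4 - Rm 1 3 2 4 = 0"
      using bianchi1[of 1 4 2 3] unfolding 1 Rm_antisym(1)[of 3 1] by simp
    have "Rm 1 4 2 3 = (Rm 1 4 2 3 + Rm 1 2 3 4 - Rm 1 3 2 4) - Rm 1 2 3 4 + Rm 1 3 2 4" by simp
    then show ?thesis unfolding 2 by simp
  qed
  show ?thesis
    unfolding sum_3 om_comp_def om_contract_eq Rsc_def Ric_def sum_4
    using s
    by (elim disjE) (simp_all add: z b Rm_antisym(1)[of 2 1] Rm_antisym(1)[of 3 1] Rm_antisym(1)[of 4 1] Rm_antisym(1)[of 3 2]
      Rm_antisym(1)[of 4 2] Rm_antisym(1)[of 4 3] Rm_antisym(2)[of _ _ 2 1] Rm_antisym(2)[of _ _ 3 1]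
      Rm_antisym(2)[of _ _ 4 1] Rm_antisym(2)[of _ _ 3 2] Rm_antisym(2)[of _ _ 4 2] Rm_antisym(2)[of _ _ 4 3]
      Rm_pair_symmetric[of 3 4 1 2] Rm_pair_symmetric[of 2 4 1 3] Rm_pair_symmetric[of 2 3 1 4] algebra_simps)
qed

lemma om_comp_W:
  assumes s: "s = 1 \<or> s = -1"
  shows "om_comp s (W4 s) \<alpha> \<beta> = om_comp s Rm \<alpha> \<beta> - (if \<alpha> = \<beta> then of_real (2/3) * Rsc else 0)"
proof -
  have W: "om_comp s (W4 s) \<alpha> \<beta> = om_comp s Rm \<alpha> \<beta> - of_real (1/24) * Rsc * (if \<alpha> = \<beta> then of_real 16 else 0)"
    unfolding W_def om_comp_diff om_comp_mult om_comp_proj_pairs[OF s] om_comp_dual_id[OF s] by simp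
  have c: "of_real (1/24) * of_real 16 = (of_real (2/3) :: germ)"
    unfolding of_real_mult[symmetric] by simp
  have "of_real (1/24) * Rsc * (if \<alpha> = \<beta> then of_real 16 else 0) = (if \<alpha> = \<beta> then (of_real (1/24) * of_real 16) * Rsc else 0)"
    by (simp add: ac_simps del: of_real_divide of_real_numeral)
  then show ?thesis using W unfolding c by simp
qed

lemma trace_om_comp_W:
  assumes s: "s = 1 \<or> s = -1"
  shows "(\<Sum>\<alpha>. om_comp s (W4 s) \<alpha> \<alpha>) = 0"
proof -
  have "(\<Sum>\<alpha>. om_comp s (W4 s) \<alpha> \<alpha>) = 2 * Rsc - 3 * (of_real (2/3) * Rsc)"
    unfolding om_comp_W[OF s] by (simp add: sum_subtractf trace_om_comp_Rm[OF s] del: of_real_divide)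
  moreover have "of_real 3 * of_real (2/3) = (of_real 2 :: germ)"
    unfolding of_real_mult[symmetric] by simp
  then have "3 * (of_real (2/3) * Rsc) = 2 * Rsc"
    by (simp flip: mult.assoc del: of_real_divide)
  ultimately show ?thesis by simp
qed

text \<open>\<open>W\<close> is trace-free, so every multiple of \<open>dual_id\<close> drops out,
  in particular the derivatives of the scalar curvature contained in those of
  \<open>W\<close>.\<close>

lemma pairing_W:
  assumes s: "s = 1 \<or> s = -1"
  shows "pairing 4 (\<lambda>as. proj_pairs s T as - c * dual_id s as) (W s) = of_real (1/16) *
    (\<Sum>\<alpha> \<beta>. om_comp s (\<lambda>i j k l. T [i, j, k, l]) \<alpha> \<beta> * om_comp s (W4 s) \<alpha> \<beta>)"
  unfolding pairing_diff pairing_cmult pairing_dual_id trace_om_comp_W[OF s] pairing_proj_pairs_eq by simp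

theorem frame_formula:
  assumes s: "s = 1 \<or> s = -1" and u: "u = pairing 4 (W s) (W s)"
  shows "(\<Sum>c. nabla (nabla (\<lambda>_. u)) [c, c]) - (\<Sum>a. f1 [a] * nabla (\<lambda>_. u) [a])
    = 2 * (\<Sum>c. pairing 4 (nab c (W s)) (nab c (W s))) + 4 * lam * u
      + of_real (1/4) * (\<Sum>\<alpha> \<beta>. om_comp s Q \<alpha> \<beta> * om_comp s (W4 s) \<alpha> \<beta>)"
proof -
  define Y where "Y as = (\<Sum>c. nab c (nabla R) (c # as)) - (\<Sum>a. f1 [a] * nab a R as)" for as
  define y where "y = (\<Sum>c. nab c (nabla (\<lambda>_. of_real (1/24) * Rsc)) [c])
     - (\<Sum>a. f1 [a] * nabla (\<lambda>_. of_real (1/24) * Rsc) [a])"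
  let ?w = "om_comp s (W4 s)"
  have Y: "(\<Sum>c. nab c (nabla (W s)) [c, i, j, k, l]) - (\<Sum>a. f1 [a] * nab a (W s) [i, j, k, l])
     = proj_pairs s Y [i, j, k, l] - y * dual_id s [i, j, k, l]" for i j k l
    unfolding nab_W[OF s] nab2_W[OF s] Y_def[abs_def] y_def proj_pairs_diff proj_pairs_sum proj_pairs_mult
    by (simp add: sum_subtractf right_diff_distrib left_diff_distrib sum_distrib_right mult.assoc
        del: nabla.simps of_real_divide)
  have X: "pairing 4 (\<lambda>is. (\<Sum>c. nab c (nabla (W s)) (c # is)) - (\<Sum>a. f1 [a] * nab a (W s) is)) (W s)
     = of_real (1/16) * (\<Sum>\<alpha> \<beta>. om_comp s (\<lambda>i j k l. Y [i, j, k, l]) \<alpha> \<beta> * ?w \<alpha> \<beta>)"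
    unfolding pairing_W[OF s, of Y y, symmetric]
    by (rule pairing_cong) (auto simp: length_Suc_conv eval_nat_numeral Y simp del: nabla.simps)
  \<comment> \<open>The contraction with \<open>om\<close> is odd under exchange of \<open>i\<close>
    and \<open>j\<close>, so the two \<open>Q\<close> terms of \<open>laplacian_R\<close> add
    up.\<close>
  have Y2: "om_comp s (\<lambda>i j k l. Y [i, j, k, l]) \<alpha> \<beta> = 2 * lam * om_comp s Rm \<alpha> \<beta> + 2 * om_comp s Q \<alpha> \<beta>" for \<alpha> \<beta>
    unfolding Y_def laplacian_R om_comp_diff om_comp_add om_comp_mult
    by (simp add: om_comp_swap[of s Q])
  have u': "u = of_real (1/16) * (\<Sum>\<alpha> \<beta>. om_comp s Rm \<alpha> \<beta> * ?w \<alpha> \<beta>)"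
    using pairing_W[OF s, of R "of_real (1/24) * Rsc"] unfolding u by (simp add: W_def[abs_def] del: of_real_divide)
  have q: "4 * (of_real (1/16) * x) = of_real (1/4) * x" for x :: germ
  proof -
    have "of_real 4 * of_real (1/16) = (of_real (1/4) :: germ)" unfolding of_real_mult[symmetric] by simp
    then show ?thesis by (simp flip: mult.assoc del: of_real_divide)
  qed
  have "2 * pairing 4 (\<lambda>is. (\<Sum>c. nab c (nabla (W s)) (c # is)) - (\<Sum>a. f1 [a] * nab a (W s) is)) (W s)
    = 4 * lam * u + 4 * (of_real (1/16) * (\<Sum>\<alpha> \<beta>. om_comp s Q \<alpha> \<beta> * ?w \<alpha> \<beta>))"
    unfolding X Y2 u' by (simp add: distrib_right sum.distrib sum_distrib_left algebra_simps del: of_real_divide)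
  then show ?thesis unfolding drift_laplacian_pairing[OF u] q by simp
qed

end

section \<open>Frame components of the algebraic operations\<close>

lemma vector_4:
  "(vector [x, y, z, w] :: 'a::zero^4) $ 1 = x" "(vector [x, y, z, w] :: 'a^4) $ 2 = y"
  "(vector [x, y, z, w] :: 'a^4) $ 3 = z" "(vector [x, y, z, w] :: 'a^4) $ 4 = w"
  unfolding vector_def by simp_all

lemma det_row_expand:
  fixes c :: "'n::finite \<Rightarrow> real^'n"
  shows "det (\<chi> i. if i = k then v else c i) = (\<Sum>l. v $ l * det (\<chi> i. if i = k then axis l 1 else c i))"
proof -
  have "det (\<chi> i. if i = k then v else c i) = det (\<chi> i. if i = k then (\<Sum>l. v $ l *s axis l 1) else c i)"
    by (rule arg_cong[where f = det]) (simp add: basis_expansion vec_eq_iff[of "\<chi> i. _ i"])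
  also have "\<dots> = (\<Sum>l. det (\<chi> i. if i = k then v $ l *s axis l 1 else c i))"
    by (rule det_linear_row_sum) simp
  finally show ?thesis by (simp add: det_row_mul)
qed

lemma det_vector_expand:
  fixes v x y z :: "real^4"
  shows "det (vector [v, x, y, z] :: real^4^4) = (\<Sum>l. v $ l * det (vector [axis l 1, x, y, z] :: real^4^4))"
    "det (vector [x, v, y, z] :: real^4^4) = (\<Sum>l. v $ l * det (vector [x, axis l 1, y, z] :: real^4^4))"
    "det (vector [x, y, v, z] :: real^4^4) = (\<Sum>l. v $ l * det (vector [x, y, axis l 1, z] :: real^4^4))"
    "det (vector [x, y, z, v] :: real^4^4) = (\<Sum>l. v $ l * det (vector [x, y, z, axis l 1] :: real^4^4))"
proof -
  have *: "(vector [v, x, y, z] :: real^4^4) = (\<chi> i. if i = 1 then v else vector [v, x, y, z] $ i)"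
    "(vector [x, v, y, z] :: real^4^4) = (\<chi> i. if i = 2 then v else vector [x, v, y, z] $ i)"
    "(vector [x, y, v, z] :: real^4^4) = (\<chi> i. if i = 3 then v else vector [x, y, v, z] $ i)"
    "(vector [x, y, z, v] :: real^4^4) = (\<chi> i. if i = 4 then v else vector [x, y, z, v] $ i)" for v :: "real^4"
    by (simp_all add: vec_eq_iff vector_4)
  have **: "(\<chi> i. if i = 1 then u else vector [v, x, y, z] $ i) = (vector [u, x, y, z] :: real^4^4)"
    "(\<chi> i. if i = 2 then u else vector [x, v, y, z] $ i) = (vector [x, u, y, z] :: real^4^4)"
    "(\<chi> i. if i = 3 then u else vector [x, y, v, z] $ i) = (vector [x, y, u, z] :: real^4^4)"
    "(\<chi> i. if i = 4 then u else vector [x, y, z, v] $ i) = (vector [x, y, z, u] :: real^4^4)" for u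
    unfolding vec_eq_iff[where 'b = 4 and 'a = "real^4"] forall_4 by (simp_all add: vector_4)
  show "det (vector [v, x, y, z] :: real^4^4) = (\<Sum>l. v $ l * det (vector [axis l 1, x, y, z] :: real^4^4))"
    by (subst *(1), subst det_row_expand) (simp only: **)
  show "det (vector [x, v, y, z] :: real^4^4) = (\<Sum>l. v $ l * det (vector [x, axis l 1, y, z] :: real^4^4))"
    by (subst *(2), subst det_row_expand) (simp only: **)
  show "det (vector [x, y, v, z] :: real^4^4) = (\<Sum>l. v $ l * det (vector [x, y, axis l 1, z] :: real^4^4))"
    by (subst *(3), subst det_row_expand) (simp only: **)
  show "det (vector [x, y, z, v] :: real^4^4) = (\<Sum>l. v $ l * det (vector [x, y, z, axis l 1] :: real^4^4))"
    by (subst *(4), subst det_row_expand) (simp only: **)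
qed

definition eps :: tensor4 where
  "eps i j k l = det (vector [axis i 1, axis j 1, axis k 1, axis l 1] :: real^4^4)"

text \<open>Multilinearity makes the left side the determinant of the chosen columns of
  \<open>M\<close>, and determinants are multiplicative.\<close>

lemma conv_eps:
  fixes M :: "real^4^4"
  shows "conv (\<lambda>i a. M $ i $ a) (tensor4 eps) [a, b, c, d] = det M * eps a b c d"
proof -
  define v where "v a = (\<chi> i. M $ i $ a)" for a
  have "conv (\<lambda>i a. M $ i $ a) (tensor4 eps) [a, b, c, d] = det (vector [v a, v b, v c, v d] :: real^4^4)"
    unfolding det_vector_expand(1)[where v = "v a"]
    unfolding det_vector_expand(2)[where v = "v b"]
    unfolding det_vector_expand(3)[where v = "v c"]
    unfolding det_vector_expand(4)[where v = "v d"]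
    by (simp add: v_def eps_def)
  also have "(vector [v a, v b, v c, v d] :: real^4^4) = vector [axis a 1, axis b 1, axis c 1, axis d 1] ** transpose M"
    unfolding vec_eq_iff[where 'b = 4 and 'a = "real^4"] forall_4
    by (simp add: vector_4 v_def matrix_matrix_mult_def transpose_def vec_eq_iff axis_def
        if_distrib[of "\<lambda>y. y * _"] cong: if_cong)
  finally show ?thesis by (simp add: det_mul eps_def)
qed

lemma det_4:
  "det (A :: 'a::comm_ring_1^4^4) =
    A$1$1 * (A$2$2 * (A$3$3 * A$4$4 - A$3$4 * A$4$3) - A$2$3 * (A$3$2 * A$4$4 - A$3$4 * A$4$2) + A$2$4 * (A$3$2 * A$4$3 - A$3$3 * A$4$2))
  - A$1$2 * (A$2$1 * (A$3$3 * A$4$4 - A$3$4 * A$4$3) - A$2$3 * (A$3$1 * A$4$4 - A$3$4 * A$4$1) + A$2$4 * (A$3$1 * A$4$3 - A$3$3 * A$4$1))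
  + A$1$3 * (A$2$1 * (A$3$2 * A$4$4 - A$3$4 * A$4$2) - A$2$2 * (A$3$1 * A$4$4 - A$3$4 * A$4$1) + A$2$4 * (A$3$1 * A$4$2 - A$3$2 * A$4$1))
  - A$1$4 * (A$2$1 * (A$3$2 * A$4$3 - A$3$3 * A$4$2) - A$2$2 * (A$3$1 * A$4$3 - A$3$3 * A$4$1) + A$2$3 * (A$3$1 * A$4$2 - A$3$2 * A$4$1))"
proof -
  have f: "finite {2, 3, 4::4}" "1 \<notin> {2, 3, 4::4}" "finite {3, 4::4}" "2 \<notin> {3, 4::4}" "finite {4::4}" "3 \<notin> {4::4}"
    by auto
  show ?thesis
    unfolding det_def UNIV_4
    unfolding sum_over_permutations_insert[OF f(1,2)] sum_over_permutations_insert[OF f(3,4)]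
      sum_over_permutations_insert[OF f(5,6)] permutes_sing
    by (simp add: sign_swap_id permutation_swap_id permutation_compose sign_compose sign_id
        swap_id_eq algebra_simps)
qed

text \<open>Identity plus \<open>s\<close> times the Hodge star is twice the projection to duality
  \<open>s\<close>. The right side expresses the same by the basis \<open>om\<close>, and the
  components agree one by one.\<close>

lemma eps_om:
  assumes s: "s = 1 \<or> s = -1"
  shows "(if p = c \<and> q = d then 1 else 0) - (if p = d \<and> q = c then 1 else 0) + s * eps p q c d
    = (\<Sum>\<alpha>. om s \<alpha> p q * om s \<alpha> c d)"
proof -
  have "\<forall>p q c d. (if p = c \<and> q = d then 1 else 0) - (if p = d \<and> q = c then 1 else 0) + s * eps p q c d
    = (\<Sum>\<alpha>. om s \<alpha> p q * om s \<alpha> c d)"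
    unfolding forall_4 sum_3 using s
    by (elim disjE) (simp_all add: om_def unit2_def axis_def eps_def det_4 vector_4)
  then show ?thesis by blast
qed

lemma conv_conv:
  "conv F (conv E T) cs = conv (\<lambda>i c. \<Sum>a. E i a * F a c) T cs"
proof (induction cs arbitrary: T)
  case (Cons c cs)
  have "conv F (conv E T) (c # cs) = (\<Sum>a i. E i a * F a c * conv (\<lambda>i c. \<Sum>a. E i a * F a c) (\<lambda>as. T (i # as)) cs)"
    by (simp add: conv_sum conv_cmult Cons.IH sum_distrib_left ac_simps)
  also have "\<dots> = conv (\<lambda>i c. \<Sum>a. E i a * F a c) T (c # cs)"
    by (subst sum.swap) (simp add: sum_distrib_right)
  finally show ?case .
qed simp

lemma pairing_conv:
  "pairing n S (conv F T) = pairing n (conv (\<lambda>a i. F i a) S) T"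
proof (induction n arbitrary: S T)
  case (Suc n)
  have "pairing (Suc n) S (conv F T) = (\<Sum>a i. F i a * pairing n (\<lambda>as. S (a # as)) (conv F (\<lambda>as. T (i # as))))"
    by (simp add: pairing_sum_right pairing_mult_right)
  also have "\<dots> = (\<Sum>i a. F i a * pairing n (\<lambda>as. S (a # as)) (conv F (\<lambda>as. T (i # as))))"
    by (rule sum.swap)
  also have "\<dots> = pairing (Suc n) (conv (\<lambda>a i. F i a) S) T"
    by (simp add: pairing_sum pairing_cmult Suc.IH)
  finally show ?case .
qed simp

section \<open>Algebra at one point in an oriented orthonormal frame\<close>

locale orthonormal_frame =
  fixes G B :: "real^4^4"
  assumes orthonormal: "transpose B ** G ** B = mat 1"
    and det_pos: "det B > 0"
begin

abbreviation E :: "4 \<Rightarrow> 4 \<Rightarrow> real" where "E i a \<equiv> B $ i $ a"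

lemma matrix_inv_eq: "matrix_inv G = B ** transpose B"
proof -
  have "B ** (transpose B ** G) = mat 1"
    using orthonormal matrix_left_right_inverse by blast
  then have 1: "(B ** transpose B) ** G = mat 1" by (simp add: matrix_mul_assoc)
  then have 2: "G ** (B ** transpose B) = mat 1"
    using matrix_left_right_inverse by blast
  \<comment> \<open>\<open>matrix_inv\<close> is defined by choice; the inverse just exhibited shows
    that the choice has the inverse property.\<close>
  have "G ** matrix_inv G = mat 1"
    using someI[of "\<lambda>A'. G ** A' = mat 1 \<and> A' ** G = mat 1"] 1 2 unfolding matrix_inv_def by blast
  then have "(B ** transpose B) ** (G ** matrix_inv G) = B ** transpose B" by simp
  then show ?thesis unfolding matrix_mul_assoc 1 by simp
qed

lemma ginv_eq: "ginv G i j = (\<Sum>a. E i a * E j a)"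
  unfolding matrix_inv_eq by (simp add: matrix_matrix_mult_def transpose_def)

lemma metric_frame: "(\<Sum>i j. E i a * E j b * G $ i $ j) = (if a = b then 1 else 0)"
proof -
  have "(transpose B ** G ** B) $ a $ b = (\<Sum>j i. E i a * E j b * G $ i $ j)"
    by (simp add: matrix_matrix_mult_def transpose_def sum_distrib_right sum_distrib_left ac_simps)
  also have "\<dots> = (\<Sum>i j. E i a * E j b * G $ i $ j)" by (rule sum.swap)
  finally show ?thesis unfolding orthonormal by (simp add: mat_def)
qed

text \<open>Here the orientation enters: a frame of negative determinant would give -1 and exchange
  the two dualities.\<close>

lemma sqrt_det: "sqrt (det G) * det B = 1"
proof -
  have "det B * det G * det B = 1"
    using arg_cong[OF orthonormal, of det] by (simp add: det_mul)
  then have "det G = (1 / det B)\<^sup>2" using det_pos by (simp add: power2_eq_square field_simps)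
  then show ?thesis using det_pos by (simp add: real_sqrt_divide)
qed

text \<open>Each inverse metric is \<open>B ** transpose B\<close>, and one factor of it goes to
  each tensor.\<close>

lemma tensor_inner_eq:
  "tensor_inner G S T = 1/4 * pairing 4 (conv E (tensor4 S)) (conv E (tensor4 T))"
proof -
  have "tensor_inner G S T = 1/4 * pairing 4 (tensor4 S) (conv (\<lambda>a i. ginv G i a) (tensor4 T))"
    by (simp add: tensor_inner_def numeral_eq_Suc sum_distrib_left ac_simps)
  also have "(\<lambda>a i. ginv G i a) = (\<lambda>a i. \<Sum>c. E a c * E i c)"
    unfolding ginv_eq by (simp add: mult.commute)
  also have "conv \<dots> (tensor4 T) = conv (\<lambda>c i. E i c) (conv E (tensor4 T))"
    by (rule ext) (simp add: conv_conv)
  finally show ?thesis by (simp add: pairing_conv)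
qed

end

lemma sum_swap_pairs:
  "(\<Sum>i\<in>I. \<Sum>j\<in>J. \<Sum>k\<in>K. \<Sum>l\<in>L. g i j k l) = (\<Sum>k\<in>K. \<Sum>l\<in>L. \<Sum>i\<in>I. \<Sum>j\<in>J. g i j k l)"
  by (subst sum_rotate3) (intro sum.cong refl sum_rotate3)

lemma sum4_product:
  fixes f g :: "'a \<Rightarrow> 'a \<Rightarrow> 'r::comm_ring_1"
  shows "(\<Sum>i\<in>I. \<Sum>j\<in>I. \<Sum>k\<in>I. \<Sum>l\<in>I. f i k * g j l) = (\<Sum>i\<in>I. \<Sum>k\<in>I. f i k) * (\<Sum>j\<in>I. \<Sum>l\<in>I. g j l)"
    "(\<Sum>i\<in>I. \<Sum>j\<in>I. \<Sum>k\<in>I. \<Sum>l\<in>I. f i l * g j k) = (\<Sum>i\<in>I. \<Sum>k\<in>I. f i k) * (\<Sum>j\<in>I. \<Sum>l\<in>I. g j l)"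
proof -
  show "(\<Sum>i\<in>I. \<Sum>j\<in>I. \<Sum>k\<in>I. \<Sum>l\<in>I. f i k * g j l) = (\<Sum>i\<in>I. \<Sum>k\<in>I. f i k) * (\<Sum>j\<in>I. \<Sum>l\<in>I. g j l)"
    by (simp add: sum_product sum_distrib_left[symmetric])
  have "(\<Sum>i\<in>I. \<Sum>j\<in>I. \<Sum>k\<in>I. \<Sum>l\<in>I. f i l * g j k) = (\<Sum>i\<in>I. \<Sum>j\<in>I. \<Sum>l\<in>I. \<Sum>k\<in>I. f i l * g j k)"
    by (intro sum.cong refl sum.swap)
  then show "(\<Sum>i\<in>I. \<Sum>j\<in>I. \<Sum>k\<in>I. \<Sum>l\<in>I. f i l * g j k) = (\<Sum>i\<in>I. \<Sum>k\<in>I. f i k) * (\<Sum>j\<in>I. \<Sum>l\<in>I. g j l)"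
    by (simp add: sum_product sum_distrib_left[symmetric])
qed

lemma on_bivectors_add_left: "on_bivectors T (\<alpha> + \<alpha>') \<beta> = on_bivectors T \<alpha> \<beta> + on_bivectors T \<alpha>' \<beta>"
  by (simp add: on_bivectors_def algebra_simps sum.distrib)

lemma on_bivectors_add_right: "on_bivectors T \<alpha> (\<beta> + \<beta>') = on_bivectors T \<alpha> \<beta> + on_bivectors T \<alpha> \<beta>'"
  by (simp add: on_bivectors_def algebra_simps sum.distrib)

lemma on_bivectors_scale_left: "on_bivectors T (c *\<^sub>R \<alpha>) \<beta> = c * on_bivectors T \<alpha> \<beta>"
  by (simp add: on_bivectors_def sum_distrib_left ac_simps)

lemma on_bivectors_scale_right: "on_bivectors T \<alpha> (c *\<^sub>R \<beta>) = c * on_bivectors T \<alpha> \<beta>"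
  by (simp add: on_bivectors_def sum_distrib_left ac_simps)

lemma on_bivectors_sum_left: "on_bivectors T (\<Sum>x\<in>X. A x) \<beta> = (\<Sum>x\<in>X. on_bivectors T (A x) \<beta>)"
  by (induction X rule: infinite_finite_induct)
    (use on_bivectors_scale_left[of T 0] in \<open>auto simp: on_bivectors_add_left\<close>)

lemma on_bivectors_sum_right: "on_bivectors T \<alpha> (\<Sum>x\<in>X. A x) = (\<Sum>x\<in>X. on_bivectors T \<alpha> (A x))"
  by (induction X rule: infinite_finite_induct)
    (use on_bivectors_scale_right[of T \<alpha> 0] in \<open>auto simp: on_bivectors_add_right\<close>)

text \<open>Read off from \<open>eps_om\<close>, whose right side is antisymmetric in the first two
  indices.\<close>

lemma eps_antisym: "eps j i k l = - eps i j k l"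
proof -
  have "(if j = k \<and> i = l then 1 else 0) = (if i = l \<and> j = k then 1 else (0::real))"
    "(if j = l \<and> i = k then 1 else 0) = (if i = k \<and> j = l then 1 else (0::real))" by auto
  then show ?thesis
    using eps_om[of 1 i k j l] eps_om[of 1 j k i l] om_antisym[of 1 _ j i]
    by (simp add: sum_negf split del: if_split)
qed

lemma sum_axis: "(\<Sum>i. h i * (axis i 1 :: real^4) $ a) = h a"
  by (simp add: axis_def if_distrib[of "\<lambda>y. _ * y"] cong: if_cong)

lemma sum_axis2:
  "(\<Sum>i j. f i * g j * ((axis i 1 :: real^4) $ a * (axis j 1 :: real^4) $ b)) = f a * g b"
proof -
  have "(\<Sum>i. f i * (axis i 1 :: real^4) $ a) * (\<Sum>j. g j * (axis j 1 :: real^4) $ b)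
     = (\<Sum>i j. f i * g j * ((axis i 1 :: real^4) $ a * (axis j 1 :: real^4) $ b))"
    unfolding sum_product by (simp add: ac_simps)
  then show ?thesis by (simp add: sum_axis)
qed

lemma sum_wedge:
  "(\<Sum>i j. f i * g j * wedge i j $ a $ b) = f a * g b - f b * g a"
  using sum_axis2[of f g a b] sum_axis2[of f g b a]
  by (simp add: wedge_def right_diff_distrib sum_subtractf mult.commute[of "axis _ 1 $ a"])

lemma conv4:
  "conv E (tensor4 T) [a, b, c, d] =
     (\<Sum>i j k l. E i a * E j b * E k c * E l d * T i j k l)"
  by (simp add: sum_distrib_left mult.assoc)

definition frame2 :: "real^4^4 \<Rightarrow> tensor2 \<Rightarrow> tensor2" where
  "frame2 B \<alpha> a b = (\<Sum>i j. B $ i $ a * B $ j $ b * \<alpha> i j)"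

context orthonormal_frame
begin

lemma raise_pair:
  "(\<Sum>a b. ginv G k a * ginv G l b * x a b)
     = (\<Sum>c d. E k c * E l d * (\<Sum>a b. E a c * E b d * x a b))"
proof -
  have "(\<Sum>a b. ginv G k a * ginv G l b * x a b)
     = (\<Sum>a b c d. E k c * E l d * (E a c * E b d * x a b))"
  proof (intro sum.cong refl)
    fix a b
    have "ginv G k a * ginv G l b = (\<Sum>c d. (E k c * E a c) * (E l d * E b d))"
      unfolding ginv_eq by (rule sum_product)
    then show "ginv G k a * ginv G l b * x a b = (\<Sum>c d. E k c * E l d * (E a c * E b d * x a b))"
      by (simp add: sum_distrib_left sum_distrib_right ac_simps)
  qed
  then show ?thesis by (simp only: sum_distrib_left) (subst sum_swap_pairs, simp)
qed

lemma hodge_wedge: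
  "hodge G (wedge i j) $ k $ l = (\<Sum>c d. E k c * E l d *
     (\<Sum>a b. E a c * E b d * (sqrt (det G) * eps i j a b)))"
proof -
  have *: "(\<Sum>i' j'. sqrt (det G) * eps i' j' a b * wedge i j $ i' $ j')
      = 2 * (sqrt (det G) * eps i j a b)" for a b
  proof -
    have x: "(\<Sum>i' j'. h i' j' * (axis k 1 $ i' * axis l 1 $ j')) = h k l" for h :: tensor2 and k l
      by (simp add: axis_def if_distrib[of "\<lambda>y. _ * y"] if_distrib[of "\<lambda>y. y * _"] cong: if_cong)
    show ?thesis
      using x[of "\<lambda>i' j'. sqrt (det G) * eps i' j' a b" i j] x[of "\<lambda>i' j'. sqrt (det G) * eps i' j' a b" j i]
      by (simp add: wedge_def right_diff_distrib sum_subtractf eps_antisym[of j i])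
  qed
  have "hodge G (wedge i j) $ k $ l = 1/2 * (\<Sum>i' j' a b.
      ginv G k a * ginv G l b * (sqrt (det G) * eps i' j' a b * wedge i j $ i' $ j'))"
    by (simp add: hodge_def vol_form_def eps_def mult.assoc)
  also have "\<dots> = 1/2 * (\<Sum>a b. ginv G k a * ginv G l b *
      (\<Sum>i' j'. sqrt (det G) * eps i' j' a b * wedge i j $ i' $ j'))"
    by (subst sum_swap_pairs) (simp add: sum_distrib_left)
  finally show ?thesis
    unfolding * raise_pair by (simp add: sum_distrib_left mult.assoc)
qed

definition Om :: "real \<Rightarrow> 3 \<Rightarrow> real^4^4" where
  "Om s \<alpha> = (\<chi> a b. \<Sum>c d. E a c * E b d * om s \<alpha> c d)"

text \<open>The determinant of \<open>B\<close> from \<open>conv_eps\<close> cancels against the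
  square root in the volume form, so the Hodge star has the constant coefficients \<open>eps\<close>
  in the frame and \<open>eps_om\<close> applies.\<close>

lemma proj_frame_bivector:
  assumes s: "s = 1 \<or> s = -1"
  shows "(\<Sum>i j. (E i p * E j q) *\<^sub>R bivector_proj s G (wedge i j))
     = (1/2) *\<^sub>R (\<Sum>\<alpha>. om s \<alpha> p q *\<^sub>R Om s \<alpha>)"
proof -
  have w: "(\<Sum>i j. E i p * E j q * wedge i j $ a $ b) = E a p * E b q - E a q * E b p" for a b
    using sum_wedge[of "\<lambda>i. E i p" "\<lambda>j. E j q" a b] by (simp add: mult.commute)
  have w': "E a p * E b q - E a q * E b p = (\<Sum>c d. E a c * E b d *
      ((if p = c \<and> q = d then 1 else 0) - (if p = d \<and> q = c then 1 else 0)))" for a b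
  proof -
    have "(\<Sum>c d. E a c * E b d * (if p' = c \<and> q' = d then 1 else 0)) = E a p' * E b q'" for p' q'
    proof -
      have "(\<Sum>c d. E a c * E b d * (if p' = c \<and> q' = d then 1 else 0))
        = (\<Sum>c d. (if p' = c then E a c else 0) * (if q' = d then E b d else 0))"
        by (intro sum.cong refl) simp
      then show ?thesis unfolding sum_product[symmetric] by simp
    qed
    from this[of p q] this[of q p] show ?thesis
      by (simp add: right_diff_distrib sum_subtractf conj_commute split del: if_split)
  qed
  have h: "(\<Sum>i j. E i p * E j q * hodge G (wedge i j) $ a $ b)
      = (\<Sum>c d. E a c * E b d * eps p q c d)" for a b
  proof -
    have "(\<Sum>i j. E i p * E j q * hodge G (wedge i j) $ a $ b) =
      (\<Sum>i j c d. E a c * E b d * (E i p * E j q * 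
       (\<Sum>k l. E k c * E l d * (sqrt (det G) * eps i j k l))))"
      unfolding hodge_wedge by (simp add: sum_distrib_left ac_simps)
    also have "\<dots> = (\<Sum>c d. E a c * E b d * (sqrt (det G) * conv E (tensor4 eps) [p, q, c, d]))"
      by (subst sum_swap_pairs) (simp add: conv4 sum_distrib_left ac_simps)
    also have "\<dots> = (\<Sum>c d. E a c * E b d * eps p q c d)"
      unfolding conv_eps using sqrt_det by (simp add: mult.assoc[symmetric])
    finally show ?thesis .
  qed
  show ?thesis
  proof (intro vec_eq_iff[THEN iffD2] allI)
    fix a b
    have "(\<Sum>i j. (E i p * E j q) *\<^sub>R bivector_proj s G (wedge i j)) $ a $ b
      = 1/2 * ((\<Sum>i j. E i p * E j q * wedge i j $ a $ b)
        + s * (\<Sum>i j. E i p * E j q * hodge G (wedge i j) $ a $ b))"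
      by (simp add: bivector_proj_def sum_component sum_distrib_left sum.distrib algebra_simps)
    also have "\<dots> = 1/2 * (\<Sum>c d. E a c * E b d *
        ((if p = c \<and> q = d then 1 else 0) - (if p = d \<and> q = c then 1 else 0) + s * eps p q c d))"
      unfolding w w' h by (simp add: sum.distrib distrib_left sum_distrib_left ac_simps)
    also have "\<dots> = 1/2 * (\<Sum>c d \<alpha>. om s \<alpha> p q * (E a c * E b d * om s \<alpha> c d))"
      unfolding eps_om[OF s] sum_distrib_left by (simp only: ac_simps)
    also have "\<dots> = ((1/2) *\<^sub>R (\<Sum>\<alpha>. om s \<alpha> p q *\<^sub>R Om s \<alpha>)) $ a $ b"
      by (subst sum_rotate3) (simp add: Om_def sum_distrib_left sum_component)
    finally show "(\<Sum>i j. (E i p * E j q) *\<^sub>R bivector_proj s G (wedge i j)) $ a $ b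
      = ((1/2) *\<^sub>R (\<Sum>\<alpha>. om s \<alpha> p q *\<^sub>R Om s \<alpha>)) $ a $ b" .
  qed
qed

lemma Om_contract:
  "(\<Sum>i j. Om s \<alpha> $ i $ j * h i j)
    = (\<Sum>c d. om s \<alpha> c d * (\<Sum>i j. E i c * E j d * h i j))"
proof -
  have "(\<Sum>i j. Om s \<alpha> $ i $ j * h i j)
    = (\<Sum>i j c d. om s \<alpha> c d * (E i c * E j d * h i j))"
    unfolding Om_def vec_lambda_beta sum_distrib_right by (intro sum.cong refl) (simp add: ac_simps)
  then show ?thesis by (subst (asm) sum_swap_pairs) (simp add: sum_distrib_left)
qed

lemma on_bivectors_Om:
  "on_bivectors T (Om s \<alpha>) (Om s \<beta>) = 1/4 * om_comp s (\<lambda>i j k l. conv E (tensor4 T) [i, j, k, l]) \<alpha> \<beta>"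
proof -
  have *: "(\<Sum>i j. E i c * E j d *
      (\<Sum>c' d'. om s \<beta> c' d' * (\<Sum>k l. E k c' * E l d' * T i j k l)))
    = om_contract s \<beta> (\<lambda>c' d'. conv E (tensor4 T) [c, d, c', d'])" (is "?L c d = ?R c d") for c d
  proof -
    have "?L c d = (\<Sum>c' d' i j. E i c * E j d * (om s \<beta> c' d' * 
      (\<Sum>k l. E k c' * E l d' * T i j k l)))"
      unfolding sum_distrib_left[of "E _ c * E _ d"] by (rule sum_swap_pairs)
    then show ?thesis
      unfolding om_contract_def conv4 by (simp add: sum_distrib_left ac_simps)
  qed
  have "on_bivectors T (Om s \<alpha>) (Om s \<beta>) = 1/4 * (\<Sum>i j. Om s \<alpha> $ i $ j *
      (\<Sum>k l. Om s \<beta> $ k $ l * T i j k l))"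
    unfolding on_bivectors_def by (simp add: sum_distrib_left ac_simps)
  also have "\<dots> = 1/4 * (\<Sum>c d. om s \<alpha> c d * (\<Sum>i j. E i c * E j d *
      (\<Sum>c' d'. om s \<beta> c' d' * (\<Sum>k l. E k c' * E l d' * T i j k l))))"
    unfolding Om_contract by (rule refl)
  finally show ?thesis
    unfolding * om_comp_def om_contract_def[of s \<alpha>] by simp
qed

text \<open>Conversion to the frame turns both arguments into projected frame bivectors. The factor
  1/16 of \<open>proj_pairs_eq\<close> arises as 1/2 from each projection and 1/4 from
  \<open>on_bivectors\<close>.\<close>

lemma dual_part_eq:
  assumes s: "s = 1 \<or> s = -1"
  shows "conv E (tensor4 (dual_part s G T)) [p, q, r, t] = proj_pairs s (conv E (tensor4 T)) [p, q, r, t]"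
proof -
  let ?P = "\<lambda>i j. bivector_proj s G (wedge i j)"
  have "conv E (tensor4 (dual_part s G T)) [p, q, r, t] =
     on_bivectors T (\<Sum>i j. (E i p * E j q) *\<^sub>R ?P i j) (\<Sum>k l. (E k r * E l t) *\<^sub>R ?P k l)"
    unfolding conv4 dual_part_def
    unfolding on_bivectors_sum_left on_bivectors_scale_left
    unfolding on_bivectors_sum_right on_bivectors_scale_right sum_distrib_left by (simp only: mult.assoc)
  then show ?thesis
    unfolding proj_frame_bivector[OF s] on_bivectors_sum_left on_bivectors_scale_left
    unfolding on_bivectors_sum_right on_bivectors_scale_right on_bivectors_Om proj_pairs_eq
    by (simp add: sum_distrib_left mult.assoc mult.left_commute)
qed

lemma kn_prod_frame:
  "conv E (tensor4 (kn_prod \<alpha> \<beta>)) [a, b, c, d] = kn_prod (frame2 B \<alpha>) (frame2 B \<beta>) a b c d"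
proof -
  let ?f = "\<lambda>a c (\<alpha>::tensor2) i k. E i a * E k c * \<alpha> i k"
  have "conv E (tensor4 (kn_prod \<alpha> \<beta>)) [a, b, c, d] = (\<Sum>i j k l.
      ?f a c \<alpha> i k * ?f b d \<beta> j l + ?f a c \<beta> i k * ?f b d \<alpha> j l
      - ?f a d \<alpha> i l * ?f b c \<beta> j k - ?f a d \<beta> i l * ?f b c \<alpha> j k)"
    unfolding conv4 kn_prod_def by (intro sum.cong refl) (simp add: algebra_simps)
  also have "\<dots> = kn_prod (frame2 B \<alpha>) (frame2 B \<beta>) a b c d"
    unfolding sum.distrib sum_subtractf sum4_product kn_prod_def frame2_def by (simp add: mult.commute)
  finally show ?thesis .
qed

lemma metric_frame2: "frame2 B (\<lambda>i j. G $ i $ j) = (\<lambda>a b. if a = b then 1 else 0)"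
  unfolding frame2_def metric_frame by (rule refl)

lemma trace_frame2: "(\<Sum>i k. ginv G i k * h i k) = (\<Sum>a. frame2 B h a a)"
proof -
  have "(\<Sum>i k. ginv G i k * h i k) = (\<Sum>i k a. E i a * E k a * h i k)"
    unfolding ginv_eq sum_distrib_right by simp
  also have "\<dots> = (\<Sum>a i k. E i a * E k a * h i k)"
    by (rule sum_rotate3)
  finally show ?thesis unfolding frame2_def .
qed

lemma contraction_frame:
  "frame2 B (\<lambda>i k. \<Sum>j l. ginv G j l * T i j k l) a c = (\<Sum>b. conv E (tensor4 T) [a, b, c, b])"
proof -
  have "frame2 B (\<lambda>i k. \<Sum>j l. ginv G j l * T i j k l) a c =
    (\<Sum>i k j l b. E i a * E j b * E k c * E l b * T i j k l)"
    unfolding frame2_def ginv_eq sum_distrib_left sum_distrib_right by (simp only: ac_simps)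
  also have "\<dots> = (\<Sum>i k b j l. E i a * E j b * E k c * E l b * T i j k l)"
    by (intro sum.cong refl sum_rotate3)
  also have "\<dots> = (\<Sum>b i k j l. E i a * E j b * E k c * E l b * T i j k l)"
    by (rule sum_rotate3)
  also have "\<dots> = (\<Sum>b. conv E (tensor4 T) [a, b, c, b])"
    unfolding conv4 by (intro sum.cong refl sum.swap)
  finally show ?thesis .
qed

end

section \<open>The determinant on the bivectors of one duality\<close>

lemma endo_det3_eq:
  fixes b :: "3 \<Rightarrow> 'v::real_vector" and m :: "real^3^3"
  assumes L: "linear L"
    and b: "inj b" "independent (range b)" "span (range b) = V"
    and m: "\<And>j. L (b j) = (\<Sum>i. m $ i $ j *\<^sub>R b i)"
  shows "endo_det3 V L = det m"
proof -
  have coeff: "\<exists>p. \<forall>j. c j = (\<Sum>i. p $ i $ j *\<^sub>R b i)"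
    if "inj b" "independent (range b)" "\<And>j. c j \<in> span (range b)" for b c :: "3 \<Rightarrow> 'v"
  proof -
    have "\<exists>f. c j = (\<Sum>i. f i *\<^sub>R b i)" for j
    proof -
      from that(3)[of j] obtain u where "c j = (\<Sum>v\<in>range b. u v *\<^sub>R v)"
        by (auto simp: span_finite)
      then have "c j = (\<Sum>i. u (b i) *\<^sub>R b i)"
        by (simp add: sum.reindex[OF that(1)])
      then show ?thesis by (intro exI[of _ "\<lambda>i. u (b i)"])
    qed
    then obtain f where "\<And>j. c j = (\<Sum>i. f j i *\<^sub>R b i)" by metis
    then show ?thesis by (intro exI[of _ "\<chi> i j. f j i"]) simp
  qed
  have unique: "p = q" if "inj b" "independent (range b)"
    "\<And>j. (\<Sum>i. p $ i $ j *\<^sub>R b i) = (\<Sum>i. q $ i $ j *\<^sub>R b i)"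
    for b :: "3 \<Rightarrow> 'v" and p q :: "real^3^3"
  proof -
    have "p $ i $ j - q $ i $ j = 0" for i j
    proof -
      have "(\<Sum>i. (p $ i $ j - q $ i $ j) *\<^sub>R b i) = 0"
        using that(3)[of j] by (simp add: scaleR_left_diff_distrib sum_subtractf)
      then have "(\<Sum>v\<in>range b. (p $ (inv b v) $ j - q $ (inv b v) $ j) *\<^sub>R v) = 0"
        by (simp add: sum.reindex[OF that(1)] inv_f_f[OF that(1)])
      then have "\<forall>v\<in>range b. p $ (inv b v) $ j - q $ (inv b v) $ j = 0"
        using independentD[OF that(2), of "range b" "\<lambda>v. p $ (inv b v) $ j - q $ (inv b v) $ j"] by auto
      then show ?thesis using inv_f_f[OF that(1)] by auto
    qed
    then show ?thesis by (simp add: vec_eq_iff)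
  qed
  have comp: "(\<Sum>i. p $ i $ j *\<^sub>R (\<Sum>k. q $ k $ i *\<^sub>R b k)) = (\<Sum>k. (q ** p) $ k $ j *\<^sub>R b k)"
    for p q :: "real^3^3" and b :: "3 \<Rightarrow> 'v" and j
  proof -
    have "(\<Sum>i. p $ i $ j *\<^sub>R (\<Sum>k. q $ k $ i *\<^sub>R b k)) = (\<Sum>i k. (q $ k $ i * p $ i $ j) *\<^sub>R b k)"
      by (simp add: scaleR_sum_right mult.commute)
    also have "\<dots> = (\<Sum>k i. (q $ k $ i * p $ i $ j) *\<^sub>R b k)" by (rule sum.swap)
    finally show ?thesis by (simp add: matrix_matrix_mult_def scaleR_sum_left)
  qed
  \<comment> \<open>Any other basis arises by an invertible matrix \<open>p\<close>, and
    \<open>m ** p = p ** m'\<close>; equality of the determinants justifies the definite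
    description.\<close>
  have same: "det m = det m'" if b': "inj b'" "independent (range b')" "span (range b') = V"
    and m': "\<And>j. L (b' j) = (\<Sum>i. m' $ i $ j *\<^sub>R b' i)" for b' :: "3 \<Rightarrow> 'v" and m' :: "real^3^3"
  proof -
    have "\<And>j. b' j \<in> span (range b)" "\<And>j. b j \<in> span (range b')"
      using b(3) b'(3) span_base[of _ "range b"] span_base[of _ "range b'"] by auto
    then obtain p q where p: "\<forall>j. b' j = (\<Sum>i. p $ i $ j *\<^sub>R b i)"
      and q: "\<forall>j. b j = (\<Sum>i. q $ i $ j *\<^sub>R b' i)"
      using coeff[OF b(1,2), of b'] coeff[OF b'(1,2), of b] by blast
    note p = p[rule_format] and q = q[rule_format]
    have "p ** q = mat 1"
    proof (rule unique[OF b(1,2)])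
      fix j
      have "(\<Sum>i. (p ** q) $ i $ j *\<^sub>R b i) = b j"
        unfolding comp[symmetric] p[symmetric] q[symmetric] by (rule refl)
      also have "b j = (\<Sum>i. (mat 1 :: real^3^3) $ i $ j *\<^sub>R b i)"
        by (simp add: mat_def if_distrib[of "\<lambda>y. y *\<^sub>R _"] cong: if_cong)
      finally show "(\<Sum>i. (p ** q) $ i $ j *\<^sub>R b i) = (\<Sum>i. (mat 1 :: real^3^3) $ i $ j *\<^sub>R b i)" .
    qed
    then have "det p \<noteq> 0" using det_mul[of p q] by auto
    have "m ** p = p ** m'"
    proof (rule unique[OF b(1,2)])
      fix j
      have "(\<Sum>i. (m ** p) $ i $ j *\<^sub>R b i) = L (b' j)"
        unfolding comp[symmetric] m[symmetric] p by (simp add: linear_sum[OF L] linear_cmul[OF L])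
      also have "\<dots> = (\<Sum>i. (p ** m') $ i $ j *\<^sub>R b i)"
        unfolding m' comp[symmetric] p[symmetric] by (rule refl)
      finally show "(\<Sum>i. (m ** p) $ i $ j *\<^sub>R b i) = (\<Sum>i. (p ** m') $ i $ j *\<^sub>R b i)" .
    qed
    then have "det m * det p = det p * det m'" by (metis det_mul)
    then show ?thesis using \<open>det p \<noteq> 0\<close> by simp
  qed
  show ?thesis unfolding endo_det3_def
  proof (rule the_equality)
    fix d assume "\<forall>(b :: 3 \<Rightarrow> 'v) (m :: real^3^3).
     inj b \<and> independent (range b) \<and> span (range b) = V
       \<and> (\<forall>j. L (b j) = (\<Sum>i. m $ i $ j *\<^sub>R b i)) \<longrightarrow> d = det m"
    then show "d = det m" using b m by blast
  qed (use same in blast)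
qed

lemma hodge_add: "hodge G (\<alpha> + \<beta>) = hodge G \<alpha> + hodge G \<beta>"
  by (simp add: vec_eq_iff hodge_def distrib_left sum.distrib)

lemma hodge_scale: "hodge G (c *\<^sub>R \<alpha>) = c *\<^sub>R hodge G \<alpha>"
  by (simp add: vec_eq_iff hodge_def sum_distrib_left ac_simps)

lemma linear_bivector_proj: "linear (bivector_proj s G)"
  by (rule linearI) (simp_all add: bivector_proj_def hodge_add hodge_scale algebra_simps)

lemma linear_bivector_op: "linear (bivector_op G T)"
  by (rule linearI) (simp_all add: bivector_op_def vec_eq_iff distrib_left sum.distrib sum_distrib_left ac_simps)

lemma bivector_wedge:
  assumes "\<alpha> \<in> bivectors"
  shows "\<alpha> = (1/2) *\<^sub>R (\<Sum>i j. \<alpha> $ i $ j *\<^sub>R wedge i j)"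
proof -
  have a: "\<alpha> $ j $ i = - \<alpha> $ i $ j" for i j
  proof -
    have "transpose \<alpha> $ i $ j = (- \<alpha>) $ i $ j" using assms by (simp add: bivectors_def)
    then show ?thesis by (simp add: transpose_def)
  qed
  have "(\<Sum>i j. \<alpha> $ i $ j *\<^sub>R wedge i j) $ a $ b = \<alpha> $ a $ b - \<alpha> $ b $ a" for a b
  proof -
    have x: "(\<Sum>i j. h i j * ((axis i 1 :: real^4) $ a * (axis j 1 :: real^4) $ b)) = h a b" for h :: tensor2 and a b
      by (simp add: axis_def if_distrib[of "\<lambda>y. _ * y"] if_distrib[of "\<lambda>y. y * _"] cong: if_cong)
    have "(\<Sum>i j. \<alpha> $ i $ j *\<^sub>R wedge i j) $ a $ b
      = (\<Sum>i j. \<alpha> $ i $ j * ((axis i 1 :: real^4) $ a * (axis j 1 :: real^4) $ b))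
      - (\<Sum>i j. \<alpha> $ i $ j * ((axis i 1 :: real^4) $ b * (axis j 1 :: real^4) $ a))"
      by (simp add: wedge_def right_diff_distrib sum_subtractf mult.commute[of "axis _ 1 $ a"])
    then show ?thesis unfolding x .
  qed
  then have "((1/2) *\<^sub>R (\<Sum>i j. \<alpha> $ i $ j *\<^sub>R wedge i j)) $ a $ b = \<alpha> $ a $ b" for a b
    using a[of b a] by (simp only: vector_scaleR_component) simp
  then show ?thesis unfolding vec_eq_iff[where 'b = 4] by metis
qed

context orthonormal_frame
begin

definition \<theta> :: "4 \<Rightarrow> 4 \<Rightarrow> real" where "\<theta> a j = (\<Sum>i. E i a * G $ i $ j)"

lemma coframe_frame: "(\<Sum>j. \<theta> a j * E j b) = (if a = b then 1 else 0)"
proof -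
  have "(\<Sum>j. \<theta> a j * E j b) = (\<Sum>j i. E i a * E j b * G $ i $ j)"
    by (simp add: \<theta>_def sum_distrib_right sum_distrib_left ac_simps)
  also have "\<dots> = (\<Sum>i j. E i a * E j b * G $ i $ j)" by (rule sum.swap)
  finally show ?thesis unfolding metric_frame .
qed

lemma frame_coframe: "(\<Sum>a. E i a * \<theta> a j) = (if i = j then 1 else 0)"
proof -
  have "(\<chi> a j. \<theta> a j) ** B = mat 1"
    using coframe_frame by (simp add: matrix_matrix_mult_def mat_def vec_eq_iff)
  then have "B ** (\<chi> a j. \<theta> a j) = mat 1" using matrix_left_right_inverse by blast
  then show ?thesis by (simp add: matrix_matrix_mult_def mat_def vec_eq_iff)
qed

definition frame_wedge :: "4 \<Rightarrow> 4 \<Rightarrow> real^4^4" where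
  "frame_wedge p q = (\<Sum>i j. (E i p * E j q) *\<^sub>R wedge i j)"

lemma proj_frame_wedge:
  assumes s: "s = 1 \<or> s = -1"
  shows "bivector_proj s G (frame_wedge p q) = (1/2) *\<^sub>R (\<Sum>\<alpha>. om s \<alpha> p q *\<^sub>R Om s \<alpha>)"
  unfolding proj_frame_bivector[OF s, symmetric] frame_wedge_def
  by (simp add: linear_sum[OF linear_bivector_proj] linear_cmul[OF linear_bivector_proj])

lemma wedge_frame: "wedge i j = (\<Sum>p q. (\<theta> p i * \<theta> q j) *\<^sub>R frame_wedge p q)"
proof -
  have f: "frame_wedge p q $ a $ b = E a p * E b q - E b p * E a q" for p q a b
    unfolding frame_wedge_def using sum_wedge[of "\<lambda>i. E i p" "\<lambda>j. E j q" a b] by simp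
  have "(\<Sum>p q. (\<theta> p i * \<theta> q j) *\<^sub>R frame_wedge p q) $ a $ b
     = (\<Sum>p. E a p * \<theta> p i) * (\<Sum>q. E b q * \<theta> q j) - (\<Sum>p. E b p * \<theta> p i) * (\<Sum>q. E a q * \<theta> q j)" for a b
    unfolding sum_product by (simp add: f right_diff_distrib sum_subtractf ac_simps)
  then show ?thesis unfolding frame_coframe by (auto simp: vec_eq_iff wedge_def axis_def)
qed

lemma Om_frame_wedge: "Om s \<alpha> = (1/2) *\<^sub>R (\<Sum>p q. om s \<alpha> p q *\<^sub>R frame_wedge p q)"
proof -
  have f: "frame_wedge p q $ a $ b = E a p * E b q - E b p * E a q" for p q a b
    unfolding frame_wedge_def using sum_wedge[of "\<lambda>i. E i p" "\<lambda>j. E j q" a b] by simp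
  have 1: "(\<Sum>p q. om s \<alpha> p q * (E b p * E a q)) = - Om s \<alpha> $ a $ b" for a b
  proof -
    have "(\<Sum>p q. om s \<alpha> p q * (E b p * E a q)) = (\<Sum>q p. om s \<alpha> p q * (E b p * E a q))"
      by (rule sum.swap)
    also have "\<dots> = - Om s \<alpha> $ a $ b"
      unfolding Om_def vec_lambda_beta sum_negf[symmetric]
      by (intro sum.cong refl) (subst om_antisym, simp)
    finally show ?thesis .
  qed
  have 2: "(\<Sum>p q. om s \<alpha> p q * (E a p * E b q)) = Om s \<alpha> $ a $ b" for a b
    by (simp add: Om_def ac_simps)
  have "((1/2) *\<^sub>R (\<Sum>p q. om s \<alpha> p q *\<^sub>R frame_wedge p q)) $ a $ b = Om s \<alpha> $ a $ b" for a b
  proof -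
    have "(\<Sum>p q. om s \<alpha> p q *\<^sub>R frame_wedge p q) $ a $ b
      = (\<Sum>p q. om s \<alpha> p q * (E a p * E b q)) - (\<Sum>p q. om s \<alpha> p q * (E b p * E a q))"
      by (simp add: f right_diff_distrib sum_subtractf)
    then show ?thesis using 1[where a = a and b = b] 2[where a = a and b = b] by simp
  qed
  then show ?thesis unfolding vec_eq_iff[where 'b = 4] by metis
qed

lemma proj_Om:
  assumes s: "s = 1 \<or> s = -1"
  shows "bivector_proj s G (Om s \<alpha>) = Om s \<alpha>"
proof -
  have "bivector_proj s G (Om s \<alpha>) = (1/4) *\<^sub>R (\<Sum>p q \<beta>. (om s \<alpha> p q * om s \<beta> p q) *\<^sub>R Om s \<beta>)"
    by (subst Om_frame_wedge)
      (simp add: linear_sum[OF linear_bivector_proj] linear_cmul[OF linear_bivector_proj]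
        proj_frame_wedge[OF s] scaleR_sum_right)
  also have "\<dots> = (1/4) *\<^sub>R (\<Sum>\<beta>. om_contract s \<alpha> (\<lambda>p q. of_real (om s \<beta> p q)) *\<^sub>R Om s \<beta>)"
    by (subst sum_rotate3) (simp add: om_contract_def scaleR_sum_left)
  also have "\<dots> = Om s \<alpha>"
    unfolding om_orthogonal[OF s] by (simp add: if_distrib[of "\<lambda>y. y *\<^sub>R _"] cong: if_cong)
  finally show ?thesis .
qed

text \<open>Bivectors of duality \<open>s\<close> are fixed by the projection, whose values on
  bivectors lie in the span. Conversely \<open>proj_Om\<close> yields the eigenvalue equation, as
  \<open>s\<close> is its own inverse.\<close>

lemma dual_bivectors_eq:
  assumes s: "s = 1 \<or> s = -1"
  shows "dual_bivectors s G = span (range (Om s))"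
proof
  have ss: "s * s = 1" using s by auto
  have "bivector_proj s G \<alpha> \<in> span (range (Om s))" if "\<alpha> \<in> bivectors" for \<alpha>
    by (subst bivector_wedge[OF that])
      (simp add: wedge_frame linear_sum[OF linear_bivector_proj] linear_cmul[OF linear_bivector_proj]
        proj_frame_wedge[OF s] span_sum span_scale span_base)
  moreover have "bivector_proj s G \<alpha> = \<alpha>" if "hodge G \<alpha> = s *\<^sub>R \<alpha>" for \<alpha>
    using that ss by (simp add: bivector_proj_def scaleR_2[symmetric])
  ultimately show "dual_bivectors s G \<subseteq> span (range (Om s))"
    unfolding dual_bivectors_def by fastforce
  have h: "hodge G (Om s \<alpha>) = s *\<^sub>R Om s \<alpha>" for \<alpha>
  proof -
    have "2 *\<^sub>R bivector_proj s G (Om s \<alpha>) = Om s \<alpha> + s *\<^sub>R hodge G (Om s \<alpha>)"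
      by (simp add: bivector_proj_def)
    then have "s *\<^sub>R hodge G (Om s \<alpha>) = Om s \<alpha>"
      unfolding proj_Om[OF s] scaleR_2 by simp
    then have "s *\<^sub>R (s *\<^sub>R hodge G (Om s \<alpha>)) = s *\<^sub>R Om s \<alpha>" by simp
    then show ?thesis using ss by simp
  qed
  have a: "transpose (Om s \<alpha>) = - Om s \<alpha>" for \<alpha>
  proof -
    have "Om s \<alpha> $ b $ a = - Om s \<alpha> $ a $ b" for a b
      unfolding Om_def vec_lambda_beta sum_negf[symmetric]
      by (subst sum.swap, intro sum.cong refl, subst om_antisym, simp)
    then show ?thesis unfolding vec_eq_iff[where 'b = 4] transpose_def vec_lambda_beta vector_uminus_component
      by blast
  qed
  have t: "transpose (x + y) = transpose x + transpose y" "transpose (c *\<^sub>R x) = c *\<^sub>R transpose x" "transpose 0 = 0"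
    for x y :: "real^4^4" and c by (simp_all add: vec_eq_iff transpose_def)
  have "hodge G 0 = 0" using hodge_scale[of G 0] by simp
  then have "subspace (dual_bivectors s G)"
    unfolding subspace_def dual_bivectors_def bivectors_def
    by (auto simp: hodge_add hodge_scale t scaleR_add_right mult.commute)
  moreover have "range (Om s) \<subseteq> dual_bivectors s G"
    using h a by (auto simp: dual_bivectors_def bivectors_def)
  ultimately show "span (range (Om s)) \<subseteq> dual_bivectors s G" by (rule span_minimal[rotated])
qed

text \<open>Four times the coordinate functionals of the \<open>Om s \<alpha>\<close>; they witness
  linear independence.\<close>

definition Om_dual :: "real \<Rightarrow> 3 \<Rightarrow> real^4^4 \<Rightarrow> real" where
  "Om_dual s \<beta> X = om_contract s \<beta> (\<lambda>c d. \<Sum>i j. \<theta> c i * \<theta> d j * X $ i $ j)"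

lemma linear_Om_dual: "linear (Om_dual s \<beta>)"
  by (rule linearI)
    (simp_all add: Om_dual_def om_contract_add[symmetric] om_contract_mult[symmetric] distrib_left sum.distrib
      sum_distrib_left mult.left_commute)

lemma Om_dual_Om:
  assumes s: "s = 1 \<or> s = -1"
  shows "Om_dual s \<beta> (Om s \<alpha>) = (if \<alpha> = \<beta> then 4 else 0)"
proof -
  have "(\<Sum>i j. \<theta> c i * \<theta> d j * Om s \<alpha> $ i $ j) = om s \<alpha> c d" for c d
  proof -
    have "(\<Sum>i j. \<theta> c i * \<theta> d j * Om s \<alpha> $ i $ j)
      = (\<Sum>p q. om s \<alpha> p q * (\<Sum>i j. E i p * E j q * (\<theta> c i * \<theta> d j)))"
      using Om_contract[of s \<alpha> "\<lambda>i j. \<theta> c i * \<theta> d j"] by (simp add: mult.commute)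
    also have "(\<lambda>p q. \<Sum>i j. E i p * E j q * (\<theta> c i * \<theta> d j)) =
      (\<lambda>p q. (\<Sum>i. \<theta> c i * E i p) * (\<Sum>j. \<theta> d j * E j q))"
      unfolding sum_product by (simp add: ac_simps)
    finally show ?thesis unfolding coframe_frame
      by (simp add: if_distrib[of "\<lambda>y. _ * y"] if_distrib[of "\<lambda>y. y * _"] cong: if_cong)
  qed
  then have "Om_dual s \<beta> (Om s \<alpha>) = om_contract s \<beta> (\<lambda>c d. of_real (om s \<alpha> c d))"
    by (simp add: Om_dual_def)
  then show ?thesis unfolding om_orthogonal[OF s] by auto
qed

lemma Om_independent:
  assumes s: "s = 1 \<or> s = -1"
  shows "inj (Om s)" "independent (range (Om s))"
proof -
  show inj: "inj (Om s)"
  proof (rule injI)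
    fix \<alpha> \<beta> assume "Om s \<alpha> = Om s \<beta>"
    then show "\<alpha> = \<beta>" using Om_dual_Om[OF s, of \<beta> \<alpha>] Om_dual_Om[OF s, of \<beta> \<beta>] by (auto split: if_splits)
  qed
  show "independent (range (Om s))"
  proof (rule independent_if_scalars_zero)
    fix u X assume u: "(\<Sum>X\<in>range (Om s). u X *\<^sub>R X) = 0" and "X \<in> range (Om s)"
    then obtain \<beta> where X: "X = Om s \<beta>" by blast
    have "(\<Sum>\<alpha>. u (Om s \<alpha>) *\<^sub>R Om s \<alpha>) = 0"
      using u by (simp add: sum.reindex[OF inj])
    then have "Om_dual s \<beta> (\<Sum>\<alpha>. u (Om s \<alpha>) *\<^sub>R Om s \<alpha>) = 0"
      using linear_0[OF linear_Om_dual] by simp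
    then have "(\<Sum>\<alpha>. u (Om s \<alpha>) * (if \<alpha> = \<beta> then 4 else 0)) = 0"
      by (simp add: linear_sum[OF linear_Om_dual] linear_cmul[OF linear_Om_dual] Om_dual_Om[OF s])
    then show "u X = 0" by (simp add: X if_distrib[of "\<lambda>y. _ * y"] cong: if_cong)
  qed simp
qed

text \<open>The factor 1/8 is 1/2 from \<open>bivector_op\<close> times 1/4 from projecting the
  second pair.\<close>

lemma bivector_op_Om:
  assumes s: "s = 1 \<or> s = -1"
  shows "bivector_op G (dual_part s G T) (Om s \<gamma>) =
    (\<Sum>\<beta>. (om_comp s (\<lambda>i j k l. conv E (tensor4 T) [i, j, k, l]) \<gamma> \<beta> / 8) *\<^sub>R Om s \<beta>)"
proof -
  let ?D = "dual_part s G T" and ?t = "om_comp s (\<lambda>i j k l. conv E (tensor4 T) [i, j, k, l])"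
  have D: "om_contract s \<gamma> (\<lambda>p q. conv E (tensor4 ?D) [p, q, c, d]) = 1/4 * (\<Sum>\<beta>. om s \<beta> c d * ?t \<gamma> \<beta>)" for c d
  proof -
    have "om_contract s \<gamma> (\<lambda>p q. conv E (tensor4 ?D) [p, q, c, d]) = 1/16 * (\<Sum>\<alpha> \<beta>.
       om_contract s \<gamma> (\<lambda>p q. of_real (om s \<alpha> p q)) * (om s \<beta> c d * ?t \<alpha> \<beta>))"
    proof -
      have m: "om_contract s \<gamma> (\<lambda>p q. h p q * c) = om_contract s \<gamma> h * c" for h and c :: real
        using om_contract_mult[of s \<gamma> c h] by (simp add: mult.commute)
      show ?thesis
        unfolding dual_part_eq[OF s] proj_pairs_eq om_contract_mult om_contract_sum mult.assoc m by simp
    qed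
    also have "\<dots> = 1/4 * (\<Sum>\<beta>. om s \<beta> c d * ?t \<gamma> \<beta>)"
      unfolding om_orthogonal[OF s] sum_distrib_left[symmetric]
      by (simp add: if_distrib[of "\<lambda>y. y * _"] cong: if_cong)
    finally show ?thesis .
  qed
  have "bivector_op G ?D (Om s \<gamma>) $ k $ l = (\<Sum>\<beta>. (?t \<gamma> \<beta> / 8) *\<^sub>R Om s \<beta>) $ k $ l" for k l
  proof -
    have "bivector_op G ?D (Om s \<gamma>) $ k $ l = 1/2 * (\<Sum>a b. ginv G k a * ginv G l b *
        (\<Sum>i j. Om s \<gamma> $ i $ j * ?D i j a b))"
      unfolding bivector_op_def vec_lambda_beta sum_distrib_left
      by (subst sum_swap_pairs) (simp add: ac_simps)
    also have "\<dots> = 1/2 * (\<Sum>c d. E k c * E l d * (\<Sum>a b. E a c * E b d *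
        (\<Sum>p q. om s \<gamma> p q * (\<Sum>i j. E i p * E j q * ?D i j a b))))"
      unfolding raise_pair Om_contract by (rule refl)
    also have "(\<lambda>c d. \<Sum>a b. E a c * E b d *
        (\<Sum>p q. om s \<gamma> p q * (\<Sum>i j. E i p * E j q * ?D i j a b)))
      = (\<lambda>c d. om_contract s \<gamma> (\<lambda>p q. conv E (tensor4 ?D) [p, q, c, d]))"
    proof (intro ext)
      fix c d
      have "(\<Sum>a b. E a c * E b d *
        (\<Sum>p q. om s \<gamma> p q * (\<Sum>i j. E i p * E j q * ?D i j a b)))
       = (\<Sum>p q a b. E a c * E b d *
        (om s \<gamma> p q * (\<Sum>i j. E i p * E j q * ?D i j a b)))"
        unfolding sum_distrib_left[of "E _ c * E _ d"] by (rule sum_swap_pairs)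
      also have "\<dots> = (\<Sum>p q i j a b. E a c * E b d *
        (om s \<gamma> p q * (E i p * E j q * ?D i j a b)))"
        unfolding sum_distrib_left by (intro sum.cong refl sum_swap_pairs)
      finally show "(\<Sum>a b. E a c * E b d *
        (\<Sum>p q. om s \<gamma> p q * (\<Sum>i j. E i p * E j q * ?D i j a b)))
       = om_contract s \<gamma> (\<lambda>p q. conv E (tensor4 ?D) [p, q, c, d])"
        unfolding om_contract_def conv4 by (simp add: sum_distrib_left ac_simps)
    qed
    finally have "bivector_op G ?D (Om s \<gamma>) $ k $ l = 1/8 * (\<Sum>c d \<beta>. ?t \<gamma> \<beta> * (E k c * E l d * om s \<beta> c d))"
      unfolding D by (simp add: sum_distrib_left ac_simps)
    then show ?thesis
      by (subst (asm) sum_rotate3) (simp add: Om_def sum_distrib_left)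
  qed
  then show ?thesis unfolding vec_eq_iff[where 'b = 4] by blast
qed

lemma dual_det_eq:
  assumes s: "s = 1 \<or> s = -1"
  shows "dual_det s G T = det (\<chi> \<alpha> \<beta>. om_comp s (\<lambda>i j k l. conv E (tensor4 T) [i, j, k, l]) \<alpha> \<beta> / 8)"
proof -
  let ?m = "\<chi> \<alpha> \<beta>. om_comp s (\<lambda>i j k l. conv E (tensor4 T) [i, j, k, l]) \<alpha> \<beta> / 8"
  \<comment> \<open>\<open>bivector_op_Om\<close> lists the coefficients of an image in a row,
    whereas \<open>endo_det3\<close> has them in a column.\<close>
  have "dual_det s G T = det (transpose ?m)"
    unfolding dual_det_def dual_bivectors_eq[OF s]
    by (rule endo_det3_eq[OF linear_bivector_op Om_independent[OF s] refl])
      (simp add: bivector_op_Om[OF s] transpose_def)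
  then show ?thesis by (simp add: det_transpose)
qed

end

section \<open>Smooth orthonormal frames\<close>

definition metric_pairing :: "real^4^4 \<Rightarrow> real^4 \<Rightarrow> real^4 \<Rightarrow> real" where
  "metric_pairing G u v = (\<Sum>i j. u $ i * v $ j * G $ i $ j)"

lemma metric_pairing_diff_left: "metric_pairing G (u - u') v = metric_pairing G u v - metric_pairing G u' v"
  by (simp add: metric_pairing_def left_diff_distrib sum_subtractf)

lemma metric_pairing_scale_left: "metric_pairing G (c *\<^sub>R u) v = c * metric_pairing G u v"
  by (simp add: metric_pairing_def sum_distrib_left mult.assoc)

lemma metric_pairing_sum_left: "metric_pairing G (\<Sum>x\<in>X. u x) v = (\<Sum>x\<in>X. metric_pairing G (u x) v)"
proof -
  have "linear (\<lambda>u. metric_pairing G u v)"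
    by (rule linearI) (simp_all add: metric_pairing_def distrib_right sum.distrib sum_distrib_left mult.assoc)
  then show ?thesis by (rule linear_sum)
qed

lemma metric_pairing_commute:
  assumes "\<And>i j. G $ i $ j = G $ j $ i"
  shows "metric_pairing G u v = metric_pairing G v u"
  unfolding metric_pairing_def by (subst sum.swap, subst assms) (simp add: mult.commute)

lemma metric_pairing_self: "metric_pairing G v v = v \<bullet> (G *v v)"
  by (simp add: metric_pairing_def inner_vec_def matrix_vector_mult_def sum_distrib_left ac_simps)

text \<open>Gram-Schmidt over a growing set of coordinate vectors. The last clause, that the fields
  built so far stay in the span of these vectors, keeps the next one from becoming zero.\<close>

lemma gram_schmidt_smooth:
  fixes g :: metric_coeffs and K :: "4 set"
  assumes S: "open S" and g: "\<And>i j. smooth_on S (\<lambda>y. g y $ i $ j)"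
    and sym: "\<And>y i j. y \<in> S \<Longrightarrow> g y $ i $ j = g y $ j $ i"
    and pos: "\<And>y v. y \<in> S \<Longrightarrow> v \<noteq> 0 \<Longrightarrow> v \<bullet> (g y *v v) > 0"
  shows "\<exists>e. (\<forall>a\<in>K. \<forall>i. smooth_on S (\<lambda>y. e a y $ i))
    \<and> (\<forall>y\<in>S. \<forall>a\<in>K. \<forall>b\<in>K. metric_pairing (g y) (e a y) (e b y) = (if a = b then 1 else 0))
    \<and> (\<forall>y\<in>S. \<forall>a\<in>K. \<forall>i. i \<notin> K \<longrightarrow> e a y $ i = 0)"
proof -
  have "finite K" by simp
  then show ?thesis
  proof (induction K rule: finite_induct)
    case (insert k K)
    then obtain e where e: "\<And>a i. a \<in> K \<Longrightarrow> smooth_on S (\<lambda>y. e a y $ i)"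
      "\<And>y a b. y \<in> S \<Longrightarrow> a \<in> K \<Longrightarrow> b \<in> K \<Longrightarrow> metric_pairing (g y) (e a y) (e b y) = (if a = b then 1 else 0)"
      "\<And>y a i. y \<in> S \<Longrightarrow> a \<in> K \<Longrightarrow> i \<notin> K \<Longrightarrow> e a y $ i = 0" by blast
    define v where "v y = axis k 1 - (\<Sum>a\<in>K. metric_pairing (g y) (axis k 1) (e a y) *\<^sub>R e a y)" for y
    define n where "n y = metric_pairing (g y) (v y) (v y)" for y
    define c where "c y = inverse (sqrt (n y))" for y
    define e' where "e' a y = (if a = k then c y *\<^sub>R v y else e a y)" for a y
    have vs: "smooth_on S (\<lambda>y. v y $ i)" for i
      unfolding v_def metric_pairing_def
      by (simp add: sum_component) (intro smooth_intros S g e(1))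
    have n_smooth: "smooth_on S n"
      unfolding n_def[abs_def] metric_pairing_def by (intro smooth_intros S g vs)
    have n_pos: "n y > 0" if "y \<in> S" for y
    proof -
      \<comment> \<open>The earlier fields have no component in the new direction \<open>k\<close>,
        so subtracting them leaves it at 1.\<close>
      have "v y $ k = 1" using e(3)[OF that _ insert.hyps(2)] by (simp add: v_def sum_component)
      then have "v y \<noteq> 0" by auto
      then show ?thesis using pos[OF that] by (simp add: n_def metric_pairing_self)
    qed
    have c_smooth: "smooth_on S c"
      unfolding c_def[abs_def] using n_pos
      by (intro smooth_on_inverse smooth_on_sqrt S n_smooth) (auto simp: less_imp_neq[symmetric])
    have vk: "metric_pairing (g y) (v y) (e b y) = 0" if "y \<in> S" "b \<in> K" for y b
    proof -
      have "metric_pairing (g y) (v y) (e b y) = metric_pairing (g y) (axis k 1) (e b y)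
          - (\<Sum>a\<in>K. metric_pairing (g y) (axis k 1) (e a y) * (if a = b then 1 else 0))"
        unfolding v_def metric_pairing_diff_left metric_pairing_sum_left metric_pairing_scale_left
        using e(2)[OF that(1) _ that(2)] by simp
      also have "(\<Sum>a\<in>K. metric_pairing (g y) (axis k 1) (e a y) * (if a = b then 1 else 0))
          = metric_pairing (g y) (axis k 1) (e b y)"
        using that(2) insert.hyps(1) by (simp add: if_distrib[of "\<lambda>y. _ * y"] cong: if_cong)
      finally show ?thesis by simp
    qed
    have cc: "c y * (c y * n y) = 1" if "y \<in> S" for y
      using n_pos[OF that] by (simp add: c_def field_simps)
    have com: "metric_pairing (g y) u v = metric_pairing (g y) v u" if "y \<in> S" for y u v
      by (rule metric_pairing_commute) (rule sym[OF that])
    have kk: "metric_pairing (g y) (e' k y) (e' k y) = 1" if "y \<in> S" for y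
      using cc[OF that] com[OF that, of "v y" "c y *\<^sub>R v y"]
      by (simp add: e'_def metric_pairing_scale_left n_def)
    have ka: "metric_pairing (g y) (e' k y) (e' a y) = 0" if "y \<in> S" "a \<in> K" for y a
      using vk[OF that] that insert.hyps(2) by (auto simp: e'_def metric_pairing_scale_left)
    have "metric_pairing (g y) (e' a y) (e' b y) = (if a = b then 1 else 0)"
      if y: "y \<in> S" and ab: "a \<in> insert k K" "b \<in> insert k K" for y a b
    proof -
      consider "a = k" "b = k" | "a = k" "b \<in> K" | "a \<in> K" "b = k" | "a \<in> K" "b \<in> K"
        using ab by auto
      then show ?thesis
      proof cases
        case 4
        then show ?thesis using e(2)[OF y 4] insert.hyps(2) by (auto simp: e'_def)
      qed (use kk[OF y] ka[OF y] com[OF y, of "e' a y" "e' k y"] insert.hyps(2) in auto)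
    qed
    moreover have "smooth_on S (\<lambda>y. e' a y $ i)" if "a \<in> insert k K" for a i
      using that e(1) insert.hyps(2) by (cases "a = k") (auto simp: e'_def intro!: smooth_on_mult S c_smooth vs)
    moreover have "e' a y $ i = 0" if "y \<in> S" "a \<in> insert k K" "i \<notin> insert k K" for y a i
      using that e(3)[OF that(1)] by (auto simp: e'_def v_def sum_component axis_def)
    ultimately show ?case by (intro exI[of _ e']) blast
  qed simp
qed

text \<open>The open set may be disconnected, so the sign correcting the orientation has to be a
  function of the point.\<close>

lemma orthonormal_frame_exists:
  fixes g :: metric_coeffs
  assumes S: "open S" and g: "\<And>i j. smooth_on S (\<lambda>y. g y $ i $ j)"
    and sym: "\<And>y i j. y \<in> S \<Longrightarrow> g y $ i $ j = g y $ j $ i"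
    and pos: "\<And>y v. y \<in> S \<Longrightarrow> v \<noteq> 0 \<Longrightarrow> v \<bullet> (g y *v v) > 0"
  obtains B where "\<And>i a. smooth_on S (\<lambda>y. B y $ i $ a)" "\<And>y. y \<in> S \<Longrightarrow> orthonormal_frame (g y) (B y)"
proof -
  have "\<exists>e :: 4 \<Rightarrow> real^4 \<Rightarrow> real^4. (\<forall>a i. smooth_on S (\<lambda>y. e a y $ i))
      \<and> (\<forall>y\<in>S. \<forall>a b. metric_pairing (g y) (e a y) (e b y) = (if a = b then 1 else 0))"
    using gram_schmidt_smooth[OF S g sym pos, of UNIV] by simp
  then obtain e :: "4 \<Rightarrow> real^4 \<Rightarrow> real^4" where "\<forall>a i. smooth_on S (\<lambda>y. e a y $ i)"
    "\<forall>y\<in>S. \<forall>a b. metric_pairing (g y) (e a y) (e b y) = (if a = b then 1 else 0)"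
    by blast
  note e = this[rule_format]
  have T: "(transpose B ** G ** B) $ a $ b = (\<Sum>i j. B $ i $ a * B $ j $ b * G $ i $ j)"
    for B G :: "real^4^4" and a b
  proof -
    have "(transpose B ** G ** B) $ a $ b = (\<Sum>j i. B $ i $ a * B $ j $ b * G $ i $ j)"
      by (simp add: matrix_matrix_mult_def transpose_def sum_distrib_right sum_distrib_left ac_simps)
    then show ?thesis by (subst sum.swap)
  qed
  define C where "C y = (\<chi> i a. e a y $ i)" for y
  have C: "transpose (C y) ** g y ** C y = mat 1" if "y \<in> S" for y
    unfolding vec_eq_iff[where 'b = 4] T using e(2)[OF that]
    by (simp add: C_def metric_pairing_def mat_def)
  \<comment> \<open>\<open>\<sigma>\<close> is a smooth choice of sign which corrects the orientation.\<close>
  define \<sigma> where "\<sigma> y = sqrt (det (g y)) * det (C y)" for y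
  have d: "det (C y) * det (C y) * det (g y) = 1" if "y \<in> S" for y
    using arg_cong[OF C[OF that], of det] by (simp add: det_mul ac_simps)
  have dpos: "det (g y) > 0" if "y \<in> S" for y
    using d[OF that] by (metis less_numeral_extra(1) mult_eq_0_iff not_real_square_gt_zero zero_less_mult_pos)
  have \<sigma>: "\<sigma> y * \<sigma> y = 1" if "y \<in> S" for y
  proof -
    have "\<sigma> y * \<sigma> y = det (C y) * det (C y) * (sqrt (det (g y)) * sqrt (det (g y)))"
      by (simp only: \<sigma>_def ac_simps)
    then show ?thesis using d[OF that] dpos[OF that] by simp
  qed
  define B where "B y = (\<chi> i a. (if a = 1 then \<sigma> y else 1) * e a y $ i)" for y
  have dets: "smooth_on S (\<lambda>y. det (g y))" "smooth_on S (\<lambda>y. det (C y))"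
    unfolding det_4 C_def vec_lambda_beta by (intro smooth_intros S g e(1))+
  have \<sigma>s: "smooth_on S \<sigma>"
    unfolding \<sigma>_def[abs_def] by (intro smooth_on_mult smooth_on_sqrt S dets dpos)
  show ?thesis
  proof (rule that)
    show "smooth_on S (\<lambda>y. B y $ i $ a)" for i a
      by (cases "a = 1") (auto simp: B_def intro!: smooth_on_mult S \<sigma>s e(1))
    fix y assume y: "y \<in> S"
    show "orthonormal_frame (g y) (B y)"
    proof
      have "(\<Sum>i j. B y $ i $ a * B y $ j $ b * g y $ i $ j)
        = (if a = 1 then \<sigma> y else 1) * (if b = 1 then \<sigma> y else 1) * metric_pairing (g y) (e a y) (e b y)" for a b
        unfolding metric_pairing_def sum_distrib_left B_def vec_lambda_beta by (simp only: ac_simps)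
      then show "transpose (B y) ** g y ** B y = mat 1"
        unfolding vec_eq_iff[where 'b = 4] T using e(2)[OF y] \<sigma>[OF y] by (simp add: mat_def)
      have "det (B y) = \<sigma> y * det (C y)"
        unfolding det_4 B_def C_def by (simp add: algebra_simps)
      also have "\<dots> = sqrt (det (g y)) * (det (C y) * det (C y))" by (simp add: \<sigma>_def)
      also have "\<dots> > 0" using dpos[OF y] d[OF y] by (metis mult_zero_left mult_pos_pos not_real_square_gt_zero real_sqrt_gt_zero zero_neq_one)
      finally show "det (B y) > 0" .
    qed
  qed
qed

text \<open>For trace-free \<open>h\<close> the product with the metric exchanges the two dualities,
  so within one block only the trace of \<open>h\<close> is visible.\<close>

lemma om_comp_kn_prod_metric:
  assumes s: "s = 1 \<or> s = -1" and h: "\<And>i j. h i j = h j i"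
  shows "om_comp s (kn_prod h (\<lambda>i j. if i = j then 1 else 0)) \<alpha> \<beta> = (if \<alpha> = \<beta> then 4 * (\<Sum>i. h i i) else 0)"
proof -
  note h' = h[of 2 1] h[of 3 1] h[of 4 1] h[of 3 2] h[of 4 2] h[of 4 3]
  have "\<forall>\<alpha> \<beta>. om_comp s (kn_prod h (\<lambda>i j. if i = j then 1 else 0)) \<alpha> \<beta> = (if \<alpha> = \<beta> then 4 * (\<Sum>i. h i i) else 0)"
    unfolding forall_3 om_comp_def om_contract_eq sum_4 kn_prod_def using s
    by (elim disjE) (simp_all add: h')
  then show ?thesis by blast
qed

section \<open>From coordinates to the frame\<close>

locale riemannian_chart = base_point S x for S x +
  fixes g :: metric_coeffs and B :: "real^4 \<Rightarrow> real^4^4"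
  assumes g_smooth: "smooth_on S (\<lambda>y. g y $ i $ j)"
    and g_sym: "y \<in> S \<Longrightarrow> g y $ i $ j = g y $ j $ i"
    and B_smooth: "smooth_on S (\<lambda>y. B y $ i $ a)"
    and frame: "y \<in> S \<Longrightarrow> orthonormal_frame (g y) (B y)"
begin

lemmas smooth_S = smooth_on_const smooth_on_add[OF open_S] smooth_on_mult[OF open_S]
  smooth_on_uminus[OF open_S] smooth_on_diff[OF open_S] smooth_on_sum[OF open_S] smooth_on_pd

lemmas germ_push = germ_at_add germ_at_mult germ_at_diff germ_at_minus germ_at_sum germ_at_const germ_at_pd

text \<open>The frame expresses the inverse metric as a polynomial in smooth functions.\<close>

lemma ginv_smooth: "smooth_on S (\<lambda>y. ginv (g y) i j)"
proof (subst smooth_on_cong[OF open_S])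
  show "ginv (g y) i j = (\<Sum>a. B y $ i $ a * B y $ j $ a)" if "y \<in> S" for y
    by (rule orthonormal_frame.ginv_eq[OF frame[OF that]])
qed (intro smooth_S B_smooth)

lemma christoffel_smooth: "smooth_on S (\<lambda>y. christoffel g y k i j)"
  unfolding christoffel_def by (intro smooth_S ginv_smooth g_smooth)

lemma riemann_smooth: "smooth_on S (\<lambda>y. riemann g y i j k l)"
  unfolding riemann_def by (intro smooth_S g_smooth christoffel_smooth)

lemma ricci_smooth: "smooth_on S (\<lambda>y. ricci g y i j)"
  unfolding ricci_def by (intro smooth_S ginv_smooth riemann_smooth)

lemma scalar_curv_smooth: "smooth_on S (\<lambda>y. scalar_curv g y)"
  unfolding scalar_curv_def by (intro smooth_S ginv_smooth ricci_smooth)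

lemma weyl_smooth: "smooth_on S (\<lambda>y. weyl g y i j k l)"
  unfolding weyl_def kn_prod_def divide_inverse
  by (intro smooth_S scalar_curv_smooth riemann_smooth ricci_smooth g_smooth)

lemma det_g_pos:
  assumes "y \<in> S"
  shows "det (g y) > 0"
proof -
  have "sqrt (det (g y)) * det (B y) = 1" by (rule orthonormal_frame.sqrt_det[OF frame[OF assms]])
  then have "sqrt (det (g y)) > 0"
    using orthonormal_frame.det_pos[OF frame[OF assms]] by (metis zero_less_mult_pos2 zero_less_one)
  then show ?thesis by simp
qed

lemma bivector_proj_smooth: "smooth_on S (\<lambda>y. bivector_proj s (g y) \<alpha> $ a $ b)"
proof -
  have "smooth_on S (\<lambda>y. det (g y))"
    unfolding det_4 by (intro smooth_S g_smooth)
  then have "smooth_on S (\<lambda>y. sqrt (det (g y)))"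
    by (intro smooth_on_sqrt open_S det_g_pos)
  then show ?thesis
    unfolding bivector_proj_def hodge_def vol_form_def vector_scaleR_component vector_add_component vec_lambda_beta
      real_scaleR_def
    by (intro smooth_S ginv_smooth)
qed

lemma dual_weyl_smooth: "smooth_on S (\<lambda>y. dual_weyl s g y i j k l)"
  unfolding dual_weyl_def dual_part_def on_bivectors_def
  by (intro smooth_S weyl_smooth bivector_proj_smooth)

lemma christoffel_symmetric:
  assumes "y \<in> S"
  shows "christoffel g y k i j = christoffel g y k j i"
proof -
  have "pd l (\<lambda>y. g y $ i $ j) y = pd l (\<lambda>y. g y $ j $ i) y" for l
    by (rule pd_cong[OF open_S assms]) (rule g_sym)
  then show ?thesis by (simp add: christoffel_def add.commute)
qed

lemma metric_inverse:
  assumes "y \<in> S"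
  shows "(\<Sum>k. g y $ j $ k * ginv (g y) k l) = (if j = l then 1 else 0)"
proof -
  interpret f: orthonormal_frame "g y" "B y" by (rule frame[OF assms])
  have "(\<Sum>k. g y $ j $ k * ginv (g y) k l) = (\<Sum>k a. B y $ l $ a * (B y $ k $ a * g y $ k $ j))"
    unfolding f.ginv_eq sum_distrib_left by (simp add: g_sym[OF assms, of j] ac_simps)
  also have "\<dots> = (\<Sum>a. B y $ l $ a * f.\<theta> a j)"
    unfolding f.\<theta>_def sum_distrib_left by (rule sum.swap)
  finally show ?thesis unfolding f.frame_coframe by auto
qed

lemma christoffel_lower:
  assumes "y \<in> S"
  shows "(\<Sum>k. g y $ j $ k * christoffel g y k p i) =
    1/2 * (pd p (\<lambda>y. g y $ i $ j) y + pd i (\<lambda>y. g y $ p $ j) y - pd j (\<lambda>y. g y $ p $ i) y)"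
proof -
  let ?d = "\<lambda>l. pd p (\<lambda>y. g y $ i $ l) y + pd i (\<lambda>y. g y $ p $ l) y - pd l (\<lambda>y. g y $ p $ i) y"
  have "(\<Sum>k. g y $ j $ k * christoffel g y k p i) = (\<Sum>k l. g y $ j $ k * ginv (g y) k l * (1/2 * ?d l))"
    unfolding christoffel_def sum_distrib_left by (simp only: ac_simps)
  also have "\<dots> = (\<Sum>l. (\<Sum>k. g y $ j $ k * ginv (g y) k l) * (1/2 * ?d l))"
    unfolding sum_distrib_right by (rule sum.swap)
  finally show ?thesis
    unfolding metric_inverse[OF assms]
    by (simp add: if_distrib[of "\<lambda>y. y * _"] if_distrib[of "\<lambda>y. y / 2"] cong: if_cong)
qed

lemma metric_compatible:
  assumes "y \<in> S"
  shows "pd p (\<lambda>y. g y $ i $ j) y =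
    (\<Sum>k. g y $ j $ k * christoffel g y k p i) + (\<Sum>k. g y $ i $ k * christoffel g y k p j)"
proof -
  have "pd l (\<lambda>y. g y $ i $ j) y = pd l (\<lambda>y. g y $ j $ i) y" for l i j
    by (rule pd_cong[OF open_S assms]) (rule g_sym)
  from this[of p j i] show ?thesis
    unfolding christoffel_lower[OF assms] by (simp add: field_simps)
qed

definition "gE i a = germ_at x (\<lambda>y. B y $ i $ a)"
definition "gg i j = germ_at x (\<lambda>y. g y $ i $ j)"
definition "gGam p i k = germ_at x (\<lambda>y. christoffel g y i p k)"
definition "gth a j = (\<Sum>i. gE i a * gg i j)"
definition "gA p a b = (\<Sum>j. gth a j * (D p (gE j b) + (\<Sum>k. gGam p j k * gE k b)))"
definition "gX i = germ_at x (\<lambda>y. y $ i)"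

lemma gg_sym: "gg i j = gg j i"
  unfolding gg_def by (rule germ_at_cong[OF g_smooth g_sym])

lemma gth_gE: "(\<Sum>j. gth a j * gE j b) = (if a = b then 1 else 0)"
proof -
  have "(\<Sum>j. gth a j * gE j b) = germ_at x (\<lambda>y. \<Sum>j. (\<Sum>i. B y $ i $ a * g y $ i $ j) * B y $ j $ b)"
    unfolding gth_def gE_def gg_def by (simp add: germ_push smooth_S B_smooth g_smooth)
  also have "\<dots> = germ_at x (\<lambda>y. if a = b then 1 else 0)"
  proof (rule germ_at_cong)
    fix y assume "y \<in> S"
    then interpret f: orthonormal_frame "g y" "B y" by (rule frame)
    show "(\<Sum>j. (\<Sum>i. B y $ i $ a * g y $ i $ j) * B y $ j $ b) = (if a = b then 1 else 0)"
      using f.coframe_frame unfolding f.\<theta>_def .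
  qed (intro smooth_S B_smooth g_smooth)
  finally show ?thesis by (simp add: germ_at_const)
qed

lemma gE_gth: "(\<Sum>a. gE i a * gth a j) = (if i = j then 1 else 0)"
proof -
  have "(\<Sum>a. gE i a * gth a j) = germ_at x (\<lambda>y. \<Sum>a. B y $ i $ a * (\<Sum>i. B y $ i $ a * g y $ i $ j))"
    unfolding gth_def gE_def gg_def by (simp add: germ_push smooth_S B_smooth g_smooth)
  also have "\<dots> = germ_at x (\<lambda>y. if i = j then 1 else 0)"
  proof (rule germ_at_cong)
    fix y assume "y \<in> S"
    then interpret f: orthonormal_frame "g y" "B y" by (rule frame)
    show "(\<Sum>a. B y $ i $ a * (\<Sum>i. B y $ i $ a * g y $ i $ j)) = (if i = j then 1 else 0)"
      using f.frame_coframe unfolding f.\<theta>_def .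
  qed (intro smooth_S B_smooth g_smooth)
  finally show ?thesis by (simp add: germ_at_const)
qed

lemma D_gg: "D p (gg i j) = (\<Sum>k. gg j k * gGam p k i) + (\<Sum>k. gg i k * gGam p k j)"
proof -
  have "D p (gg i j) = germ_at x (pd p (\<lambda>y. g y $ i $ j))"
    unfolding gg_def by (simp add: germ_at_pd g_smooth)
  also have "\<dots> = germ_at x (\<lambda>y. (\<Sum>k. g y $ j $ k * christoffel g y k p i) + (\<Sum>k. g y $ i $ k * christoffel g y k p j))"
    by (rule germ_at_cong) (auto intro: metric_compatible smooth_S g_smooth)
  finally show ?thesis
    unfolding gg_def gGam_def by (simp add: germ_push smooth_S christoffel_smooth g_smooth)
qed

text \<open>Differentiate the constant products g(e_a, e_b) and replace the derivative of the metric
  by Christoffel symbols.\<close>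

lemma gA_antisym: "gA p a b = - gA p b a"
proof -
  define Y where "Y i b = D p (gE i b) + (\<Sum>k. gGam p i k * gE k b)" for i b
  have A: "gA p a b = (\<Sum>j i. gE i a * gg i j * Y j b)" for a b
    unfolding gA_def gth_def Y_def sum_distrib_right by simp
  have A'': "gA p a b = (\<Sum>i j. gE i a * gg i j * Y j b)"
    unfolding A by (rule sum.swap)
  have A': "gA p b a = (\<Sum>i j. gg i j * gE j b * Y i a)"
    unfolding A by (intro sum.cong refl) (simp add: gg_sym mult.commute)
  have "D p (\<Sum>i j. gE i a * gg i j * gE j b) = D p (\<Sum>j. gth a j * gE j b)"
    unfolding gth_def sum_distrib_right by (subst sum.swap) (rule refl)
  also have "\<dots> = 0" unfolding gth_gE by simp
  also have "D p (\<Sum>i j. gE i a * gg i j * gE j b) =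
      (\<Sum>i j. gE i a * gg i j * D p (gE j b)) + (\<Sum>i j. gg i j * gE j b * D p (gE i a))
      + (\<Sum>i j k. gE i a * gE j b * (gg j k * gGam p k i))
      + (\<Sum>i j k. gE i a * gE j b * (gg i k * gGam p k j))"
    by (simp add: D_gg sum.distrib algebra_simps sum_distrib_left sum_distrib_right)
  also have "(\<Sum>i j k. gE i a * gE j b * (gg i k * gGam p k j))
     = (\<Sum>i j. gE i a * gg i j * (\<Sum>k. gGam p j k * gE k b))"
    unfolding sum_distrib_left
    by (rule sum.cong[OF refl], subst sum.swap, intro sum.cong refl) (simp add: ac_simps)
  also have "(\<Sum>i j k. gE i a * gE j b * (gg j k * gGam p k i))
     = (\<Sum>k i j. gE i a * gE j b * (gg j k * gGam p k i))"
    by (rule sum_rotate3)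
  also have "\<dots> = (\<Sum>k j. gg k j * gE j b * (\<Sum>i. gGam p k i * gE i a))"
    unfolding sum_distrib_left
    by (rule sum.cong[OF refl], subst sum.swap, intro sum.cong refl) (simp add: gg_sym ac_simps)
  finally have "gA p a b + gA p b a = 0"
    unfolding A' A'' Y_def by (simp add: distrib_left sum.distrib ac_simps)
  then show ?thesis by (simp add: eq_neg_iff_add_eq_0)
qed

sublocale frame_calculus gE gth gA gGam gX
proof
  fix p i b a k
  show "gA p a b = - gA p b a" by (rule gA_antisym)
  have "(\<Sum>a. gE i a * gA p a b) = (\<Sum>a j. gE i a * gth a j * (D p (gE j b) + (\<Sum>k. gGam p j k * gE k b)))"
    unfolding gA_def sum_distrib_left by (simp add: mult.assoc)
  also have "\<dots> = (\<Sum>j. (\<Sum>a. gE i a * gth a j) * (D p (gE j b) + (\<Sum>k. gGam p j k * gE k b)))"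
    unfolding sum_distrib_right by (rule sum.swap)
  also have "\<dots> = D p (gE i b) + (\<Sum>k. gGam p i k * gE k b)"
    unfolding gE_gth by (simp add: if_distrib[of "\<lambda>y. y * _"] cong: if_cong)
  finally show "D p (gE i b) = (\<Sum>a. gE i a * gA p a b) - (\<Sum>k. gGam p i k * gE k b)"
    by simp
  show "gGam p i k = gGam k i p"
    unfolding gGam_def by (rule germ_at_cong[OF christoffel_smooth christoffel_symmetric])
  show "(\<Sum>i. gth b i * gE i a) = (if a = b then 1 else 0)"
    unfolding gth_gE by auto
  have 1: "(\<lambda>y :: real^4. y $ i) differentiable (at y)" for y
    by (intro bounded_linear_imp_differentiable bounded_linear_vec_nth)
  have 2: "pd p (\<lambda>y. y $ i) = (\<lambda>y. if p = i then 1 else 0)" for p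
  proof
    fix y
    have "((\<lambda>y :: real^4. y $ i) has_derivative (\<lambda>h. h $ i)) (at y)"
      by (rule bounded_linear_imp_has_derivative[OF bounded_linear_vec_nth])
    then show "pd p (\<lambda>y. y $ i) y = (if p = i then 1 else 0)"
      using pd_eqI[of "\<lambda>y. y $ i" "\<lambda>h. h $ i" y p] by (auto simp: axis_def)
  qed
  have "smooth_on S (\<lambda>y. y $ i)"
    unfolding smooth_on_def
  proof
    fix k show "Ck_on k S (\<lambda>y. y $ i)"
      by (cases k) (auto simp: 1 2 Ck_on_const intro!: continuous_intros)
  qed
  then show "D p (gX i) = (if p = i then 1 else 0)"
    unfolding gX_def by (simp add: germ_at_pd[symmetric] 2 germ_at_const)
qed

end

section \<open>Frame components of coordinate tensor fields and of the curvature\<close>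

context riemannian_chart
begin

definition gT :: "(real^4 \<Rightarrow> tensor4) \<Rightarrow> 4 list \<Rightarrow> germ" where
  "gT T = tensor4 (\<lambda>i j k l. germ_at x (\<lambda>y. T y i j k l))"

lemma conv_gT:
  assumes "\<And>i j k l. smooth_on S (\<lambda>y. T y i j k l)"
  shows "conv gE (gT T) [a, b, c, d] = germ_at x (\<lambda>y. conv (\<lambda>i a. B y $ i $ a) (tensor4 (T y)) [a, b, c, d])"
  unfolding conv4 gT_def gE_def by (simp add: germ_push smooth_S B_smooth assms)

lemma conv_smooth:
  assumes "\<And>i j k l. smooth_on S (\<lambda>y. T y i j k l)"
  shows "smooth_on S (\<lambda>y. conv (\<lambda>i a. B y $ i $ a) (tensor4 (T y)) [a, b, c, d])"
  unfolding conv4 by (intro smooth_S B_smooth assms)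

lemma ev_conv_gT:
  assumes "\<And>i j k l. smooth_on S (\<lambda>y. T y i j k l)"
  shows "ev (conv gE (gT T) [a, b, c, d]) = conv (\<lambda>i a. B x $ i $ a) (tensor4 (T x)) [a, b, c, d]"
  unfolding conv_gT[OF assms] by (rule ev_germ_at[OF conv_smooth[OF assms]])

lemma cov_deriv_smooth:
  assumes "\<And>i j k l. smooth_on S (\<lambda>y. T y i j k l)"
  shows "smooth_on S (\<lambda>y. cov_deriv g T y p i j k l)"
  unfolding cov_deriv_def by (intro smooth_S christoffel_smooth assms)

text \<open>\<open>conv_covariant\<close> with the connection matrices on the frame side and the
  Christoffel symbols on the coordinate side.\<close>

lemma nab_conv_gT:
  assumes T: "\<And>i j k l. smooth_on S (\<lambda>y. T y i j k l)"
  shows "nab c (conv gE (gT T)) [a, b, d, e] = (\<Sum>p. gE p c * conv gE (gT (\<lambda>y. cov_deriv g T y p)) [a, b, d, e])"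
proof -
  have "D p (conv gE (gT T) [a, b, d, e]) - slots (gA p) (conv gE (gT T)) [a, b, d, e]
     = conv gE (gT (\<lambda>y. cov_deriv g T y p)) [a, b, d, e]" for p
  proof -
    have "D p (gT T [i, j, k, l]) - slots (\<lambda>i k. gGam p i k) (gT T) [i, j, k, l] = gT (\<lambda>y. cov_deriv g T y p) [i, j, k, l]" for i j k l
      unfolding gT_def cov_deriv_def gGam_def
      by (simp add: germ_push smooth_S christoffel_smooth T sum.distrib)
    then have "conv gE (\<lambda>as. D p (gT T as) - slots (\<lambda>i k. gGam p i k) (gT T) as) [a, b, d, e]
      = conv gE (gT (\<lambda>y. cov_deriv g T y p)) [a, b, d, e]"
      by (intro conv_cong) (auto simp: length_Suc_conv)
    then show ?thesis
      using conv_covariant[of p gE "gA p" "\<lambda>i k. gGam p i k" "gT T" "[a, b, d, e]"] D_frame by simp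
  qed
  then show ?thesis by (simp only: nab_def)
qed

lemma nabla_scalar: "nabla (\<lambda>_. u) [a] = (\<Sum>p. gE p a * D p u)"
  by (simp add: nab_def)

lemma nabla2_scalar:
  assumes u: "smooth_on S u"
  shows "nabla (nabla (\<lambda>_. germ_at x u)) [a, b] = (\<Sum>p i. gE p a * gE i b * germ_at x (\<lambda>y. hessian g u y p i))"
proof -
  let ?T = "tensor1 (\<lambda>i. germ_at x (pd i u))"
  have "nabla (nabla (\<lambda>_. germ_at x u)) [a, b] = nab a (conv gE ?T) [b]"
    unfolding nabla.simps(2)[of "nabla _"]
    by (rule nab_cong) (auto simp: length_Suc_conv nab_def germ_at_pd u)
  also have "\<dots> = (\<Sum>p. gE p a * conv gE (\<lambda>as. D p (?T as) - slots (\<lambda>i k. gGam p i k) ?T as) [b])"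
    unfolding nab_def
    by (intro sum.cong refl, subst conv_covariant) (rule D_frame, rule refl)
  also have "\<dots> = (\<Sum>p. gE p a * (\<Sum>i. gE i b * germ_at x (\<lambda>y. hessian g u y p i)))"
    unfolding hessian_def gGam_def
    by (simp add: germ_push smooth_S christoffel_smooth u)
  finally show ?thesis by (simp add: sum_distrib_left mult.assoc)
qed

text \<open>The connection matrices are the Christoffel matrices in another gauge, and curvature is
  gauge covariant. This is the integrability condition of the equation \<open>D_frame\<close>,
  obtained from commuting second derivatives of the frame.\<close>

lemma Rm_eq: "Rm d c a b = conv gE (gT (riemann g)) [d, c, a, b]"
proof -
  define Fc where "Fc q p i l = D q (gGam p i l) - D p (gGam q i l)
    + (\<Sum>m. gGam q i m * gGam p m l) - (\<Sum>m. gGam p i m * gGam q m l)" for q p i l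
  have EF: "(\<Sum>a. gE i a * F q p a b) = (\<Sum>l. Fc q p i l * gE l b)" for q p i b
  proof -
    define T1 where "T1 q p = (\<Sum>a m. gE i m * gA q m a * gA p a b)" for q p
    define T2 where "T2 q p = (\<Sum>a k. gGam q i k * gE k a * gA p a b)" for q p
    define T3 where "T3 q p = (\<Sum>a. gE i a * D q (gA p a b))" for q p
    define T4 where "T4 q p = (\<Sum>k. D q (gGam p i k) * gE k b)" for q p
    define T6 where "T6 q p = (\<Sum>k m. gGam p i k * gGam q k m * gE m b)" for q p
    have T2: "(\<Sum>k a. gGam p i k * gE k a * gA q a b) = T2 p q" for q p
      unfolding T2_def by (rule sum.swap)
    have "D q (D p (gE i b)) = T1 q p - T2 q p + T3 q p - T4 q p - T2 p q + T6 q p" for q p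
    proof -
      have "D q (D p (gE i b)) = D q ((\<Sum>a. gE i a * gA p a b) - (\<Sum>k. gGam p i k * gE k b))"
        by (simp only: D_frame[of p i b])
      also have "\<dots> = (\<Sum>a. gE i a * D q (gA p a b)) + (\<Sum>a. D q (gE i a) * gA p a b)
        - (\<Sum>k. gGam p i k * D q (gE k b)) - (\<Sum>k. D q (gGam p i k) * gE k b)"
        by (simp add: sum.distrib algebra_simps)
      finally show ?thesis
        unfolding D_frame[of q] T1_def T2_def T3_def T4_def T6_def
        by (simp add: left_diff_distrib right_diff_distrib sum_distrib_left sum_distrib_right sum_subtractf mult.assoc)
          (rule sum.swap)
    qed
    then have "T1 q p + T3 q p - T4 q p + T6 q p = D q (D p (gE i b)) + (T2 q p + T2 p q)" for q p
      by simp
    \<comment> \<open>The left side and the mixed terms \<open>T2\<close> are symmetric in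
      \<open>q\<close> and \<open>p\<close>, so the rest is symmetric as well.\<close>
    from this[of q p] this[of p q] have T: "T1 q p + T3 q p - T4 q p + T6 q p = T1 p q + T3 p q - T4 p q + T6 p q"
      using D_commute[of q p "gE i b"] add.commute[of "T2 q p" "T2 p q"] by presburger
    have EF: "(\<Sum>a. gE i a * F q p a b) = T3 q p - T3 p q + T1 q p - T1 p q"
    proof -
      have "(\<Sum>a. gE i a * (\<Sum>m. gA q a m * gA p m b)) = T1 q p" for q p
        unfolding T1_def sum_distrib_left by (subst sum.swap) (simp add: mult.assoc)
      then show ?thesis
        unfolding F_def T3_def by (simp add: right_diff_distrib distrib_left sum.distrib sum_subtractf)
    qed
    have "(\<Sum>l. Fc q p i l * gE l b) = T4 q p - T4 p q + T6 p q - T6 q p"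
    proof -
      have "(\<Sum>l. (\<Sum>m. gGam q i m * gGam p m l) * gE l b) = T6 p q" for q p
        unfolding T6_def sum_distrib_right by (subst sum.swap) (simp add: mult.assoc)
      then show ?thesis
        unfolding Fc_def T4_def by (simp add: left_diff_distrib distrib_right sum.distrib sum_subtractf)
    qed
    also have "\<dots> = (T1 q p + T3 q p - T4 q p + T6 q p) - (T1 p q + T3 p q - T4 p q + T6 p q)
        + (T4 q p - T4 p q + T6 p q - T6 q p)"
      unfolding T by simp
    also have "\<dots> = T3 q p - T3 p q + T1 q p - T1 p q" by simp
    finally show ?thesis unfolding EF by simp
  qed
  have F: "F q p a b = (\<Sum>i. gth a i * (\<Sum>l. Fc q p i l * gE l b))" for q p a b
  proof -
    have "(\<Sum>i. gth a i * (\<Sum>a'. gE i a' * F q p a' b)) = (\<Sum>a'. (\<Sum>i. gth a i * gE i a') * F q p a' b)"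
      unfolding sum_distrib_left sum_distrib_right by (subst sum.swap) (simp add: mult.assoc)
    also have "\<dots> = F q p a b"
      unfolding gth_gE by (simp add: if_distrib[of "\<lambda>y. y * _"] cong: if_cong)
    finally show ?thesis unfolding EF by simp
  qed
  have riem: "germ_at x (\<lambda>y. riemann g y q p k l) = (\<Sum>i. gg k i * Fc q p i l)" for q p k l
    unfolding riemann_def Fc_def gg_def gGam_def
    by (simp add: germ_push smooth_S g_smooth christoffel_smooth sum_subtractf add_diff_eq)
  have "F q p a b = (\<Sum>k l. gE k a * gE l b * germ_at x (\<lambda>y. riemann g y q p k l))" for q p
  proof -
    have "F q p a b = (\<Sum>i k l. gE k a * gE l b * (gg k i * Fc q p i l))"
      unfolding F gth_def sum_product by (simp add: sum_distrib_left ac_simps)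
    also have "\<dots> = (\<Sum>k l i. gE k a * gE l b * (gg k i * Fc q p i l))"
      by (rule sum_rotate3[symmetric])
    finally show ?thesis unfolding riem sum_distrib_left .
  qed
  then show ?thesis
    unfolding Rm_def conv4 gT_def by (simp add: sum_distrib_left mult.assoc)
qed

lemma ev_Rm: "ev (Rm a b c d) = conv (\<lambda>i a. B x $ i $ a) (tensor4 (riemann g x)) [a, b, c, d]"
  unfolding Rm_eq by (rule ev_conv_gT[OF riemann_smooth])

lemma Ric_eq: "Ric a c = germ_at x (\<lambda>y. frame2 (B y) (ricci g y) a c)"
proof -
  have "Ric a c = germ_at x (\<lambda>y. \<Sum>b. conv (\<lambda>i a. B y $ i $ a) (tensor4 (riemann g y)) [a, b, c, b])"
    unfolding Ric_def Rm_eq conv_gT[OF riemann_smooth]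
    by (rule germ_at_sum[symmetric]) (rule conv_smooth[OF riemann_smooth])
  also have "\<dots> = germ_at x (\<lambda>y. frame2 (B y) (ricci g y) a c)"
  proof (rule germ_at_cong)
    fix y assume "y \<in> S"
    then interpret f: orthonormal_frame "g y" "B y" by (rule frame)
    show "(\<Sum>b. conv (\<lambda>i a. B y $ i $ a) (tensor4 (riemann g y)) [a, b, c, b]) = frame2 (B y) (ricci g y) a c"
      unfolding f.contraction_frame[symmetric] ricci_def[abs_def] by (rule refl)
  qed (intro smooth_S conv_smooth riemann_smooth)
  finally show ?thesis .
qed

lemma ev_Ric: "ev (Ric a c) = frame2 (B x) (ricci g x) a c"
  unfolding Ric_eq
  by (rule ev_germ_at) (unfold frame2_def, intro smooth_S B_smooth ricci_smooth)

lemma ricci_frame_symmetric: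
  "frame2 (B x) (ricci g x) a c = frame2 (B x) (ricci g x) c a"
  using Ric_symmetric[of a c] by (simp flip: ev_Ric)

lemma germ_om_comp:
  assumes "\<And>i j k l. smooth_on S (\<lambda>y. T y i j k l)"
  shows "germ_at x (\<lambda>y. om_comp s (T y) \<alpha> \<beta>) = om_comp s (\<lambda>i j k l. germ_at x (\<lambda>y. T y i j k l)) \<alpha> \<beta>"
  unfolding om_comp_def om_contract_def by (simp add: germ_push smooth_S assms)

lemma om_comp_smooth:
  assumes "\<And>i j k l. smooth_on S (\<lambda>y. T y i j k l)"
  shows "smooth_on S (\<lambda>y. om_comp s (T y) \<alpha> \<beta>)"
  unfolding om_comp_def om_contract_def by (intro smooth_S assms)

text \<open>With R the scalar curvature, the Ricci term contributes -1/2 * 4 R and the scalar term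
  16/12 R on the diagonal, together -2/3 R.\<close>

lemma weyl_frame:
  assumes s: "s = 1 \<or> s = -1" and y: "y \<in> S"
  defines "r \<equiv> \<lambda>i j k l. conv (\<lambda>i a. B y $ i $ a) (tensor4 (riemann g y)) [i, j, k, l]"
    and "h \<equiv> frame2 (B y) (ricci g y)"
  assumes h_sym: "\<And>i j. h i j = h j i"
  shows "om_comp s (\<lambda>i j k l. conv (\<lambda>i a. B y $ i $ a) (tensor4 (weyl g y)) [i, j, k, l]) \<alpha> \<beta>
    = om_comp s r \<alpha> \<beta> - (if \<alpha> = \<beta> then 2/3 * (\<Sum>i. h i i) else 0)"
proof -
  interpret f: orthonormal_frame "g y" "B y" by (rule frame[OF y])
  let ?\<delta> = "\<lambda>i j :: 4. if i = j then 1 else 0 :: real"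
  have sc: "scalar_curv g y = (\<Sum>i. h i i)"
    unfolding scalar_curv_def h_def by (rule f.trace_frame2)
  have "conv (\<lambda>i a. B y $ i $ a) (tensor4 (weyl g y)) [i, j, k, l]
     = r i j k l - 1/2 * kn_prod h ?\<delta> i j k l + scalar_curv g y / 12 * kn_prod ?\<delta> ?\<delta> i j k l" for i j k l
  proof -
    have "conv (\<lambda>i a. B y $ i $ a) (tensor4 (weyl g y)) [i, j, k, l] = r i j k l
      - 1/2 * conv (\<lambda>i a. B y $ i $ a) (tensor4 (kn_prod (ricci g y) (\<lambda>i j. g y $ i $ j))) [i, j, k, l]
      + scalar_curv g y / 12 * conv (\<lambda>i a. B y $ i $ a) (tensor4 (kn_prod (\<lambda>i j. g y $ i $ j) (\<lambda>i j. g y $ i $ j))) [i, j, k, l]"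
      unfolding r_def conv_cmult[symmetric] conv_diff[symmetric] conv_add[symmetric]
      by (rule conv_cong) (auto simp: length_Suc_conv weyl_def)
    then show ?thesis unfolding f.kn_prod_frame f.metric_frame2 h_def .
  qed
  then have "om_comp s (\<lambda>i j k l. conv (\<lambda>i a. B y $ i $ a) (tensor4 (weyl g y)) [i, j, k, l]) \<alpha> \<beta>
    = om_comp s r \<alpha> \<beta> - 1/2 * om_comp s (kn_prod h ?\<delta>) \<alpha> \<beta> + scalar_curv g y / 12 * om_comp s (kn_prod ?\<delta> ?\<delta>) \<alpha> \<beta>"
    by (simp only: om_comp_add om_comp_diff om_comp_mult)
  also have "om_comp s (kn_prod h ?\<delta>) \<alpha> \<beta> = (if \<alpha> = \<beta> then 4 * (\<Sum>i. h i i) else 0)"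
    by (rule om_comp_kn_prod_metric[OF s h_sym])
  also have "om_comp s (kn_prod ?\<delta> ?\<delta>) \<alpha> \<beta> = (if \<alpha> = \<beta> then 16 else 0)"
  proof -
    have "?\<delta> i j = ?\<delta> j i" for i j by auto
    from om_comp_kn_prod_metric[OF s this, where \<alpha> = \<alpha> and \<beta> = \<beta>] show ?thesis by (simp add: sum_4)
  qed
  finally show ?thesis unfolding sc by auto
qed

end

section \<open>The formula in a chart\<close>

locale soliton_chart = riemannian_chart +
  fixes f :: "real^4 \<Rightarrow> real" and lam :: real
  assumes f_smooth: "smooth_on S f"
    and soliton_on: "y \<in> S \<Longrightarrow> ricci g y i j + hessian g f y i j = lam * g y $ i $ j"
begin

lemma hessian_smooth: "smooth_on S u \<Longrightarrow> smooth_on S (\<lambda>y. hessian g u y i j)"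
  unfolding hessian_def by (intro smooth_S christoffel_smooth)

sublocale frame_soliton gE gth gA gGam gX "germ_at x f" "of_real lam"
proof
  fix a b p
  have "Ric a b + nabla (nabla (\<lambda>_. germ_at x f)) [a, b]
    = germ_at x (\<lambda>y. \<Sum>i j. B y $ i $ a * B y $ j $ b * (ricci g y i j + hessian g f y i j))"
    unfolding nabla2_scalar[OF f_smooth] Ric_eq frame2_def gE_def
    by (simp add: germ_push smooth_S B_smooth ricci_smooth hessian_smooth f_smooth distrib_left sum.distrib)
  also have "\<dots> = germ_at x (\<lambda>y. if a = b then lam else 0)"
  proof (rule germ_at_cong)
    fix y assume y: "y \<in> S"
    then interpret f: orthonormal_frame "g y" "B y" by (rule frame)
    have "(\<Sum>i j. B y $ i $ a * B y $ j $ b * (ricci g y i j + hessian g f y i j))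
      = lam * (\<Sum>i j. B y $ i $ a * B y $ j $ b * g y $ i $ j)"
      unfolding soliton_on[OF y] sum_distrib_left by (simp only: ac_simps)
    then show "(\<Sum>i j. B y $ i $ a * B y $ j $ b * (ricci g y i j + hessian g f y i j)) = (if a = b then lam else 0)"
      unfolding f.metric_frame by simp
  qed (intro smooth_S B_smooth ricci_smooth hessian_smooth f_smooth)
  finally show "Ric a b + nabla (nabla (\<lambda>_. germ_at x f)) [a, b] = (if a = b then of_real lam else 0)"
    by (simp add: germ_at_const del: nabla.simps)
  show "D p (of_real lam) = 0" by simp
qed

lemma W_eq:
  assumes s: "s = 1 \<or> s = -1"
  shows "W s [i, j, k, l] = of_real (1/16) * (\<Sum>\<alpha> \<beta>. of_real (om s \<alpha> i j) * of_real (om s \<beta> k l)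
    * (om_comp s Rm \<alpha> \<beta> - (if \<alpha> = \<beta> then of_real (2/3) * Rsc else 0)))"
proof -
  have c: "of_real (1/16) * of_real (2/3) = (of_real (1/24) :: germ)"
    unfolding of_real_mult[symmetric] by simp
  have "of_real (1/16) * (\<Sum>\<alpha> \<beta>. of_real (om s \<alpha> i j) * of_real (om s \<beta> k l) * (if \<alpha> = \<beta> then of_real (2/3) * Rsc else 0))
    = (of_real (1/16) * of_real (2/3)) * Rsc * dual_id s [i, j, k, l]"
    by (simp add: dual_id_def if_distrib[of "\<lambda>y. _ * y"] sum_distrib_left ac_simps del: of_real_divide cong: if_cong)
  then show ?thesis
    unfolding c W_def proj_pairs_eq
    by (simp add: right_diff_distrib sum_subtractf del: of_real_divide)
qed

text \<open>Identifies the trace-free curvature block \<open>W\<close> with the Weyl part defined in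
  coordinates, as germs, so that derivatives agree too.\<close>

lemma conv_dual_weyl:
  assumes s: "s = 1 \<or> s = -1"
  shows "conv gE (gT (dual_weyl s g)) [a, b, c, d] = W s [a, b, c, d]"
proof -
  define c16 c23 :: real where "c16 = 1/16" and "c23 = 2/3"
  let ?r = "\<lambda>y i j k l. conv (\<lambda>i a. B y $ i $ a) (tensor4 (riemann g y)) [i, j, k, l]"
  let ?h = "\<lambda>y. frame2 (B y) (ricci g y)"
  have h: "smooth_on S (\<lambda>y. ?h y i j)" for i j
    unfolding frame2_def by (intro smooth_S B_smooth ricci_smooth)
  have r: "smooth_on S (\<lambda>y. ?r y i j k l)" for i j k l
    by (rule conv_smooth[OF riemann_smooth])
  have "conv gE (gT (dual_weyl s g)) [a, b, c, d]
    = germ_at x (\<lambda>y. conv (\<lambda>i a. B y $ i $ a) (tensor4 (dual_weyl s g y)) [a, b, c, d])"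
    by (rule conv_gT[OF dual_weyl_smooth])
  also have "\<dots> = germ_at x (\<lambda>y. c16 * (\<Sum>\<alpha> \<beta>. om s \<alpha> a b * om s \<beta> c d
    * (om_comp s (?r y) \<alpha> \<beta> - (if \<alpha> = \<beta> then 1 else 0) * (c23 * (\<Sum>i. ?h y i i)))))"
  proof (rule germ_at_cong[OF conv_smooth[OF dual_weyl_smooth]])
    fix y assume y: "y \<in> S"
    then interpret f: orthonormal_frame "g y" "B y" by (rule frame)
    \<comment> \<open>The symmetry of Ricci is available at the base point only, so the base point
      is moved to \<open>y\<close>.\<close>
    interpret c: riemannian_chart S y g B
      using riemannian_chart_axioms y by (simp add: riemannian_chart_def base_point_def)
    show "conv (\<lambda>i a. B y $ i $ a) (tensor4 (dual_weyl s g y)) [a, b, c, d] = c16 * (\<Sum>\<alpha> \<beta>. om s \<alpha> a b * om s \<beta> c d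
      * (om_comp s (?r y) \<alpha> \<beta> - (if \<alpha> = \<beta> then 1 else 0) * (c23 * (\<Sum>i. ?h y i i))))"
      unfolding dual_weyl_def f.dual_part_eq[OF s] proj_pairs_eq weyl_frame[OF s y c.ricci_frame_symmetric]
      by (intro arg_cong2[where f = "(*)"] sum.cong refl) (auto simp: c16_def c23_def simp del: conv.simps)
  qed
  also have "\<dots> = of_real c16 * (\<Sum>\<alpha> \<beta>. of_real (om s \<alpha> a b) * of_real (om s \<beta> c d)
    * (om_comp s Rm \<alpha> \<beta> - of_real (if \<alpha> = \<beta> then 1 else 0) * (of_real c23 * Rsc)))"
  proof -
    have "Rsc = germ_at x (\<lambda>y. \<Sum>i. ?h y i i)"
      unfolding Rsc_def Ric_eq by (rule germ_at_sum[symmetric]) (rule h)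
    moreover have "om_comp s Rm \<alpha> \<beta> = germ_at x (\<lambda>y. om_comp s (?r y) \<alpha> \<beta>)" for \<alpha> \<beta>
      unfolding germ_om_comp[OF r] Rm_eq conv_gT[OF riemann_smooth] by (rule refl)
    ultimately show ?thesis
      by (simp add: germ_push smooth_S h om_comp_smooth[OF r] del: of_real_divide conv.simps)
  qed
  also have "\<dots> = W s [a, b, c, d]"
    unfolding W_eq[OF s] c16_def[symmetric] c23_def[symmetric] by (intro arg_cong[where f = "\<lambda>x. _ * x"] sum.cong refl) simp
  finally show ?thesis .
qed

lemma nab_of_real_mult: "nab c (\<lambda>as. of_real r * T as) is = of_real r * nab c T is"
  by (simp add: nab_def slots_cmult sum_distrib_left right_diff_distrib mult.left_commute)

lemma ev_pairing: "ev (pairing n U T) = pairing n (\<lambda>as. ev (U as)) (\<lambda>as. ev (T as))"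
  by (induction n arbitrary: U T) auto

lemma ev_om_comp: "ev (om_comp s T \<alpha> \<beta>) = om_comp s (\<lambda>i j k l. ev (T i j k l)) \<alpha> \<beta>"
  by (simp add: om_comp_def om_contract_def)

lemma ev_gE: "ev (gE i a) = B x $ i $ a"
  unfolding gE_def by (rule ev_germ_at[OF B_smooth])

lemma drift_laplacian_germ:
  assumes u: "smooth_on S u"
  shows "drift_laplacian g f u x = ev ((\<Sum>c. nabla (nabla (\<lambda>_. germ_at x u)) [c, c])
     - (\<Sum>a. f1 [a] * nabla (\<lambda>_. germ_at x u) [a]))"
proof -
  interpret f: orthonormal_frame "g x" "B x" by (rule frame[OF x_in_S])
  have "ev (nabla (nabla (\<lambda>_. germ_at x u)) [a, b]) = frame2 (B x) (hessian g u x) a b" for a b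
    unfolding nabla2_scalar[OF u] by (simp add: ev_gE frame2_def hessian_smooth[OF u])
  then have 1: "laplacian g u x = (\<Sum>c. ev (nabla (nabla (\<lambda>_. germ_at x u)) [c, c]))"
    unfolding laplacian_def f.trace_frame2 by simp
  have 2: "ev (nabla (\<lambda>_. germ_at x v) [a]) = (\<Sum>p. B x $ p $ a * pd p v x)" if "smooth_on S v" for v a
    unfolding nabla_scalar by (simp add: ev_gE germ_at_pd[symmetric] that smooth_on_pd)
  have "(\<Sum>i j. ginv (g x) i j * pd i f x * pd j u x) = (\<Sum>a. frame2 (B x) (\<lambda>i j. pd i f x * pd j u x) a a)"
    unfolding f.trace_frame2[symmetric] by (simp add: mult.assoc)
  also have "\<dots> = (\<Sum>a. ev (f1 [a]) * ev (nabla (\<lambda>_. germ_at x u) [a]))"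
    unfolding 2[OF u] 2[OF f_smooth] frame2_def sum_product by (simp add: ac_simps)
  finally show ?thesis unfolding drift_laplacian_def 1 by simp
qed

lemma cov_deriv_norm2_germ:
  assumes s: "s = 1 \<or> s = -1"
  shows "cov_deriv_norm2 g (dual_weyl s g) x = 1/4 * (\<Sum>c. ev (pairing 4 (nab c (W s)) (nab c (W s))))"
proof -
  interpret f: orthonormal_frame "g x" "B x" by (rule frame[OF x_in_S])
  let ?c = "\<lambda>p. conv (\<lambda>i a. B x $ i $ a) (tensor4 (cov_deriv g (dual_weyl s g) x p))"
  have W: "ev (nab c (W s) [i, j, k, l]) = (\<Sum>p. B x $ p $ c * ?c p [i, j, k, l])" for c i j k l
  proof -
    have "nab c (W s) [i, j, k, l] = nab c (conv gE (gT (dual_weyl s g))) [i, j, k, l]"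
      by (rule nab_cong) (auto simp: length_Suc_conv conv_dual_weyl[OF s] simp del: conv.simps)
    then show ?thesis
      unfolding nab_conv_gT[OF dual_weyl_smooth]
      by (simp add: ev_gE ev_conv_gT[OF cov_deriv_smooth[OF dual_weyl_smooth]] del: conv.simps)
  qed
  have "ev (pairing 4 (nab c (W s)) (nab c (W s))) = frame2 (B x) (\<lambda>p q. pairing 4 (?c p) (?c q)) c c" for c
  proof -
    have "ev (pairing 4 (nab c (W s)) (nab c (W s)))
      = pairing 4 (\<lambda>as. \<Sum>p. B x $ p $ c * ?c p as) (\<lambda>as. \<Sum>p. B x $ p $ c * ?c p as)"
      unfolding ev_pairing by (rule pairing_cong) (auto simp: length_Suc_conv eval_nat_numeral W simp del: conv.simps)
    also have "\<dots> = frame2 (B x) (\<lambda>p q. pairing 4 (?c p) (?c q)) c c"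
      unfolding pairing_sum pairing_sum_right pairing_cmult pairing_mult_right frame2_def by (simp add: ac_simps sum_distrib_left)
    finally show ?thesis .
  qed
  then have "1/4 * (\<Sum>c. ev (pairing 4 (nab c (W s)) (nab c (W s))))
    = 1/4 * (\<Sum>p q. ginv (g x) p q * pairing 4 (?c p) (?c q))"
    unfolding f.trace_frame2 by simp
  then show ?thesis
    unfolding cov_deriv_norm2_def f.tensor_inner_eq by (simp add: sum_distrib_left ac_simps)
qed

lemma norm2_germ:
  assumes s: "s = 1 \<or> s = -1"
  defines "N \<equiv> \<lambda>y. tensor_norm2 (g y) (dual_weyl s g y)"
  shows "smooth_on S N" "germ_at x N = of_real (1/4) * pairing 4 (W s) (W s)"
proof -
  define c4 :: real where "c4 = 1/4"
  let ?w = "\<lambda>y. conv (\<lambda>i a. B y $ i $ a) (tensor4 (dual_weyl s g y))"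
  have N: "N y = c4 * (\<Sum>a b c d. ?w y [a, b, c, d] * ?w y [a, b, c, d])" if "y \<in> S" for y
    unfolding N_def orthonormal_frame.tensor_inner_eq[OF frame[OF that]] c4_def by (simp add: numeral_eq_Suc del: conv.simps)
  have w: "smooth_on S (\<lambda>y. ?w y [a, b, c, d])" for a b c d
    by (rule conv_smooth[OF dual_weyl_smooth])
  show 1: "smooth_on S N"
    by (subst smooth_on_cong[OF open_S N]) (auto intro!: smooth_S w simp del: conv.simps)
  have "germ_at x N = germ_at x (\<lambda>y. c4 * (\<Sum>a b c d. ?w y [a, b, c, d] * ?w y [a, b, c, d]))"
    by (rule germ_at_cong[OF 1 N])
  also have "\<dots> = of_real c4 * (\<Sum>a b c d. W s [a, b, c, d] * W s [a, b, c, d])"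
    unfolding conv_dual_weyl[OF s, symmetric] conv_gT[OF dual_weyl_smooth]
    by (simp add: germ_push smooth_S w del: conv.simps of_real_divide)
  finally show "germ_at x N = of_real (1/4) * pairing 4 (W s) (W s)"
    by (simp add: numeral_eq_Suc c4_def)
qed

text \<open>Evaluation at the point makes the algebraic identities for real tensors
  applicable.\<close>

sublocale curvature_tensor "\<lambda>i j k l. ev (Rm i j k l)"
proof
  fix i j k l
  show "ev (Rm i j k l) = - ev (Rm j i k l)" using Rm_antisym(1)[of i j k l] by simp
  show "ev (Rm i j k l) = ev (Rm k l i j)" using Rm_pair_symmetric[of i j k l] by simp
  have "Rm i j k l + Rm j k i l + Rm k i j l = 0"
  proof -
    have "Rm i j k l + Rm j k i l + Rm k i j l = - (Rm i j l k + Rm j k l i + Rm k i l j)"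
      using Rm_antisym(2)[of i j k l] Rm_antisym(2)[of j k i l] Rm_antisym(2)[of k i j l] by simp
    then show ?thesis using bianchi1[of i j l k] by simp
  qed
  then show "ev (Rm i j k l) + ev (Rm j k i l) + ev (Rm k i j l) = 0"
    by (metis ev_0 ev_add)
qed

lemma ric_frame2: "ric a b = frame2 (B x) (ricci g x) a b"
  unfolding ev_Ric[symmetric] ric_def Ric_def by simp

lemma w_eq:
  assumes s: "s = 1 \<or> s = -1"
  shows "ev (om_comp s (W4 s) \<alpha> \<beta>) = 8 * w s \<alpha> \<beta>"
  unfolding om_comp_W[OF s] w_def Rsc_def
  by (simp add: ev_om_comp ric_frame2 ev_Ric)

theorem chart_formula:
  assumes s: "s = 1 \<or> s = -1"
  shows "drift_laplacian g f (\<lambda>y. tensor_norm2 (g y) (dual_weyl s g y)) x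
    = 2 * cov_deriv_norm2 g (dual_weyl s g) x + 4 * lam * tensor_norm2 (g x) (dual_weyl s g x)
      - 36 * dual_det s (g x) (weyl g x)
      - tensor_inner (g x) (dual_part s (g x) (kn_prod (ricci g x) (ricci g x))) (dual_weyl s g x)"
proof -
  interpret f: orthonormal_frame "g x" "B x" by (rule frame[OF x_in_S])
  define N where "N = (\<lambda>y. tensor_norm2 (g y) (dual_weyl s g y))"
  define u where "u = pairing 4 (W s) (W s)"
  have N: "smooth_on S N" "germ_at x N = of_real (1/4) * u"
    using norm2_germ[OF s] unfolding N_def u_def by auto
  let ?k = "om_comp s (kn_prod ric ric)"
  have 1: "nabla (\<lambda>_. of_real (1/4) * u) [a] = of_real (1/4) * nabla (\<lambda>_. u) [a]" for a
    unfolding nabla.simps by (rule nab_of_real_mult)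
  have 2: "nabla (nabla (\<lambda>_. of_real (1/4) * u)) [a, b] = of_real (1/4) * nabla (nabla (\<lambda>_. u)) [a, b]" for a b
    unfolding nabla.simps(2)[of "nabla _"] nab_of_real_mult[symmetric]
    by (rule nab_cong) (use 1 in \<open>auto simp: length_Suc_conv\<close>)
  have "drift_laplacian g f N x = ev (of_real (1/4) *
     ((\<Sum>c. nabla (nabla (\<lambda>_. u)) [c, c]) - (\<Sum>a. f1 [a] * nabla (\<lambda>_. u) [a])))"
    unfolding drift_laplacian_germ[OF N(1)] N(2) 1 2
    by (simp add: right_diff_distrib sum_distrib_left mult.left_commute del: nabla.simps of_real_divide)
  \<comment> \<open>The leading 1/4 is the factor in the inner product of (0,4)-tensors; 8 passes
    from \<open>om_comp\<close> to the orthonormal basis.\<close>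
  also have "\<dots> = 1/4 * (2 * (\<Sum>c. ev (pairing 4 (nab c (W s)) (nab c (W s)))) + 4 * lam * ev u
      + 1/4 * (\<Sum>\<alpha> \<beta>. om_comp s q \<alpha> \<beta> * (8 * w s \<alpha> \<beta>)))"
  proof -
    have "ev (om_comp s Q \<alpha> \<beta>) = om_comp s q \<alpha> \<beta>" for \<alpha> \<beta>
    proof -
      have "(\<lambda>i j k l. ev (Q i j k l)) = q" by (intro ext) (simp add: Q_def q_def)
      then show ?thesis unfolding ev_om_comp by simp
    qed
    moreover have "ev 2 = 2" "ev 4 = 4" using ev_of_real[of 2] ev_of_real[of 4] by simp_all
    ultimately show ?thesis
      unfolding frame_formula[OF s u_def] by (simp add: w_eq[OF s] mult.assoc del: of_real_divide)
  qed
  also have "\<dots> = 1/2 * (\<Sum>c. ev (pairing 4 (nab c (W s)) (nab c (W s)))) + lam * ev u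
      + 1/2 * (\<Sum>\<alpha> \<beta>. w s \<alpha> \<beta> * om_comp s q \<alpha> \<beta>)"
    by (simp add: sum_distrib_left algebra_simps)
  \<comment> \<open>With the coefficient 1/2 in front, -72 becomes -36.\<close>
  also have "(\<Sum>\<alpha> \<beta>. w s \<alpha> \<beta> * om_comp s q \<alpha> \<beta>)
      = -72 * det (\<chi> \<alpha> \<beta>. w s \<alpha> \<beta>) - 1/4 * (\<Sum>\<alpha> \<beta>. w s \<alpha> \<beta> * ?k \<alpha> \<beta>)"
    unfolding reaction_identity[OF s, symmetric]
    by (simp add: distrib_left sum.distrib sum_distrib_left)
  also have "det (\<chi> \<alpha> \<beta>. w s \<alpha> \<beta>) = dual_det s (g x) (weyl g x)"
  proof -
    have "om_comp s (\<lambda>i j k l. conv (\<lambda>i a. B x $ i $ a) (tensor4 (weyl g x)) [i, j, k, l]) \<alpha> \<beta> / 8 = w s \<alpha> \<beta>" for \<alpha> \<beta>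
      unfolding weyl_frame[OF s x_in_S ricci_frame_symmetric] ev_Rm[symmetric] w_def ric_frame2
      by (simp add: field_simps)
    then show ?thesis unfolding f.dual_det_eq[OF s] by simp
  qed
  \<comment> \<open>The inner product carries 1/4, the contraction 1/16 and the matrix of W^+- the
    factor 8, in total 1/8. Thus -1/2 * 1/4 * 8 gives the coefficient -1 of the Ricci term.\<close>
  also have "(\<Sum>\<alpha> \<beta>. w s \<alpha> \<beta> * ?k \<alpha> \<beta>)
      = 8 * tensor_inner (g x) (dual_part s (g x) (kn_prod (ricci g x) (ricci g x))) (dual_weyl s g x)"
  proof -
    let ?c = "\<lambda>T. conv (\<lambda>i a. B x $ i $ a) (tensor4 T)"
    have "?c (dual_weyl s g x) [i, j, k, l] = ev (W4 s i j k l)" for i j k l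
      unfolding conv_dual_weyl[OF s, symmetric] by (rule ev_conv_gT[OF dual_weyl_smooth, symmetric])
    then have W: "om_comp s (\<lambda>i j k l. ?c (dual_weyl s g x) [i, j, k, l]) \<alpha> \<beta> = 8 * w s \<alpha> \<beta>" for \<alpha> \<beta>
      unfolding w_eq[OF s, symmetric] ev_om_comp by simp
    have k: "om_comp s (\<lambda>i j k l. ?c (kn_prod (ricci g x) (ricci g x)) [i, j, k, l]) = ?k"
      unfolding f.kn_prod_frame ric_frame2[abs_def] by simp
    have "tensor_inner (g x) (dual_part s (g x) (kn_prod (ricci g x) (ricci g x))) (dual_weyl s g x)
      = 1/4 * pairing 4 (proj_pairs s (?c (kn_prod (ricci g x) (ricci g x)))) (?c (dual_weyl s g x))"
      unfolding f.tensor_inner_eq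
      by (intro arg_cong[where f = "\<lambda>x. 1/4 * x"] pairing_cong)
        (auto simp: length_Suc_conv eval_nat_numeral f.dual_part_eq[OF s] simp del: conv.simps)
    then show ?thesis
      unfolding pairing_proj_pairs_eq W k by (simp add: sum_distrib_left mult.commute)
  qed
  finally have "drift_laplacian g f N x = 1/2 * (\<Sum>c. ev (pairing 4 (nab c (W s)) (nab c (W s)))) + lam * ev u
    - 36 * dual_det s (g x) (weyl g x)
    - tensor_inner (g x) (dual_part s (g x) (kn_prod (ricci g x) (ricci g x))) (dual_weyl s g x)"
    by simp
  moreover have "ev u = 4 * N x"
    using ev_germ_at[OF N(1)] unfolding N(2) by simp
  ultimately show ?thesis
    unfolding cov_deriv_norm2_germ[OF s] N_def by simp
qed

end

section \<open>The formula on the manifold\<close>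

theorem corollary1p2:
  fixes M :: "'m topology" and \<A> :: "'m chart set" and g :: "'m chart \<Rightarrow> metric_coeffs"
    and f :: "'m \<Rightarrow> real" and lam s :: real and c :: "'m chart" and p :: 'm
  assumes "gradient_ricci_soliton_4 M \<A> g f lam"
    and "s = 1 \<or> s = -1"
    and "c \<in> \<A>" and "p \<in> fst c"
  defines "x \<equiv> snd c p"
  shows "drift_laplacian (g c) (f \<circ> chart_inv c)
           (\<lambda>y. tensor_norm2 (g c y) (dual_weyl s (g c) y)) x
         = 2 * cov_deriv_norm2 (g c) (dual_weyl s (g c)) x
           + 4 * lam * tensor_norm2 (g c x) (dual_weyl s (g c) x)
           - 36 * dual_det s (g c x) (weyl (g c) x)
           - tensor_inner (g c x)
               (dual_part s (g c x) (kn_prod (ricci (g c) x) (ricci (g c) x)))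
               (dual_weyl s (g c) x)"
proof -
  interpret M: gradient_ricci_soliton_4 M \<A> g f lam by (rule assms(1))
  note c = \<open>c \<in> \<A>\<close>
  \<comment> \<open>One frame over the whole chart image exists, since Gram-Schmidt starts from the
    coordinate frame.\<close>
  obtain B where B: "\<And>i a. smooth_on (chart_image c) (\<lambda>y. B y $ i $ a)"
    "\<And>y. y \<in> chart_image c \<Longrightarrow> orthonormal_frame (g c y) (B y)"
    using orthonormal_frame_exists[OF M.chart_image_open[OF c] M.metric_smooth[OF c]
        M.metric_symmetric[OF c] M.metric_positive[OF c]] by blast
  have "x \<in> chart_image c"
    using assms(4) by (simp add: x_def chart_image_def)
  then interpret soliton_chart "chart_image c" x "g c" B "f \<circ> chart_inv c" lam
    by (intro soliton_chart.intro riemannian_chart.intro base_point.intro riemannian_chart_axioms.intro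
        soliton_chart_axioms.intro M.chart_image_open[OF c] M.metric_smooth[OF c]
        M.metric_symmetric[OF c] M.potential_smooth[OF c] M.soliton_eq[OF c] B)
  show ?thesis by (rule chart_formula[OF assms(2)])
qed

end
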